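(* Let $(\mathbf{X}_t)_{t\in\mathbb{Z}}$ be a strictly stationary $\mathbb{R}^d$-valued sequence that is regularly varying with index $\alpha>0$. Let $C\subset\overline{\mathbb{R}}_0^d$ be a Borel set bounded away from zero with $\mu(\partial C)=0$, and suppose that for every $h\ge 1$ the set $C\times\overline{\mathbb{R}}^{d(h-1)}\times C\subset\overline{\mathbb{R}}_0^{(h+1)d}$ is a continuity set of $\nu_{h+1}$. Suppose that $(\mathbf{X}_t)$ is $\alpha$-mixing with rate function $(\alpha_h)$ and that there are integer sequences $m_n,r_n\to\infty$ with $m_n/n\to0$, $r_n/m_n\to0$, $$\lim_{n\to\infty}m_n\sum_{h=r_n}^{\infty}\alpha_h=0,$$ and, for all $\epsilon>0$, $$\lim_{k\to\infty}\limsup_{n\to\infty}m_n\sum_{h=k}^{r_n}P(|\mathbf{X}_h|>\epsilon a_{m_n},\,|\mathbf{X}_0|>\epsilon a_{m_n})=0.$$ Put $k_n=n/m_n$ and suppose in addition that $k_n\alpha_{r_n}\to0$ and that at least one of the following holds: (i) $m_n=o(n^{1/3})$; (ii) $\displaystyle\frac{m_n^4}{n}\sum_{j=r_n}^{m_n}\alpha_j\to0$ and $\displaystyle\frac{m_nr_n^3}{n}\to0$. Let $\widehat P_m(C)=\frac{m_n}{n}\sum_{t=1}^n I_{\{\mathbf{X}_t/a_{m_n}\in C\}}$. Then $$S_n=\Big(\frac{n}{m_n}\Big)^{1/2}\big[\widehat P_m(C)-m_nP(a_{m_n}^{-1}\mathbf{X}_0\in C)\big]=\Big(\frac{m_n}{n}\Big)^{1/2}\sum_{t=1}^n\big(I_{\{\mathbf{X}_t/a_{m_n}\in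 C\}}-P(a_{m_n}^{-1}\mathbf{X}_0\in C)\big)\xrightarrow{d}N(0,\sigma^2(C)),$$ where $$\sigma^2(C)=\mu(C)+2\sum_{h=1}^\infty\tau_h(C),\qquad \tau_h(C)=\nu_{h+1}\big(C\times\overline{\mathbb{R}}^{d(h-1)}\times C\big).$$
   Context: Notation: $\overline{\mathbb{R}}=\mathbb{R}\cup\{\pm\infty\}$, $\overline{\mathbb{R}}_0^{k}=\overline{\mathbb{R}}^{k}\setminus\{\mathbf 0\}$; a set is bounded away from zero if it is contained in $\{\mathbf{x}:|\mathbf{x}|>\epsilon\}$ for some $\epsilon>0$. $I$ denotes an indicator. Regular variation: a strictly stationary $\mathbb{R}^d$-valued sequence $(\mathbf{X}_t)$ is regularly varying with index $\alpha>0$ if for every $h\ge1$ the lagged vector $\mathbf{Y}_h=\mathrm{vec}(\mathbf{X}_1,\dots,\mathbf{X}_h)$ satisfies, as $x\to\infty$, $$\frac{P(x^{-1}\mathbf{Y}_h\in\cdot)}{P(|\mathbf{Y}_h|>x)}\xrightarrow{v}\mu_h(\cdot)$$ (vague convergence on $\overline{\mathbb{R}}_0^{hd}$) for some non-null Radon measure $\mu_h$ on $\overline{\mathbb{R}}_0^{hd}$ with $\mu_h(tB)=t^{-\alpha}\mu_h(B)$ for all $t>0$ and Borel sets $B$. Let $(a_n)$ be a sequence with $a_n\uparrow\infty$ and $P(|\mathbf{X}_0|>a_n)\sim n^{-1}$. Then for every $h\ge1$, $nP(a_n^{-1}\mathbf{Y}_h\in\cdot)\xrightarrow{v}\nu_h(\cdot)=c_h\mu_h(\cdot)$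 for some constant $c_h>0$; we write $\mu=\mu_1=\nu_1$. Mixing: $(\mathbf{X}_t)$ is $\alpha$-mixing with rate function $(\alpha_h)$ if $\alpha_h=\sup\{|P(A\cap B)-P(A)P(B)|:A\in\sigma(\mathbf{X}_s,s\le0),\,B\in\sigma(\mathbf{X}_s,s\ge h)\}\to0$ as $h\to\infty$. $N(0,0)$ is the point mass at $0$. *)

theory Defs
  imports "HOL-Probability.Probability" "HOL-Library.Landau_Symbols"
begin

section \<open>Radon measures and vague convergence\<close>

definition borel_of :: "'a topology \<Rightarrow> 'a measure" where
  "borel_of T = sigma (topspace T) {U. openin T U}"

text \<open>
  On the locally compact second countable spaces used below, a Borel measure that is finite on
  compact sets is automatically regular, so nothing more is required of a Radon measure.
\<close>

definition radon_measure :: "'a topology \<Rightarrow> 'a measure \<Rightarrow> bool" where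
  "radon_measure T N \<longleftrightarrow>
     space N = topspace T \<and> sets N = sets (borel_of T) \<and>
     (\<forall>K. compactin T K \<longrightarrow> emeasure N K < \<infinity>)"

definition vague_conv ::
    "'a topology \<Rightarrow> ('b \<Rightarrow> 'a measure) \<Rightarrow> 'a measure \<Rightarrow> 'b filter \<Rightarrow> bool" where
  "vague_conv T Ns N F \<longleftrightarrow>
     (\<forall>f :: 'a \<Rightarrow> real.
        continuous_map T euclideanreal f \<and> compactin T (T closure_of {x \<in> topspace T. f x \<noteq> 0})
        \<longrightarrow> ((\<lambda>i. integral\<^sup>L (Ns i) f) \<longlongrightarrow> integral\<^sup>L N f) F)"

text \<open>
  On a locally compact second countable Hausdorff space a vague limit is unique whenever it exists,
  so the choice below is not a real one.
\<close>

definition vague_limit :: "'a topology \<Rightarrow> ('b \<Rightarrow> 'a measure) \<Rightarrow> 'b filter \<Rightarrow> 'a measure" where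
  "vague_limit T Ns F = (SOME N. radon_measure T N \<and> vague_conv T Ns N F)"

definition continuity_set :: "'a topology \<Rightarrow> 'a measure \<Rightarrow> 'a set \<Rightarrow> bool" where
  "continuity_set T N B \<longleftrightarrow> B \<in> sets N \<and> emeasure N (T frontier_of B) = 0"


section \<open>Extended vectors and blocks of extended vectors\<close>

definition ext_vec :: "real ^ 'd \<Rightarrow> ereal ^ 'd" where
  "ext_vec x = (\<chi> i. ereal (x $ i))"

definition ext_norm :: "ereal ^ 'd \<Rightarrow> ereal" where
  "ext_norm x =
     (if \<forall>i. \<bar>x $ i\<bar> \<noteq> \<infinity> then ereal (norm (\<chi> i. real_of_ereal (x $ i))) else \<infinity>)"

definition bounded_away_from_zero :: "(ereal ^ 'd) set \<Rightarrow> bool" where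
  "bounded_away_from_zero C \<longleftrightarrow> (\<exists>\<epsilon>>0. C \<subseteq> {x. ext_norm x > ereal \<epsilon>})"

text \<open>
  The number of lags \<open>h\<close> varies, so the extended real space of dimension \<open>h * CARD('d)\<close> is
  represented by the extensional functions from \<open>{1..h}\<close> to \<open>ereal ^ 'd\<close> with the product topology.
\<close>

definition block_top :: "nat \<Rightarrow> (nat \<Rightarrow> ereal ^ 'd) topology" where
  "block_top h = product_topology (\<lambda>_. euclidean) {1..h}"

definition block_top0 :: "nat \<Rightarrow> (nat \<Rightarrow> ereal ^ 'd) topology" where
  "block_top0 h = subtopology (block_top h) (topspace (block_top h) - {\<lambda>i\<in>{1..h}. 0})"

definition block_scale :: "nat \<Rightarrow> real \<Rightarrow> (nat \<Rightarrow> ereal ^ 'd) \<Rightarrow> (nat \<Rightarrow> ereal ^ 'd)" where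
  "block_scale h t y = (\<lambda>i\<in>{1..h}. \<chi> j. ereal t * y i $ j)"

text \<open>The product set with \<open>C\<close> as first and last of \<open>h + 1\<close> factors and no other restriction.\<close>

definition ends_in :: "nat \<Rightarrow> (ereal ^ 'd) set \<Rightarrow> (nat \<Rightarrow> ereal ^ 'd) set" where
  "ends_in h C = (\<Pi>\<^sub>E i\<in>{1..h + 1}. if i = 1 \<or> i = h + 1 then C else UNIV)"


section \<open>Stationarity, regular variation, mixing\<close>

definition strictly_stationary :: "'a measure \<Rightarrow> (int \<Rightarrow> 'a \<Rightarrow> real ^ 'd) \<Rightarrow> bool" where
  "strictly_stationary M X \<longleftrightarrow>
     (\<forall>t. X t \<in> borel_measurable M) \<and>
     (\<forall>J k. finite J \<longrightarrow>
        distr M (\<Pi>\<^sub>M t\<in>J. borel) (\<lambda>\<omega>. \<lambda>t\<in>J. X (t + k) \<omega>) =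
        distr M (\<Pi>\<^sub>M t\<in>J. borel) (\<lambda>\<omega>. \<lambda>t\<in>J. X t \<omega>))"

definition lagged_norm :: "(int \<Rightarrow> 'a \<Rightarrow> real ^ 'd) \<Rightarrow> nat \<Rightarrow> 'a \<Rightarrow> real" where
  "lagged_norm X h \<omega> = L2_set (\<lambda>i. norm (X (int i) \<omega>)) {1..h}"

definition lagged_scaled :: "(int \<Rightarrow> 'a \<Rightarrow> real ^ 'd) \<Rightarrow> nat \<Rightarrow> real \<Rightarrow> 'a \<Rightarrow> (nat \<Rightarrow> ereal ^ 'd)" where
  "lagged_scaled X h x \<omega> = (\<lambda>i\<in>{1..h}. ext_vec (inverse x *\<^sub>R X (int i) \<omega>))"

text \<open>The measure \<open>P(x\<^sup>-\<^sup>1 Y\<^sub>h \<in> \<cdot>)\<close>, restricted to the punctured space.\<close>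

definition lagged_law ::
    "'a measure \<Rightarrow> (int \<Rightarrow> 'a \<Rightarrow> real ^ 'd) \<Rightarrow> nat \<Rightarrow> real \<Rightarrow> (nat \<Rightarrow> ereal ^ 'd) measure" where
  "lagged_law M X h x =
     restrict_space (distr M (borel_of (block_top h)) (lagged_scaled X h x))
       (topspace (block_top0 h))"

definition regularly_varying :: "'a measure \<Rightarrow> (int \<Rightarrow> 'a \<Rightarrow> real ^ 'd) \<Rightarrow> real \<Rightarrow> bool" where
  "regularly_varying M X \<alpha> \<longleftrightarrow> \<alpha> > 0 \<and>
     (\<forall>h\<ge>1. \<exists>\<mu>\<^sub>h.
        radon_measure (block_top0 h) \<mu>\<^sub>h \<and>
        emeasure \<mu>\<^sub>h (space \<mu>\<^sub>h) \<noteq> 0 \<and>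
        (\<forall>t>0. \<forall>B\<in>sets \<mu>\<^sub>h.
           emeasure \<mu>\<^sub>h (block_scale h t ` B) = ennreal (t powr - \<alpha>) * emeasure \<mu>\<^sub>h B) \<and>
        vague_conv (block_top0 h)
          (\<lambda>x. scale_measure (ennreal (1 / measure M {\<omega> \<in> space M. lagged_norm X h \<omega> > x}))
                 (lagged_law M X h x))
          \<mu>\<^sub>h at_top)"

definition tail_measure ::
    "'a measure \<Rightarrow> (int \<Rightarrow> 'a \<Rightarrow> real ^ 'd) \<Rightarrow> (nat \<Rightarrow> real) \<Rightarrow> nat \<Rightarrow> (nat \<Rightarrow> ereal ^ 'd) measure" where
  "tail_measure M X a h =
     vague_limit (block_top0 h)
       (\<lambda>n. scale_measure (ennreal (real n)) (lagged_law M X h (a n))) sequentially"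

text \<open>The measure \<open>\<nu>\<^sub>1\<close>, transported from blocks of length one to vectors.\<close>

definition tail_measure1 ::
    "'a measure \<Rightarrow> (int \<Rightarrow> 'a \<Rightarrow> real ^ 'd) \<Rightarrow> (nat \<Rightarrow> real) \<Rightarrow> (ereal ^ 'd) measure" where
  "tail_measure1 M X a =
     distr (tail_measure M X a 1) (borel_of (top_of_set (- {0}))) (\<lambda>y. y 1)"

definition generated_events ::
    "'a measure \<Rightarrow> (int \<Rightarrow> 'a \<Rightarrow> real ^ 'd) \<Rightarrow> int set \<Rightarrow> 'a set set" where
  "generated_events M X T =
     sigma_sets (space M) (\<Union>s\<in>T. {X s -` B \<inter> space M | B. B \<in> sets borel})"

definition mixing_rate :: "'a measure \<Rightarrow> (int \<Rightarrow> 'a \<Rightarrow> real ^ 'd) \<Rightarrow> nat \<Rightarrow> real" where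
  "mixing_rate M X h =
     Sup {\<bar>measure M (A \<inter> B) - measure M A * measure M B\<bar> | A B.
            A \<in> generated_events M X {..0} \<and> B \<in> generated_events M X {int h..}}"

definition alpha_mixing :: "'a measure \<Rightarrow> (int \<Rightarrow> 'a \<Rightarrow> real ^ 'd) \<Rightarrow> bool" where
  "alpha_mixing M X \<longleftrightarrow> mixing_rate M X \<longlonglongrightarrow> 0"


section \<open>The estimator and its limit law\<close>

definition exceed :: "(int \<Rightarrow> 'a \<Rightarrow> real ^ 'd) \<Rightarrow> real \<Rightarrow> (ereal ^ 'd) set \<Rightarrow> int \<Rightarrow> 'a set" where
  "exceed X u C t = {\<omega>. ext_vec (inverse u *\<^sub>R X t \<omega>) \<in> C}"

definition P_hat ::
    "(int \<Rightarrow> 'a \<Rightarrow> real ^ 'd) \<Rightarrow> (nat \<Rightarrow> real) \<Rightarrow> (nat \<Rightarrow> nat) \<Rightarrow> (ereal ^ 'd) set \<Rightarrow> nat \<Rightarrow> 'a \<Rightarrow> real" where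
  "P_hat X a m C n \<omega> =
     real (m n) / real n * (\<Sum>t=1..n. indicator (exceed X (a (m n)) C (int t)) \<omega>)"

definition S_stat ::
    "'a measure \<Rightarrow> (int \<Rightarrow> 'a \<Rightarrow> real ^ 'd) \<Rightarrow> (nat \<Rightarrow> real) \<Rightarrow> (nat \<Rightarrow> nat) \<Rightarrow> (ereal ^ 'd) set \<Rightarrow> nat \<Rightarrow> 'a \<Rightarrow> real" where
  "S_stat M X a m C n \<omega> =
     sqrt (real n / real (m n)) *
       (P_hat X a m C n \<omega> - real (m n) * measure M (exceed X (a (m n)) C 0 \<inter> space M))"

definition tau ::
    "'a measure \<Rightarrow> (int \<Rightarrow> 'a \<Rightarrow> real ^ 'd) \<Rightarrow> (nat \<Rightarrow> real) \<Rightarrow> (ereal ^ 'd) set \<Rightarrow> nat \<Rightarrow> real" where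
  "tau M X a C h = measure (tail_measure M X a (h + 1)) (ends_in h C)"

definition sigma2 ::
    "'a measure \<Rightarrow> (int \<Rightarrow> 'a \<Rightarrow> real ^ 'd) \<Rightarrow> (nat \<Rightarrow> real) \<Rightarrow> (ereal ^ 'd) set \<Rightarrow> real" where
  "sigma2 M X a C = measure (tail_measure1 M X a) C + 2 * (\<Sum>h. tau M X a C (Suc h))"

text \<open>
  The centred normal law with variance \<open>v\<close>; \<open>normal_density\<close> with standard deviation \<open>0\<close> is the
  zero function, so the degenerate case has to be given separately.
\<close>

definition centred_normal :: "real \<Rightarrow> real measure" where
  "centred_normal v =
     (if v = 0 then return borel 0 else density lborel (\<lambda>x. ennreal (normal_density 0 (sqrt v) x)))"

end

theory Submission
  imports Defs
begin

text \<open>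
  The statistic is a normalised sum of centred indicators of the rare events \<open>X t / a (m n) \<in> C\<close>. It is
  asymptotically normal because the sequence is weakly dependent, and the limit variance is read off from
  the tail measures. The argument has an extremal and a probabilistic half.

  The extremal half identifies the limits of \<open>n P(X 0 / a n \<in> C)\<close> and of
  \<open>n P(X 0 / a n \<in> C, X h / a n \<in> C)\<close> with \<open>\<mu>(C)\<close> and \<open>\<tau> h\<close> (\<open>tail_measure1_limit\<close>, \<open>tau_limit\<close>). The vague
  limits along \<open>a n\<close> exist (\<open>tail_measure_exists\<close>): regular variation gives a limit under the normalisation by
  \<open>P(|Y\<^sub>h| > x)\<close>, and homogeneity together with stationarity shows that this is asymptotically a constant
  multiple of \<open>P(|X 0| > x)\<close>. The portmanteau theorem for vague convergence (\<open>vague_conv_continuity_set\<close>)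
  then turns convergence of integrals into convergence of the measures of continuity sets.

  The probabilistic half is Bernstein's method of big and small blocks. The sample is cut into about
  \<open>n / m n\<close> blocks of length \<open>m n\<close>, and the last \<open>r n\<close> indices of each are dropped. The covariances at lag \<open>h\<close>
  are of order \<open>1 / m n\<close> and, multiplied by \<open>m n\<close>, have uniformly small tails: the anti-clustering condition
  handles lags up to \<open>r n\<close>, the mixing rates handle the longer ones (\<open>gam_tail\<close>). Hence the dropped indices are
  negligible in mean square, the \<open>\<tau> h\<close> are summable, and the block variances converge to
  \<open>\<mu>(C) + 2 \<Sum>\<^sub>h \<tau> h\<close> (\<open>var_lim\<close>). The mixing inequality \<open>mixing_covariance_complex\<close> makes the characteristic
  function of the sum over the kept blocks a power of that of a single block, with an error of order
  \<open>n / m n\<close> times the mixing rate at \<open>r n\<close> (\<open>blocks_factorise\<close>). A Taylor expansion then reduces the claim to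
  the smallness of the third moments of the block sums (\<open>char_sum_gaussian\<close>).

  The two alternative hypotheses serve only for these third moments. If \<open>m n = o(n powr (1 / 3))\<close>, the trivial
  bound of a block sum by the block length is enough (\<open>third_moment_small_blocks\<close>). Otherwise fourth moments
  are estimated by sorting the four indices and decoupling across a gap larger than \<open>r n\<close>
  (\<open>quadruple_bound\<close>, \<open>fourth_moment_sum\<close>), and the third moments follow by interpolation.
\<close>

section \<open>The portmanteau theorem for vague convergence\<close>

lemma space_borel_of: "space (borel_of T) = topspace T"
  unfolding borel_of_def by (rule space_measure_of) (auto dest: openin_subset)

lemma openin_borel_of: "openin T U \<Longrightarrow> U \<in> sets (borel_of T)"
  by (auto simp: borel_of_def intro!: in_measure_of dest: openin_subset)

lemma continuous_map_borel_measurable: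
  fixes f :: "'a \<Rightarrow> real"
  assumes "continuous_map T euclideanreal f" "radon_measure T N"
  shows "f \<in> borel_measurable N"
proof -
  have sp: "space N = topspace T" and se: "sets N = sets (borel_of T)"
    using assms(2) by (auto simp: radon_measure_def)
  have "f \<in> borel_measurable (borel_of T)"
  proof (rule borel_measurableI)
    fix S :: "real set" assume "open S"
    then have "openin T (f -` S \<inter> topspace T)"
      using openin_continuous_map_preimage[OF assms(1), of S]
      by (simp add: vimage_def Int_def conj_commute)
    then show "f -` S \<inter> space (borel_of T) \<in> sets (borel_of T)"
      unfolding space_borel_of by (intro openin_borel_of) (simp add: Int_commute)
  qed
  then show ?thesis
    using se measurable_cong_sets by blast
qed

lemma radon_measure_openin: "radon_measure T N \<Longrightarrow> openin T U \<Longrightarrow> U \<in> sets N"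
  by (simp add: radon_measure_def openin_borel_of)

lemma radon_measure_closedin: "radon_measure T N \<Longrightarrow> closedin T L \<Longrightarrow> L \<in> sets N"
proof -
  assume N: "radon_measure T N" and L: "closedin T L"
  have "L = space N - (topspace T - L)"
    using N closedin_subset[OF L] by (auto simp: radon_measure_def)
  moreover have "topspace T - L \<in> sets N"
    using N L by (auto intro!: radon_measure_openin simp: closedin_def)
  ultimately show "L \<in> sets N" by (metis sets.compl_sets)
qed

lemma compactly_supported_integrable:
  fixes f :: "'a \<Rightarrow> real"
  assumes N: "radon_measure T N" and f: "f \<in> borel_measurable N"
    and V: "compactin T V" "closedin T V"
    and supp: "\<And>x. x \<in> topspace T \<Longrightarrow> x \<notin> V \<Longrightarrow> f x = 0"
    and bnd: "\<And>x. x \<in> topspace T \<Longrightarrow> \<bar>f x\<bar> \<le> c"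
  shows "integrable N f"
proof (rule integrableI_bounded_set[where A=V and B=c])
  have sp: "space N = topspace T" using N by (auto simp: radon_measure_def)
  show "V \<in> sets N" using radon_measure_closedin N V by blast
  show "emeasure N V < \<infinity>" using N V by (auto simp: radon_measure_def)
  show "AE x in N. x \<in> V \<longrightarrow> norm (f x) \<le> c" using bnd sp by auto
  show "AE x in N. x \<notin> V \<longrightarrow> f x = 0" using supp sp by auto
qed (fact f)

text \<open>
  A closed set of a metrizable space is a \<open>G\<^sub>\<delta>\<close>; Urysohn functions separating it from the
  complements of countably many open neighbourhoods multiply up to continuous functions that
  decrease to its indicator.
\<close>

lemma closedin_indicator_approx:
  assumes T: "metrizable_space T" and L: "closedin T L"
  obtains g :: "nat \<Rightarrow> 'a \<Rightarrow> real" where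
    "\<And>j. continuous_map T euclideanreal (g j)"
    "\<And>j x. x \<in> topspace T \<Longrightarrow> 0 \<le> g j x \<and> g j x \<le> 1"
    "\<And>j x. x \<in> L \<Longrightarrow> g j x = 1"
    "\<And>x. x \<in> topspace T \<Longrightarrow> (\<lambda>j. g j x) \<longlonglongrightarrow> indicator L x"
proof -
  obtain U :: "nat \<Rightarrow> 'a set" where U: "\<And>n. openin T (U n)" "\<Inter>(range U) = L"
    using closed_imp_gdelta_in[OF T L] unfolding gdelta_in_descending by blast
  have "\<exists>f. continuous_map T (top_of_set {0..1::real}) f \<and> f ` (topspace T - U n) \<subseteq> {0} \<and> f ` L \<subseteq> {1}" for n
  proof -
    have "disjnt (topspace T - U n) L" using U by (auto simp: disjnt_def)
    moreover have "closedin T (topspace T - U n)" using U by auto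
    ultimately show ?thesis
      using Urysohn_lemma[OF metrizable_imp_normal_space[OF T], of "topspace T - U n" L 0 1] L by (metis zero_le_one)
  qed
  then obtain f :: "nat \<Rightarrow> 'a \<Rightarrow> real"
    where f: "\<And>n. continuous_map T (top_of_set {0..1}) (f n)"
      "\<And>n. f n ` (topspace T - U n) \<subseteq> {0}" "\<And>n. f n ` L \<subseteq> {1}"
    by metis
  have fc: "continuous_map T euclideanreal (f n)" for n
    using f(1) by (simp add: continuous_map_in_subtopology)
  have f01: "0 \<le> f n x \<and> f n x \<le> 1" if "x \<in> topspace T" for n x
    using continuous_map_image_subset_topspace[OF f(1), of n] that by auto
  define g where "g j x = (\<Prod>n\<le>j. f n x)" for j x
  show ?thesis
  proof
    show "continuous_map T euclideanreal (g j)" for j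
      unfolding g_def using fc by (intro continuous_map_prod) auto
    show "0 \<le> g j x \<and> g j x \<le> 1" if "x \<in> topspace T" for j x
      unfolding g_def using f01[OF that] by (auto intro!: prod_nonneg prod_le_1)
    show gL: "g j x = 1" if "x \<in> L" for j x
      using f(3) that by (auto simp: g_def image_subset_iff intro!: prod.neutral)
    show "(\<lambda>j. g j x) \<longlonglongrightarrow> indicator L x" if x: "x \<in> topspace T" for x
    proof (cases "x \<in> L")
      case True
      then show ?thesis using gL by simp
    next
      case False
      then obtain n where "x \<notin> U n" using U by auto
      then have "f n x = 0" using f(2)[of n] x by auto
      then have "\<forall>j\<ge>n. g j x = 0" unfolding g_def by (auto intro!: prod_zero)
      then have "\<forall>\<^sub>F j in sequentially. g j x = 0" using eventually_sequentially by blast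
      then show ?thesis using False by (auto intro!: tendsto_eventually)
    qed
  qed
qed

text \<open>
  Local compactness provides a compact neighbourhood of \<open>K\<close> to carry the support of a Urysohn function.
\<close>

lemma compactin_cutoff:
  assumes T: "metrizable_space T" "locally_compact_space T" and K: "compactin T K"
  obtains \<psi> :: "'a \<Rightarrow> real" and V where
    "continuous_map T euclideanreal \<psi>" "\<And>x. x \<in> topspace T \<Longrightarrow> 0 \<le> \<psi> x \<and> \<psi> x \<le> 1"
    "\<And>x. x \<in> K \<Longrightarrow> \<psi> x = 1" "\<And>x. x \<in> topspace T \<Longrightarrow> x \<notin> V \<Longrightarrow> \<psi> x = 0"
    "compactin T V" "closedin T V"
proof -
  have haus: "Hausdorff_space T" using T by (simp add: metrizable_imp_Hausdorff_space)
  obtain U V where UV: "openin T U" "compactin T V" "closedin T V" "K \<subseteq> U" "U \<subseteq> V"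
    using T(2) K haus locally_compact_space_compact_closed_compact by metis
  have "closedin T K" using K haus by (simp add: compactin_imp_closedin)
  moreover have "closedin T (topspace T - U)" using UV by auto
  moreover have "disjnt (topspace T - U) K" using UV by (auto simp: disjnt_def)
  ultimately obtain f where f: "continuous_map T (top_of_set {0..1::real}) f"
      "f ` (topspace T - U) \<subseteq> {0}" "f ` K \<subseteq> {1}"
    using Urysohn_lemma[OF metrizable_imp_normal_space[OF T(1)], of "topspace T - U" K 0 1] by (metis zero_le_one)
  show ?thesis
  proof (rule that[of f V])
    show "continuous_map T euclideanreal f"
      using f(1) by (simp add: continuous_map_in_subtopology)
    show "0 \<le> f x \<and> f x \<le> 1" if "x \<in> topspace T" for x
      using continuous_map_image_subset_topspace[OF f(1)] that by auto
    show "f x = 1" if "x \<in> K" for x using f(3) that by auto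
    show "f x = 0" if "x \<in> topspace T" "x \<notin> V" for x using f(2) that UV by auto
  qed (use UV in auto)
qed

text \<open>
  Vague convergence only sees compactly supported functions, and the measures may have infinite total
  mass; the usual upper bound for closed sets therefore survives only after multiplication by a
  compactly supported cutoff.
\<close>

lemma vague_conv_limsup_closed:
  fixes \<psi> :: "'a \<Rightarrow> real"
  assumes T: "metrizable_space T"
    and N: "radon_measure T N" and Ns: "\<And>i. radon_measure T (Ns i)"
    and vc: "vague_conv T Ns N F"
    and \<psi>: "continuous_map T euclideanreal \<psi>" "\<And>x. x \<in> topspace T \<Longrightarrow> 0 \<le> \<psi> x \<and> \<psi> x \<le> 1"
      "\<And>x. x \<in> topspace T \<Longrightarrow> x \<notin> V \<Longrightarrow> \<psi> x = 0"
    and V: "compactin T V" "closedin T V"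
    and L: "closedin T L" and e: "0 < e"
  shows "\<forall>\<^sub>F i in F. (\<integral>x. \<psi> x * indicator L x \<partial>Ns i) < (\<integral>x. \<psi> x * indicator L x \<partial>N) + e"
proof -
  obtain g :: "nat \<Rightarrow> 'a \<Rightarrow> real" where g:
    "\<And>j. continuous_map T euclideanreal (g j)"
    "\<And>j x. x \<in> topspace T \<Longrightarrow> 0 \<le> g j x \<and> g j x \<le> 1"
    "\<And>j x. x \<in> L \<Longrightarrow> g j x = 1"
    "\<And>x. x \<in> topspace T \<Longrightarrow> (\<lambda>j. g j x) \<longlonglongrightarrow> indicator L x"
    using closedin_indicator_approx[OF T L] by blast
  let ?f = "\<lambda>j x. \<psi> x * g j x"
  have fc: "continuous_map T euclideanreal (?f j)" for j
    using \<psi>(1) g(1) by (rule continuous_map_real_mult)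
  have sp: "space N = topspace T" "\<And>i. space (Ns i) = topspace T"
    using N Ns by (auto simp: radon_measure_def)
  have \<psi>g: "\<bar>?f j x\<bar> \<le> \<psi> x" "0 \<le> ?f j x" if "x \<in> topspace T" for j x
    using \<psi>(2)[OF that] g(2)[OF that, of j] by (auto simp: abs_mult mult_left_le)
  have int\<psi>: "integrable N \<psi>"
    using compactly_supported_integrable[OF N continuous_map_borel_measurable[OF \<psi>(1) N] V, of 1] \<psi> by auto
  have meas: "?f j \<in> borel_measurable N" "?f j \<in> borel_measurable (Ns i)"
      "(\<lambda>x. \<psi> x * indicator L x) \<in> borel_measurable N"
      "(\<lambda>x. \<psi> x * indicator L x) \<in> borel_measurable (Ns i)" for i j
    using continuous_map_borel_measurable[OF fc] N Ns continuous_map_borel_measurable[OF \<psi>(1)]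
      radon_measure_closedin[OF _ L]
    by (auto intro!: borel_measurable_times borel_measurable_indicator)
  have "(\<lambda>j. \<integral>x. ?f j x \<partial>N) \<longlonglongrightarrow> (\<integral>x. \<psi> x * indicator L x \<partial>N)"
  proof (rule integral_dominated_convergence[where w=\<psi>])
    show "AE x in N. (\<lambda>j. ?f j x) \<longlonglongrightarrow> \<psi> x * indicator L x"
      using g(4) sp by (auto intro!: AE_I2 tendsto_mult)
    show "AE x in N. norm (?f j x) \<le> \<psi> x" for j
      using \<psi>g sp by (auto intro!: AE_I2)
  qed (use meas int\<psi> in auto)
  then have "\<forall>\<^sub>F j in sequentially. (\<integral>x. ?f j x \<partial>N) < (\<integral>x. \<psi> x * indicator L x \<partial>N) + e"
    using e by (intro order_tendstoD) auto
  then obtain j where j: "(\<integral>x. ?f j x \<partial>N) < (\<integral>x. \<psi> x * indicator L x \<partial>N) + e"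
    by (auto simp: eventually_sequentially)
  have "T closure_of {x \<in> topspace T. ?f j x \<noteq> 0} \<subseteq> V"
    using \<psi>(3) V(2) by (intro closure_of_minimal) auto
  then have "compactin T (T closure_of {x \<in> topspace T. ?f j x \<noteq> 0})"
    using V closed_compactin by fastforce
  then have "((\<lambda>i. \<integral>x. ?f j x \<partial>Ns i) \<longlongrightarrow> (\<integral>x. ?f j x \<partial>N)) F"
    using vc fc unfolding vague_conv_def by blast
  then have "\<forall>\<^sub>F i in F. (\<integral>x. ?f j x \<partial>Ns i) < (\<integral>x. \<psi> x * indicator L x \<partial>N) + e"
    using j by (intro order_tendstoD)
  moreover have "(\<integral>x. \<psi> x * indicator L x \<partial>Ns i) \<le> (\<integral>x. ?f j x \<partial>Ns i)" for i
  proof (rule integral_mono)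
    show "integrable (Ns i) (?f j)"
    proof (rule compactly_supported_integrable[OF Ns meas(2) V])
      show "\<bar>?f j x\<bar> \<le> 1" if "x \<in> topspace T" for x
        using \<psi>g(1)[OF that, of j] \<psi>(2)[OF that] by linarith
    qed (simp add: \<psi>(3))
    show "integrable (Ns i) (\<lambda>x. \<psi> x * indicator L x)"
      using compactly_supported_integrable[OF Ns meas(4) V, of 1] \<psi>(3,2)
      by (auto simp: indicator_def split: if_splits)
    show "\<psi> x * indicator L x \<le> ?f j x" if "x \<in> space (Ns i)" for x
      using \<psi>g(2)[of x j] g(3)[of x j] that sp by (auto simp: indicator_def)
  qed
  ultimately show ?thesis
    by (auto elim!: eventually_mono intro: le_less_trans)
qed

text \<open>
  With a compactly supported cutoff \<open>\<psi>\<close> that is \<open>1\<close> on the closure of \<open>B\<close>, the upper bound comes from the closure of \<open>B\<close>, the lower bound from the closed complement of its interior.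
\<close>

theorem vague_conv_continuity_set:
  assumes T: "metrizable_space T" "locally_compact_space T"
    and N: "radon_measure T N" and Ns: "\<And>i. radon_measure T (Ns i)"
    and vc: "vague_conv T Ns N F"
    and B: "continuity_set T N B" and cB: "compactin T (T closure_of B)"
  shows "((\<lambda>i. measure (Ns i) B) \<longlongrightarrow> measure N B) F"
proof -
  obtain \<psi> V where \<psi>: "continuous_map T euclideanreal \<psi>" "\<And>x. x \<in> topspace T \<Longrightarrow> 0 \<le> \<psi> x \<and> \<psi> x \<le> 1"
      "\<And>x. x \<in> T closure_of B \<Longrightarrow> \<psi> x = 1" "\<And>x. x \<in> topspace T \<Longrightarrow> x \<notin> V \<Longrightarrow> \<psi> x = 0"
      and V: "compactin T V" "closedin T V"
    using compactin_cutoff[OF T cB] by blast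
  have sp: "space N = topspace T" "\<And>i. space (Ns i) = topspace T"
    and se: "\<And>i. sets (Ns i) = sets N"
    using N Ns by (auto simp: radon_measure_def)
  have Bs: "B \<in> sets N" and fr: "T frontier_of B \<in> null_sets N"
    using B radon_measure_closedin[OF N closedin_frontier_of] by (auto simp: continuity_set_def null_sets_def)
  have Bt: "B \<subseteq> topspace T" using Bs sp sets.sets_into_space by metis
  have BK: "B \<subseteq> T closure_of B" using Bt closure_of_subset by blast
  let ?K = "T closure_of B" and ?L = "topspace T - T interior_of B"
  have cl: "closedin T ?K" "closedin T ?L" by auto
  have mI: "N' = N \<or> N' = Ns i \<Longrightarrow> integrable N' (\<lambda>x. \<psi> x * indicator D x)" if "D \<in> sets N" for D N' i
  proof -
    assume "N' = N \<or> N' = Ns i"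
    then have N': "radon_measure T N'" "D \<in> sets N'" using N Ns se that by auto
    have "(\<lambda>x. \<psi> x * indicator D x) \<in> borel_measurable N'"
      using continuous_map_borel_measurable[OF \<psi>(1) N'(1)] N'(2)
      by (auto intro!: borel_measurable_times borel_measurable_indicator)
    from compactly_supported_integrable[OF N'(1) this V, of 1] show ?thesis
      using \<psi>(4,2) by (auto simp: indicator_def split: if_splits)
  qed
  have KL: "?K \<in> sets N" "?L \<in> sets N" "topspace T \<in> sets N"
    using radon_measure_closedin[OF N] cl by auto
  have mB: "(\<integral>x. \<psi> x * indicator B x \<partial>N') = measure N' B" if "N' = N \<or> N' = Ns i" for N' i
  proof -
    have "(\<integral>x. \<psi> x * indicator B x \<partial>N') = (\<integral>x. indicator B x \<partial>N')"
      using BK \<psi>(3) by (intro Bochner_Integration.integral_cong) (auto simp: indicator_def)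
    also have "\<dots> = measure N' B"
      using that Bt sp by (auto simp: Int_absorb2)
    finally show ?thesis .
  qed
  have N_K: "(\<integral>x. \<psi> x * indicator ?K x \<partial>N) = measure N B"
  proof -
    have "AE x in N. x \<notin> T frontier_of B" using fr AE_not_in by blast
    then have "(\<integral>x. \<psi> x * indicator ?K x \<partial>N) = (\<integral>x. \<psi> x * indicator B x \<partial>N)"
      using mI[OF KL(1), of N] mI[OF Bs, of N] BK interior_of_subset[of T B]
      by (intro integral_cong_AE) (auto elim!: eventually_mono simp: frontier_of_def indicator_def)
    then show ?thesis using mB by auto
  qed
  have N_L: "(\<integral>x. \<psi> x * indicator ?L x \<partial>N) = (\<integral>x. \<psi> x * indicator (topspace T) x \<partial>N) - measure N B"
  proof -
    have "AE x in N. x \<notin> T frontier_of B" using fr AE_not_in by blast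
    then have "AE x in N. \<psi> x * indicator ?L x = \<psi> x * indicator (topspace T) x - \<psi> x * indicator B x"
      using BK interior_of_subset[of T B]
      by (auto elim!: eventually_mono simp: frontier_of_def indicator_def interior_of_subset_topspace subset_iff
        dest: interior_of_subset_topspace[THEN subsetD])
    then have "(\<integral>x. \<psi> x * indicator ?L x \<partial>N) = (\<integral>x. \<psi> x * indicator (topspace T) x - \<psi> x * indicator B x \<partial>N)"
      using mI[of _ N]  KL Bs  by (intro integral_cong_AE) (auto)
    then show ?thesis using mB mI[of _ N] KL Bs by (auto simp: Bochner_Integration.integral_diff)
  qed
  let ?I = "\<lambda>N'. \<integral>x. \<psi> x * indicator (topspace T) x \<partial>N'"
  have I\<psi>: "?I N' = (\<integral>x. \<psi> x \<partial>N')" if "N' = N \<or> N' = Ns i" for N' i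
    using sp that by (intro Bochner_Integration.integral_cong) auto
  have "T closure_of {x \<in> topspace T. \<psi> x \<noteq> 0} \<subseteq> V"
    using \<psi>(4) V(2) by (intro closure_of_minimal) auto
  then have "compactin T (T closure_of {x \<in> topspace T. \<psi> x \<noteq> 0})"
    using V closed_compactin by fastforce
  then have "((\<lambda>i. \<integral>x. \<psi> x \<partial>Ns i) \<longlongrightarrow> (\<integral>x. \<psi> x \<partial>N)) F"
    using vc \<psi>(1) unfolding vague_conv_def by blast
  then have lim\<psi>: "((\<lambda>i. ?I (Ns i)) \<longlongrightarrow> ?I N) F"
    using I\<psi>[OF disjI1[OF refl]] I\<psi>[OF disjI2[OF refl]] by simp
  have upper: "\<forall>\<^sub>F i in F. measure (Ns i) B < measure N B + e" if e: "e > 0" for e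
  proof -
    have "measure (Ns i) B \<le> (\<integral>x. \<psi> x * indicator ?K x \<partial>Ns i)" for i
      unfolding mB[of "Ns i" i, OF disjI2[OF refl], symmetric] using mI[OF Bs] mI[OF KL(1)] BK \<psi>(2) sp
      by (intro integral_mono) (auto simp: indicator_def)
    then show ?thesis
      using vague_conv_limsup_closed[OF T(1) N Ns vc \<psi>(1,2,4) V cl(1) e] unfolding N_K
      by (auto elim!: eventually_mono intro: le_less_trans)
  qed
  have lower: "\<forall>\<^sub>F i in F. measure N B - e < measure (Ns i) B" if e: "e > 0" for e
  proof -
    have le: "?I (Ns i) - measure (Ns i) B \<le> (\<integral>x. \<psi> x * indicator ?L x \<partial>Ns i)" for i
    proof -
      have "?I (Ns i) - measure (Ns i) B = (\<integral>x. \<psi> x * indicator (topspace T) x - \<psi> x * indicator B x \<partial>Ns i)"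
        using mI[of _ "Ns i" i] KL Bs mB[of "Ns i" i] by auto
      also have "\<dots> \<le> (\<integral>x. \<psi> x * indicator ?L x \<partial>Ns i)"
      proof (intro integral_mono Bochner_Integration.integrable_diff)
        show "\<psi> x * indicator (topspace T) x - \<psi> x * indicator B x \<le> \<psi> x * indicator ?L x"
          if "x \<in> space (Ns i)" for x
          using \<psi>(2)[of x] that sp interior_of_subset[of T B] by (auto simp: indicator_def)
      qed (use mI[of _ "Ns i" i] KL Bs in auto)
      finally show ?thesis .
    qed
    have "\<forall>\<^sub>F i in F. (\<integral>x. \<psi> x * indicator ?L x \<partial>Ns i) < (?I N - measure N B) + e / 2"
      using vague_conv_limsup_closed[OF T(1) N Ns vc \<psi>(1,2,4) V cl(2), of "e/2"] e unfolding N_L by auto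
    moreover have "\<forall>\<^sub>F i in F. ?I N - e / 2 < ?I (Ns i)"
      using lim\<psi> e by (intro order_tendstoD) auto
    ultimately show ?thesis
    proof eventually_elim
      case (elim i)
      then show ?case using le[of i] by linarith
    qed
  qed
  show ?thesis
  proof (rule order_tendstoI)
    fix c assume "c < measure N B"
    then show "\<forall>\<^sub>F i in F. c < measure (Ns i) B"
      using lower[of "measure N B - c"] by simp
  next
    fix c assume "measure N B < c"
    then show "\<forall>\<^sub>F i in F. measure (Ns i) B < c"
      using upper[of "c - measure N B"] by simp
  qed
qed

section \<open>Spaces of extended vectors and blocks\<close>

text \<open>
  Clamping turns the extended coordinates into continuous real functions. The integer levels together
  separate points, and this embeds the extended vectors into a countable power of the reals.
\<close>

definition trunc_ereal :: "real \<Rightarrow> ereal \<Rightarrow> real" where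
  "trunc_ereal c x = real_of_ereal (max (- ereal c) (min (ereal c) x))"

lemma clamp_ereal_finite: "\<bar>max (- ereal c) (min (ereal c) x)\<bar> \<noteq> \<infinity>"
  by (cases x) (auto simp: max_def min_def)

lemma continuous_on_trunc_ereal: "continuous_on UNIV (trunc_ereal c)"
proof -
  have *: "continuous_on UNIV (\<lambda>x::ereal. max (- ereal c) (min (ereal c) x))"
    by (intro continuous_intros)
  have "continuous_on UNIV (real_of_ereal \<circ> (\<lambda>x. max (- ereal c) (min (ereal c) x)))"
    by (rule continuous_on_compose[OF * continuous_on_subset[OF continuous_on_real]])
       (use clamp_ereal_finite[of c] in \<open>metis (no_types, lifting) DiffI UNIV_I abs_ereal.simps(2,3) image_subsetI insert_iff singletonD\<close>)
  then show ?thesis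
    by (simp add: trunc_ereal_def[abs_def] o_def)
qed

lemma trunc_ereal_inject:
  assumes "\<And>n::nat. trunc_ereal (real n) x = trunc_ereal (real n) y"
  shows "x = y"
proof (rule ccontr)
  have wlog: False if xy: "x < y" and eq: "\<And>n::nat. trunc_ereal (real n) x = trunc_ereal (real n) y" for x y
  proof -
    obtain q where q: "x < ereal q" "ereal q < y" using xy ereal_dense2 by blast
    obtain n :: nat where n: "real n > \<bar>q\<bar>" using reals_Archimedean2 by blast
    have "trunc_ereal n x < q"
      using q n by (cases x) (auto simp: trunc_ereal_def max_def min_def)
    moreover have "q < trunc_ereal n y"
      using q n by (cases y) (auto simp: trunc_ereal_def max_def min_def)
    ultimately show False using eq[of n] by simp
  qed
  assume "x \<noteq> y"
  then show False
    using wlog[of x y] wlog[of y x] assms by (metis neq_iff)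
qed

text \<open>
  A real-valued continuous substitute for the extended norm that is faithful below level \<open>c\<close>; through it
  the sets cut out by strict and weak lower bounds on the norm are seen to be open and closed.
\<close>

definition trunc_norm :: "real \<Rightarrow> ereal ^ 'd \<Rightarrow> real" where
  "trunc_norm c x = norm (\<chi> i. trunc_ereal c (x $ i))"

lemma continuous_on_trunc_norm: "continuous_on UNIV (trunc_norm c :: ereal ^ 'd \<Rightarrow> real)"
  unfolding trunc_norm_def
  by (intro continuous_on_norm continuous_on_vec_lambda
      continuous_on_compose2[OF continuous_on_trunc_ereal] continuous_on_component) auto

lemma abs_le_ext_norm: "\<bar>x $ i\<bar> \<le> ext_norm x"
proof (cases "\<forall>i. \<bar>x $ i\<bar> \<noteq> \<infinity>")
  case True
  then have "\<bar>x $ i\<bar> = ereal \<bar>(\<chi> i. real_of_ereal (x $ i)) $ i\<bar>"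
    using True[rule_format, of i] by (cases "x $ i") auto
  also have "\<dots> \<le> ext_norm x"
    using True component_le_norm_cart[of "\<chi> i. real_of_ereal (x $ i)" i]
    by (simp add: ext_norm_def)
  finally show ?thesis .
next
  case False
  then have "ext_norm x = \<infinity>" by (simp only: ext_norm_def if_False)
  then show ?thesis by simp
qed

lemma ext_norm_trunc_cases:
  assumes "0 < c"
  obtains "ext_norm x = ereal (trunc_norm c x)" | "ext_norm x > ereal c" "trunc_norm c x \<ge> c"
proof (cases "\<forall>i. \<bar>x $ i\<bar> \<le> ereal c")
  case True
  then have fin: "\<bar>x $ i\<bar> \<noteq> \<infinity>" for i by (metis ereal_infty_less_eq(1) PInfty_neq_ereal(1))
  have "trunc_ereal c (x $ i) = real_of_ereal (x $ i)" for i
    using True[rule_format, of i] by (cases "x $ i") (auto simp: trunc_ereal_def max_def min_def)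
  then show ?thesis using fin that(1) by (simp add: ext_norm_def trunc_norm_def)
next
  case False
  then obtain i where i: "\<bar>x $ i\<bar> > ereal c" by (auto simp: not_le)
  have "\<bar>trunc_ereal c (x $ i)\<bar> = c"
    using i assms by (cases "x $ i") (auto simp: trunc_ereal_def max_def min_def)
  then have "trunc_norm c x \<ge> c"
    using component_le_norm_cart[of "\<chi> i. trunc_ereal c (x $ i)" i] by (simp add: trunc_norm_def)
  then show ?thesis using that(2) i abs_le_ext_norm[of x i] by simp
qed

lemma ext_norm_gt_iff: "0 < s \<Longrightarrow> ext_norm x > ereal s \<longleftrightarrow> trunc_norm (2 * s) x > s"
  by (rule ext_norm_trunc_cases[of "2 * s" x]) (auto intro: less_trans[of "ereal s" "ereal (2 * s)"])

lemma ext_norm_ge_iff: "0 < s \<Longrightarrow> ext_norm x \<ge> ereal s \<longleftrightarrow> trunc_norm (2 * s) x \<ge> s"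
  by (rule ext_norm_trunc_cases[of "2 * s" x]) (auto intro: order.strict_implies_order[OF less_trans[of "ereal s" "ereal (2 * s)"]])

lemma open_ext_norm_gt: "0 < s \<Longrightarrow> open {x :: ereal ^ 'd. ext_norm x > ereal s}"
  by (simp add: ext_norm_gt_iff open_Collect_less continuous_on_trunc_norm)

lemma closed_ext_norm_ge: "0 < s \<Longrightarrow> closed {x :: ereal ^ 'd. ext_norm x \<ge> ereal s}"
  by (simp add: ext_norm_ge_iff closed_Collect_le continuous_on_trunc_norm)

lemma ext_norm_scale:
  assumes "0 < t"
  shows "ext_norm (\<chi> j. ereal t * x $ j) = ereal t * ext_norm x"
proof (cases "\<forall>i. \<bar>x $ i\<bar> \<noteq> \<infinity>")
  case True
  then have "\<bar>ereal t * x $ i\<bar> \<noteq> \<infinity>" for i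
    by (metis abs_ereal.simps(1) ereal_infinity_cases times_ereal.simps(1) PInfty_neq_ereal(1) ereal_real')
  moreover have "(\<chi> i. real_of_ereal (ereal t * x $ i)) = t *\<^sub>R (\<chi> i. real_of_ereal (x $ i))"
    by (auto simp: vec_eq_iff)
  ultimately show ?thesis using True assms by (auto simp: ext_norm_def)
next
  case False
  then obtain i where "\<bar>x $ i\<bar> = \<infinity>" by metis
  then have "\<bar>ereal t * x $ i\<bar> = \<infinity>" using assms by (cases "x $ i") auto
  then have "ext_norm x = \<infinity>" "ext_norm (\<chi> j. ereal t * x $ j) = \<infinity>"
    using abs_le_ext_norm[of x i] abs_le_ext_norm[of "\<chi> j. ereal t * x $ j" i] \<open>\<bar>x $ i\<bar> = \<infinity>\<close>
    by (simp_all del: abs_eq_infinity_cases)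
  then show ?thesis using assms by simp
qed

lemma ext_norm_zero_iff: "ext_norm x = 0 \<longleftrightarrow> x = 0"
proof
  assume *: "ext_norm x = 0"
  have "x $ i = 0" for i using abs_le_ext_norm[of x i] * by (cases "x $ i") (auto simp: zero_ereal_def)
  then show "x = 0" by (simp add: vec_eq_iff)
next
  assume "x = 0"
  moreover have "(\<chi> i. real_of_ereal ((0::ereal^'a) $ i)) = 0" by (simp add: vec_eq_iff)
  ultimately show "ext_norm x = 0" by (simp add: ext_norm_def)
qed

lemma ext_norm_nonneg: "0 \<le> ext_norm x"
  by (simp add: ext_norm_def)

lemma ext_norm_ext_vec: "ext_norm (ext_vec x) = ereal (norm x)"
  by (simp add: ext_norm_def ext_vec_def)

lemma continuous_on_ext_vec: "continuous_on UNIV (ext_vec :: real ^ 'd \<Rightarrow> ereal ^ 'd)"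
  unfolding ext_vec_def
  by (intro continuous_on_vec_lambda continuous_on_ereal continuous_on_component continuous_on_id)

lemma compact_space_ext_vec: "compact_space (euclidean :: (ereal ^ 'd) topology)"
proof -
  let ?P = "product_topology (\<lambda>_. euclidean :: ereal topology) (UNIV :: 'd set)"
  have "compact_space ?P"
    unfolding compact_space_product_topology
    by (simp add: compact_space_def compactin_euclidean_iff compact_UNIV del: euclidean_product_topology)
  moreover have "continuous_map ?P euclidean (\<lambda>y. \<chi> i. y i)"
  proof -
    have "continuous_on UNIV (\<lambda>y::'d \<Rightarrow> ereal. \<chi> i. y i)"
      by (intro continuous_on_vec_lambda continuous_on_product_coordinates)
    then show ?thesis
      by (simp add: euclidean_product_topology)
  qed
  moreover have "surj (\<lambda>y :: 'd \<Rightarrow> ereal. \<chi> i. y i)"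
    by (rule surjI[of _ vec_nth]) simp
  ultimately show ?thesis
    using image_compactin[of ?P "topspace ?P" "euclidean :: (ereal ^ 'd) topology" "\<lambda>y. \<chi> i. y i"]
    by (simp add: compact_space_def)
qed

text \<open>
  A continuous injection of a compact space into a Hausdorff space is an embedding.
\<close>

lemma metrizable_space_ext_vec: "metrizable_space (euclidean :: (ereal ^ 'd) topology)"
proof -
  let ?Q = "powertop_real (UNIV :: ('d \<times> nat) set)"
  let ?f = "\<lambda>(x :: ereal ^ 'd) (i, n). trunc_ereal (real n) (x $ i)"
  have Q: "metrizable_space ?Q"
    by (simp add: metrizable_space_product_topology metrizable_space_euclidean)
  have "continuous_map euclidean ?Q ?f"
    by (auto simp: continuous_map_componentwise_UNIV case_prod_beta
      intro!: continuous_on_compose2[OF continuous_on_trunc_ereal] continuous_on_component)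
  moreover from this have "closed_map euclidean ?Q ?f"
    using compact_space_ext_vec Q by (intro T1_Spaces.continuous_imp_closed_map) (auto simp: metrizable_imp_Hausdorff_space)
  moreover have "inj ?f"
    by (rule injI) (auto simp: fun_eq_iff vec_eq_iff intro!: trunc_ereal_inject)
  ultimately have "embedding_map euclidean ?Q ?f"
    by (intro injective_closed_imp_embedding_map) auto
  from embedding_map_imp_homeomorphic_space[OF this] show ?thesis
    using Q by (metis homeomorphic_metrizable_space metrizable_space_subtopology)
qed

lemma topspace_block_top: "topspace (block_top h) = (\<Pi>\<^sub>E i\<in>{1..h}. UNIV)"
  by (simp add: block_top_def)

lemma compact_block_top: "compact_space (block_top h :: (nat \<Rightarrow> ereal ^ 'd) topology)"
  by (auto simp: block_top_def compact_space_product_topology compact_space_ext_vec)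

lemma metrizable_block_top: "metrizable_space (block_top h :: (nat \<Rightarrow> ereal ^ 'd) topology)"
  by (auto simp: block_top_def metrizable_space_product_topology metrizable_space_ext_vec)

lemma openin_punctured_block: "openin (block_top h) (topspace (block_top h) - {\<lambda>i\<in>{1..h}. 0 :: ereal ^ 'd})"
proof -
  have "closedin (block_top h) {\<lambda>i\<in>{1..h}. 0 :: ereal ^ 'd}"
    using metrizable_imp_Hausdorff_space[OF metrizable_block_top]
    by (auto simp: topspace_block_top intro!: closedin_Hausdorff_singleton)
  then show ?thesis by blast
qed

lemma topspace_block_top0: "topspace (block_top0 h) = topspace (block_top h) - {\<lambda>i\<in>{1..h}. 0}"
  by (auto simp: block_top0_def)

lemma metrizable_block_top0: "metrizable_space (block_top0 h :: (nat \<Rightarrow> ereal ^ 'd) topology)"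
  by (simp add: block_top0_def metrizable_space_subtopology metrizable_block_top)

lemma locally_compact_block_top0: "locally_compact_space (block_top0 h :: (nat \<Rightarrow> ereal ^ 'd) topology)"
  unfolding block_top0_def
  by (intro locally_compact_space_open_subset compact_imp_locally_compact_space compact_block_top
      openin_punctured_block disjI1 metrizable_imp_Hausdorff_space metrizable_block_top)

lemma openin_block_top0:
  "openin (block_top0 h) U \<longleftrightarrow> openin (block_top h) U \<and> U \<subseteq> topspace (block_top0 h)"
  using openin_open_subtopology[OF openin_punctured_block, of h U]
  by (auto simp: block_top0_def)

definition block_gt :: "nat \<Rightarrow> nat \<Rightarrow> real \<Rightarrow> (nat \<Rightarrow> ereal ^ 'd) set" where
  "block_gt h i s = {y \<in> topspace (block_top h). ext_norm (y i) > ereal s}"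

definition block_ge :: "nat \<Rightarrow> nat \<Rightarrow> real \<Rightarrow> (nat \<Rightarrow> ereal ^ 'd) set" where
  "block_ge h i s = {y \<in> topspace (block_top h). ext_norm (y i) \<ge> ereal s}"

lemma block_ge_subset_punctured:
  assumes "0 < s" "i \<in> {1..h}"
  shows "block_ge h i s \<subseteq> topspace (block_top0 h :: (nat \<Rightarrow> ereal ^ 'd) topology)"
proof -
  have "ext_norm (0 :: ereal ^ 'd) = 0" by (simp add: ext_norm_zero_iff)
  then have "\<not> ereal s \<le> ext_norm (0 :: ereal ^ 'd)" using assms by simp
  then show ?thesis
    using assms by (auto simp: block_ge_def topspace_block_top0)
qed

lemma block_gt_subset_ge: "block_gt h i s \<subseteq> block_ge h i s"
  by (auto simp: block_ge_def block_gt_def)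

lemma continuous_block_coordinate:
  "i \<in> {1..h} \<Longrightarrow> continuous_map (block_top h) (euclidean :: (ereal ^ 'd) topology) (\<lambda>y. y i)"
  unfolding block_top_def by (rule continuous_map_product_projection)

lemma openin_block_gt: "0 < s \<Longrightarrow> i \<in> {1..h} \<Longrightarrow> openin (block_top0 h) (block_gt h i s)"
  using openin_continuous_map_preimage[OF continuous_block_coordinate, of i h "{x. ext_norm x > ereal s}"]
    open_ext_norm_gt[of s] block_ge_subset_punctured[of s i h] block_gt_subset_ge[of h i s]
  by (auto simp: openin_block_top0 block_gt_def)

text \<open>
  In the punctured space the relatively compact sets are those that stay away from the origin; a lower
  bound on a single component already guarantees this.
\<close>

lemma compactin_block_ge: "0 < s \<Longrightarrow> i \<in> {1..h} \<Longrightarrow> compactin (block_top0 h) (block_ge h i s)"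
  using closedin_continuous_map_preimage[OF continuous_block_coordinate, of i h "{x. ext_norm x \<ge> ereal s}"]
    closed_ext_norm_ge[of s] block_ge_subset_punctured[of s i h]
  by (auto simp: block_top0_def compactin_subtopology block_ge_def compact_block_top intro!: closedin_compact_space)

lemma closedin_block_ge: "0 < s \<Longrightarrow> i \<in> {1..h} \<Longrightarrow> closedin (block_top0 h) (block_ge h i s)"
  using compactin_block_ge metrizable_block_top0 compactin_imp_closedin metrizable_imp_Hausdorff_space by blast

lemma compactin_closure_block:
  assumes "B \<subseteq> block_ge h i s" "0 < s" "i \<in> {1..h}"
  shows "compactin (block_top0 h) (block_top0 h closure_of B)"
  using closure_of_minimal[OF assms(1) closedin_block_ge[OF assms(2,3)]]
    compactin_block_ge[OF assms(2,3)] closed_compactin closedin_closure_of by meson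

lemma block_scale_block_gt:
  assumes t: "0 < t" and i: "i \<in> {1..h}"
  shows "block_scale h t ` block_gt h i 1 = (block_gt h i t :: (nat \<Rightarrow> ereal ^ 'd) set)"
proof (intro equalityI subsetI)
  fix z :: "nat \<Rightarrow> ereal ^ 'd" assume "z \<in> block_scale h t ` block_gt h i 1"
  then obtain y where y: "y \<in> block_gt h i 1" "z = block_scale h t y" by auto
  then have "ext_norm (z i) = ereal t * ext_norm (y i)"
    using i t by (simp add: block_scale_def ext_norm_scale)
  moreover have "ereal t * 1 < ereal t * ext_norm (y i)"
    using y t by (intro ereal_mult_strict_left_mono) (auto simp: block_gt_def one_ereal_def)
  ultimately show "z \<in> block_gt h i t"
    using y by (auto simp: block_gt_def block_scale_def topspace_block_top)
next
  fix z :: "nat \<Rightarrow> ereal ^ 'd" assume z: "z \<in> block_gt h i t"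
  have inv: "ereal t * (ereal (1 / t) * e) = e" for e :: ereal
    using t by (cases e) auto
  define y where "y = block_scale h (1 / t) z"
  have "z = block_scale h t y"
    using z t by (auto simp: y_def block_scale_def fun_eq_iff restrict_def vec_eq_iff inv
        block_gt_def topspace_block_top PiE_def extensional_def)
  moreover have "y \<in> block_gt h i 1"
  proof -
    have "ext_norm (y i) = ereal (1 / t) * ext_norm (z i)"
      using i t by (simp add: y_def block_scale_def ext_norm_scale)
    moreover have "ereal (1 / t) * ereal t < ereal (1 / t) * ext_norm (z i)"
      using z t by (intro ereal_mult_strict_left_mono) (auto simp: block_gt_def)
    ultimately show ?thesis
      using t by (auto simp: block_gt_def y_def block_scale_def topspace_block_top)
  qed
  ultimately show "z \<in> block_scale h t ` block_gt h i 1" by blast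
qed

lemma punctured_block_eq_Union_block_gt:
  "topspace (block_top0 h) = (\<Union>i\<in>{1..h}. \<Union>n. block_gt h i (1 / real (Suc n)) :: (nat \<Rightarrow> ereal ^ 'd) set)"
proof (intro equalityI subsetI)
  fix y :: "nat \<Rightarrow> ereal ^ 'd" assume y: "y \<in> topspace (block_top0 h)"
  then have "y \<noteq> (\<lambda>i\<in>{1..h}. 0)" "y \<in> extensional {1..h}"
    by (auto simp: topspace_block_top0 topspace_block_top PiE_def)
  then have "\<not> (\<forall>i\<in>{1..h}. y i = 0)"
    by (metis (no_types, lifting) extensionalityI restrict_apply restrict_extensional)
  then obtain i where i: "i \<in> {1..h}" "y i \<noteq> 0"
    by blast
  then have "0 < ext_norm (y i)"
    using ext_norm_zero_iff[of "y i"] ext_norm_nonneg[of "y i"] by (simp add: less_le)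
  then obtain q where q: "0 < q" "ereal q < ext_norm (y i)"
    using ereal_dense2[of 0 "ext_norm (y i)"] by (auto simp: zero_ereal_def)
  obtain n where "inverse (real (Suc n)) < q" using q reals_Archimedean by blast
  then have "ereal (1 / real (Suc n)) < ext_norm (y i)"
    using q by (intro less_trans[OF _ q(2)]) (simp add: inverse_eq_divide)
  then show "y \<in> (\<Union>i\<in>{1..h}. \<Union>n. block_gt h i (1 / real (Suc n)))"
    using i y by (auto simp: block_gt_def topspace_block_top0)
next
  fix y :: "nat \<Rightarrow> ereal ^ 'd" assume "y \<in> (\<Union>i\<in>{1..h}. \<Union>n. block_gt h i (1 / real (Suc n)))"
  then obtain i n where "i \<in> {1..h}" "y \<in> block_gt h i (1 / real (Suc n))" by blast
  then show "y \<in> topspace (block_top0 h)"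
    using block_gt_subset_ge[of h i "1 / real (Suc n)"]
      block_ge_subset_punctured[of "1 / real (Suc n)" i h] by auto
qed

section \<open>Existence of the tail measures\<close>

lemma strictly_stationary_measurable:
  "strictly_stationary M X \<Longrightarrow> X t \<in> borel_measurable M"
  by (simp add: strictly_stationary_def)

lemma stationary_integral:
  fixes f :: "(int \<Rightarrow> real ^ 'd) \<Rightarrow> 'b::{banach, second_countable_topology}"
  assumes X: "strictly_stationary M X" and J: "finite J"
    and f: "f \<in> borel_measurable (\<Pi>\<^sub>M t\<in>J. borel)"
  shows "(\<integral>\<omega>. f (\<lambda>t\<in>J. X (t + k) \<omega>) \<partial>M) = (\<integral>\<omega>. f (\<lambda>t\<in>J. X t \<omega>) \<partial>M)"
proof -
  have meas: "(\<lambda>\<omega>. \<lambda>t\<in>J. X (t + j) \<omega>) \<in> M \<rightarrow>\<^sub>M (\<Pi>\<^sub>M t\<in>J. borel)" for j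
    using strictly_stationary_measurable[OF X] by (intro measurable_restrict) auto
  have "(\<integral>\<omega>. f (\<lambda>t\<in>J. X (t + k) \<omega>) \<partial>M) =
      integral\<^sup>L (distr M (\<Pi>\<^sub>M t\<in>J. borel) (\<lambda>\<omega>. \<lambda>t\<in>J. X (t + k) \<omega>)) f"
    using meas f by (simp add: integral_distr)
  also have "distr M (\<Pi>\<^sub>M t\<in>J. borel) (\<lambda>\<omega>. \<lambda>t\<in>J. X (t + k) \<omega>) =
      distr M (\<Pi>\<^sub>M t\<in>J. borel) (\<lambda>\<omega>. \<lambda>t\<in>J. X t \<omega>)"
    using X J by (simp add: strictly_stationary_def)
  also have "integral\<^sup>L \<dots> f = (\<integral>\<omega>. f (\<lambda>t\<in>J. X t \<omega>) \<partial>M)"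
    using meas[of 0] f by (simp add: integral_distr)
  finally show ?thesis .
qed

lemma (in prob_space) stationary_pair:
  assumes X: "strictly_stationary M X" and D: "D \<in> sets borel"
  shows "prob {\<omega> \<in> space M. X (s + k) \<omega> \<in> D \<and> X (t + k) \<omega> \<in> D} =
    prob {\<omega> \<in> space M. X s \<omega> \<in> D \<and> X t \<omega> \<in> D}"
proof -
  note [measurable] = strictly_stationary_measurable[OF X] D
  let ?f = "\<lambda>y :: int \<Rightarrow> real ^ 'b. indicator D (y s) * indicator D (y t) :: real"
  have "?f \<in> borel_measurable (\<Pi>\<^sub>M i\<in>{s, t}. borel)" by measurable
  from stationary_integral[OF X _ this, of k]
  have "(\<integral>\<omega>. indicat_real D (X (s + k) \<omega>) * indicator D (X (t + k) \<omega>) \<partial>M) =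
      (\<integral>\<omega>. indicat_real D (X s \<omega>) * indicator D (X t \<omega>) \<partial>M)"
    by simp
  moreover have "(\<integral>\<omega>. indicat_real D (X s \<omega>) * indicator D (X t \<omega>) \<partial>M) =
      prob {\<omega> \<in> space M. X s \<omega> \<in> D \<and> X t \<omega> \<in> D}" for s t
  proof -
    have "(\<integral>\<omega>. indicat_real D (X s \<omega>) * indicator D (X t \<omega>) \<partial>M) =
        (\<integral>\<omega>. indicat_real {\<omega> \<in> space M. X s \<omega> \<in> D \<and> X t \<omega> \<in> D} \<omega> \<partial>M)"
      by (intro Bochner_Integration.integral_cong) (auto simp: indicator_def)
    then show ?thesis by simp
  qed
  ultimately show ?thesis by simp
qed

lemma (in prob_space) stationary_marginal:
  assumes X: "strictly_stationary M X" and D: "D \<in> sets borel"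
  shows "prob {\<omega> \<in> space M. X t \<omega> \<in> D} = prob {\<omega> \<in> space M. X 0 \<omega> \<in> D}"
  using stationary_pair[OF assms, of 0 t 0] by simp

text \<open>
  On sequences of ordinary vectors, whose space is second countable, the Borel sets of the product
  topology are those generated by the coordinates. The passage from there to scaled extended blocks is
  continuous.
\<close>

lemma measurable_lagged_scaled:
  fixes X :: "int \<Rightarrow> 'a \<Rightarrow> real ^ 'd"
  assumes X: "strictly_stationary M X"
  shows "lagged_scaled X h x \<in> M \<rightarrow>\<^sub>M borel_of (block_top h)"
proof -
  define Y where "Y \<omega> = (\<lambda>i::nat. X (int i) \<omega>)" for \<omega>
  define G :: "(nat \<Rightarrow> real ^ 'd) \<Rightarrow> (nat \<Rightarrow> ereal ^ 'd)"
    where "G y = (\<lambda>i\<in>{1..h}. ext_vec (inverse x *\<^sub>R y i))" for y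
  have Y: "Y \<in> borel_measurable M"
    unfolding Y_def[abs_def] using strictly_stationary_measurable[OF X]
    by (intro measurable_coordinatewise_then_product) auto
  have G: "continuous_map euclidean (block_top h) G"
    unfolding block_top_def G_def
    by (intro continuous_map_coordinatewise_then_product)
      (auto intro!: continuous_on_compose2[OF continuous_on_ext_vec] continuous_intros
         continuous_on_product_coordinates)
  have "lagged_scaled X h x = (\<lambda>\<omega>. G (Y \<omega>))"
    by (auto simp: fun_eq_iff lagged_scaled_def G_def Y_def)
  moreover have "(\<lambda>\<omega>. G (Y \<omega>)) \<in> M \<rightarrow>\<^sub>M borel_of (block_top h)"
    unfolding borel_of_def
  proof (rule measurable_measure_of)
    show "{U. openin (block_top h) U} \<subseteq> Pow (topspace (block_top h))"
      by (auto dest: openin_subset)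
    show "(\<lambda>\<omega>. G (Y \<omega>)) \<in> space M \<rightarrow> topspace (block_top h)"
      by (auto simp: topspace_block_top G_def)
    fix U :: "(nat \<Rightarrow> ereal ^ 'd) set" assume "U \<in> {U. openin (block_top h) U}"
    then have "open {y. G y \<in> U}"
      using openin_continuous_map_preimage[OF G, of U] by simp
    then have "Y -` {y. G y \<in> U} \<inter> space M \<in> sets M"
      using Y by (intro measurable_sets[OF Y]) auto
    then show "(\<lambda>\<omega>. G (Y \<omega>)) -` U \<inter> space M \<in> sets M"
      by (simp add: vimage_def)
  qed
  ultimately show ?thesis by simp
qed

lemma punctured_in_borel: "topspace (block_top0 h) \<in> sets (borel_of (block_top h))"
  unfolding topspace_block_top0 by (rule openin_borel_of[OF openin_punctured_block])

lemma sets_borel_of_block_top0: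
  "sets (borel_of (block_top0 h :: (nat \<Rightarrow> ereal ^ 'd) topology)) =
   (\<inter>) (topspace (block_top0 h)) ` sets (borel_of (block_top h))"
proof -
  let ?T = "block_top h :: (nat \<Rightarrow> ereal ^ 'd) topology" and ?S = "block_top0 h :: (nat \<Rightarrow> ereal ^ 'd) topology"
  have s: "sets (borel_of T) = sigma_sets (topspace T) {U. openin T U}" for T :: "'z topology"
    unfolding borel_of_def by (rule sets_measure_of) (auto dest: openin_subset)
  have sub: "topspace ?S \<subseteq> topspace ?T" by (auto simp: topspace_block_top0)
  have "(\<inter>) (topspace ?S) ` sigma_sets (topspace ?T) {U. openin ?T U} =
     sigma_sets (topspace ?S) ((\<inter>) (topspace ?S) ` {U. openin ?T U})"
    using punctured_in_borel[of h] sub by (intro sigma_sets_Int) (auto simp: s)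
  also have "(\<inter>) (topspace ?S) ` {U. openin ?T U} = {U. openin ?S U}"
    by (auto simp: block_top0_def openin_subtopology image_iff Int_commute)
  finally show ?thesis by (simp add: s)
qed

lemma lagged_law_space: "space (lagged_law M X h x) = topspace (block_top0 h)"
  unfolding lagged_law_def space_restrict_space space_distr space_borel_of
  by (auto simp: topspace_block_top0)

lemma lagged_law_sets: "sets (lagged_law M X h x) = sets (borel_of (block_top0 h))"
  unfolding lagged_law_def sets_restrict_space sets_distr sets_borel_of_block_top0 by (rule refl)

lemma block_top0_borel_subset: "B \<in> sets (borel_of (block_top0 h)) \<Longrightarrow> B \<in> sets (borel_of (block_top h))"
  unfolding sets_borel_of_block_top0 by (auto intro: sets.Int punctured_in_borel)

lemma emeasure_lagged_law:
  assumes X: "strictly_stationary M X" and B: "B \<in> sets (borel_of (block_top0 h))"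
  shows "emeasure (lagged_law M X h x) B = emeasure M {\<omega> \<in> space M. lagged_scaled X h x \<omega> \<in> B}"
proof -
  have "B \<subseteq> topspace (block_top0 h)"
    using sets.sets_into_space[OF B] by (simp add: space_borel_of)
  then have "emeasure (lagged_law M X h x) B = emeasure (distr M (borel_of (block_top h)) (lagged_scaled X h x)) B"
    unfolding lagged_law_def using punctured_in_borel[of h]
    by (intro emeasure_restrict_space) (auto intro: sets.Int)
  also have "\<dots> = emeasure M (lagged_scaled X h x -` B \<inter> space M)"
    using measurable_lagged_scaled[OF X] block_top0_borel_subset[OF B] by (rule emeasure_distr)
  also have "lagged_scaled X h x -` B \<inter> space M = {\<omega> \<in> space M. lagged_scaled X h x \<omega> \<in> B}" by auto
  finally show ?thesis .
qed

lemma measure_lagged_law: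
  assumes X: "strictly_stationary M X" and B: "B \<in> sets (borel_of (block_top0 h))"
  shows "measure (lagged_law M X h x) B = measure M {\<omega> \<in> space M. lagged_scaled X h x \<omega> \<in> B}"
  using emeasure_lagged_law[OF assms] by (simp add: measure_def)

lemma (in prob_space) radon_scaled_law:
  assumes X: "strictly_stationary M X"
  shows "radon_measure (block_top0 h) (scale_measure (ennreal c) (lagged_law M X h x))"
  unfolding radon_measure_def
proof (intro conjI allI impI)
  fix K assume "compactin (block_top0 h :: (nat \<Rightarrow> ereal ^ 'b) topology) K"
  then have "closedin (block_top0 h) K"
    using metrizable_block_top0 compactin_imp_closedin metrizable_imp_Hausdorff_space by blast
  then have "topspace (block_top0 h) - K \<in> sets (borel_of (block_top0 h))"
    by (intro openin_borel_of) (simp add: closedin_def)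
  then have "topspace (block_top0 h) - (topspace (block_top0 h) - K) \<in> sets (borel_of (block_top0 h))"
    using sets.compl_sets[of _ "borel_of (block_top0 h)"] by (simp only: space_borel_of)
  moreover have "topspace (block_top0 h) - (topspace (block_top0 h) - K) = K"
    using closedin_subset[OF \<open>closedin (block_top0 h) K\<close>] by blast
  ultimately show "emeasure (scale_measure (ennreal c) (lagged_law M X h x)) K < \<infinity>"
    by (simp add: emeasure_lagged_law[OF X] ennreal_mult_eq_top_iff less_top[symmetric] emeasure_finite)
qed (simp_all add: space_scale_measure lagged_law_space lagged_law_sets)

lemma scale_measure_eq_density: "scale_measure c L = density L (\<lambda>_. c)"
  by (rule measure_eqI) (auto simp: emeasure_density_const)

lemma integral_scale_measure:
  fixes f :: "'a \<Rightarrow> real"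
  assumes "0 \<le> c" "f \<in> borel_measurable L"
  shows "(\<integral>x. f x \<partial>scale_measure (ennreal c) L) = c * (\<integral>x. f x \<partial>L)"
  using assms by (simp add: scale_measure_eq_density integral_density)

lemma lagged_scaled_block_gt:
  assumes "0 < x" "i \<in> {1..h}"
  shows "lagged_scaled X h x \<omega> \<in> block_gt h i 1 \<longleftrightarrow> norm (X (int i) \<omega>) > x"
  using assms by (auto simp: lagged_scaled_def block_gt_def topspace_block_top ext_norm_ext_vec field_simps
     simp flip: one_ereal_def)

lemma radon_measure_block_ge_finite:
  "radon_measure (block_top0 h) N \<Longrightarrow> 0 < s \<Longrightarrow> i \<in> {1..h} \<Longrightarrow> emeasure N (block_ge h i s) < \<infinity>"
  using compactin_block_ge[of s i h] unfolding radon_measure_def by blast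

text \<open>
  Homogeneity makes the sphere \<open>{y. ext_norm (y i) = 1}\<close> negligible: its union with the outside of the
  unit ball is contained in the \<open>s\<close>-fold of the outside for each \<open>s < 1\<close>, and as \<open>s\<close> tends to \<open>1\<close> the mass
  of the \<open>s\<close>-fold tends to the mass of the outside itself.
\<close>

lemma homogeneous_sphere_null:
  fixes \<mu> :: "(nat \<Rightarrow> ereal ^ 'd) measure"
  assumes rad: "radon_measure (block_top0 h) \<mu>"
    and hom: "\<And>t B. 0 < t \<Longrightarrow> B \<in> sets \<mu> \<Longrightarrow>
        emeasure \<mu> (block_scale h t ` B) = ennreal (t powr - \<alpha>) * emeasure \<mu> B"
    and i: "i \<in> {1..h}"
  shows "continuity_set (block_top0 h) \<mu> (block_gt h i 1)"
proof -
  let ?G = "block_gt h i :: real \<Rightarrow> (nat \<Rightarrow> ereal ^ 'd) set" and ?F = "block_ge h i 1 :: (nat \<Rightarrow> ereal ^ 'd) set"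
  have Gs: "?G s \<in> sets \<mu>" if "0 < s" for s
    using radon_measure_openin[OF rad openin_block_gt[OF that i]] .
  have Fs: "?F \<in> sets \<mu>" using radon_measure_closedin[OF rad closedin_block_ge[OF _ i]] by simp
  have finF: "emeasure \<mu> ?F < \<infinity>" using radon_measure_block_ge_finite[OF rad _ i] by simp
  have finG: "emeasure \<mu> (?G 1) < \<infinity>"
    using finF emeasure_mono[OF block_gt_subset_ge Fs] le_less_trans by blast
  have G_ps: "measure \<mu> (?G s) = s powr - \<alpha> * measure \<mu> (?G 1)" if "0 < s" for s
    using hom[OF that Gs[of 1]] block_scale_block_gt[OF that i, where 'd='d]
    by (simp add: measure_def enn2real_mult)
  have finGs: "emeasure \<mu> (?G s) < \<infinity>" if "0 < s" for s
    using hom[OF that Gs[of 1]] block_scale_block_gt[OF that i, where 'd='d] finG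
    by (simp add: ennreal_mult_less_top)
  have "measure \<mu> ?F \<le> s powr - \<alpha> * measure \<mu> (?G 1)" if "0 < s" "s < 1" for s
  proof -
    have "?F \<subseteq> ?G s"
      using that less_le_trans[of "ereal s" "ereal 1"] by (auto simp: block_ge_def block_gt_def)
    then have "measure \<mu> ?F \<le> measure \<mu> (?G s)"
      using Gs Fs finGs that by (intro measure_mono_fmeasurable) (auto simp: fmeasurable_def)
    then show ?thesis using G_ps[OF that(1)] by linarith
  qed
  then have ev: "\<forall>\<^sub>F s in at_left 1. measure \<mu> ?F \<le> s powr - \<alpha> * measure \<mu> (?G 1)"
    by (intro eventually_mono[OF eventually_at_left_real[of 0 1]]) auto
  have "((\<lambda>s. s powr - \<alpha> * measure \<mu> (?G 1)) \<longlongrightarrow> 1 powr - \<alpha> * measure \<mu> (?G 1)) (at_left 1)"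
    by (intro tendsto_intros) auto
  from tendsto_lowerbound[OF this ev] have "measure \<mu> ?F \<le> measure \<mu> (?G 1)"
    by (simp add: trivial_limit_at_left_real)
  moreover have "measure \<mu> (?F - ?G 1) = measure \<mu> ?F - measure \<mu> (?G 1)"
    using finF Fs Gs[of 1] block_gt_subset_ge[of h i 1]
    by (intro measure_Diff) auto
  ultimately have "measure \<mu> (?F - ?G 1) = 0"
    using measure_nonneg[of \<mu> "?F - ?G 1"] by linarith
  moreover have "emeasure \<mu> (?F - ?G 1) < \<infinity>"
    by (rule le_less_trans[OF emeasure_mono[OF Diff_subset Fs] finF])
  ultimately have null: "emeasure \<mu> (?F - ?G 1) = 0"
    by (simp add: emeasure_eq_ennreal_measure less_top)
  have "block_top0 h frontier_of ?G 1 \<subseteq> ?F - ?G 1"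
  proof -
    have "block_top0 h closure_of ?G 1 \<subseteq> ?F"
      by (intro closure_of_minimal block_gt_subset_ge closedin_block_ge i) simp
    then show ?thesis
      by (auto simp: frontier_of_def interior_of_openin[OF openin_block_gt[OF zero_less_one i]])
  qed
  then show ?thesis
    using null Gs[of 1] Fs emeasure_mono[of "block_top0 h frontier_of ?G 1" "?F - ?G 1" \<mu>]
    by (auto simp: continuity_set_def)
qed

text \<open>
  If the outsides of the unit ball in all components were null, then so would be all their multiples, and
  countably many of these cover the punctured space.
\<close>

lemma homogeneous_block_gt:
  fixes \<mu> :: "(nat \<Rightarrow> ereal ^ 'd) measure"
  assumes rad: "radon_measure (block_top0 h) \<mu>"
    and hom: "\<And>t B. 0 < t \<Longrightarrow> B \<in> sets \<mu> \<Longrightarrow>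
        emeasure \<mu> (block_scale h t ` B) = ennreal (t powr - \<alpha>) * emeasure \<mu> B"
    and nz: "emeasure \<mu> (space \<mu>) \<noteq> 0"
  obtains i where "i \<in> {1..h}" "measure \<mu> (block_gt h i 1) > 0"
proof (rule ccontr)
  assume *: "\<not> thesis"
  note witness = that
  have sp: "space \<mu> = topspace (block_top0 h)" using rad by (simp add: radon_measure_def)
  have "block_gt h i s \<in> null_sets \<mu>" if i: "i \<in> {1..h}" and s: "0 < s" for i s
  proof -
    have op: "block_gt h i u \<in> sets \<mu>" if "0 < u" for u
      using radon_measure_openin[OF rad openin_block_gt[OF that i]] .
    have "emeasure \<mu> (block_gt h i 1) \<le> emeasure \<mu> (block_ge h i 1)"
      by (intro emeasure_mono block_gt_subset_ge radon_measure_closedin[OF rad closedin_block_ge[OF _ i]]) simp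
    also have "\<dots> < \<infinity>" using radon_measure_block_ge_finite[OF rad _ i] by simp
    finally have fin: "emeasure \<mu> (block_gt h i 1) < \<infinity>" .
    have "measure \<mu> (block_gt h i 1) = 0"
      using * witness[OF i] measure_nonneg[of \<mu> "block_gt h i 1"] by linarith
    then have "emeasure \<mu> (block_gt h i 1) = 0"
      using fin by (simp add: emeasure_eq_ennreal_measure less_top)
    then have "emeasure \<mu> (block_gt h i s) = 0"
      using hom[OF s op[of 1]] block_scale_block_gt[OF s i, where 'd='d] by simp
    then show ?thesis using op[OF s] by (auto simp: null_sets_def)
  qed
  then have "space \<mu> \<in> null_sets \<mu>"
    unfolding sp punctured_block_eq_Union_block_gt
    by (intro null_sets_UN' countable_finite finite_atLeastAtMost null_sets_UN) auto
  then show False using nz by auto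
qed

text \<open>
  The normalisations \<open>1 / P(|Y\<^sub>h| > x)\<close> and \<open>n\<close> agree along \<open>a\<^sub>n\<close> up to a positive constant: the ratio
  \<open>P(|X\<^sub>i| > x) / P(|Y\<^sub>h| > x)\<close> converges for each component \<open>i\<close> of the block, homogeneity provides an \<open>i\<close> for
  which the limit is positive, and by stationarity \<open>X\<^sub>i\<close> may be replaced by \<open>X\<^sub>0\<close>.
\<close>

theorem (in prob_space) tail_measure_exists:
  fixes X :: "int \<Rightarrow> 'a \<Rightarrow> real ^ 'd"
  assumes X: "strictly_stationary M X" and rv: "regularly_varying M X \<alpha>"
    and a: "filterlim a at_top sequentially"
    and an: "(\<lambda>n. prob {\<omega> \<in> space M. norm (X 0 \<omega>) > a n}) \<sim>[sequentially] (\<lambda>n. 1 / real n)"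
    and h: "1 \<le> h"
  shows "radon_measure (block_top0 h) (tail_measure M X a h) \<and>
    vague_conv (block_top0 h) (\<lambda>n. scale_measure (ennreal (real n)) (lagged_law M X h (a n)))
      (tail_measure M X a h) sequentially"
proof -
  define V where "V x = prob {\<omega> \<in> space M. lagged_norm X h \<omega> > x}" for x
  define W where "W x = prob {\<omega> \<in> space M. norm (X 0 \<omega>) > x}" for x
  obtain \<mu> where rad: "radon_measure (block_top0 h) \<mu>" and nz: "emeasure \<mu> (space \<mu>) \<noteq> 0"
    and hom: "\<And>t B. 0 < t \<Longrightarrow> B \<in> sets \<mu> \<Longrightarrow>
        emeasure \<mu> (block_scale h t ` B) = ennreal (t powr - \<alpha>) * emeasure \<mu> B"
    and vc: "vague_conv (block_top0 h)
          (\<lambda>x. scale_measure (ennreal (1 / V x)) (lagged_law M X h x)) \<mu> at_top"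
    using rv h unfolding regularly_varying_def V_def by blast
  obtain i where i: "i \<in> {1..h}" and q0: "measure \<mu> (block_gt h i 1) > 0"
    using homogeneous_block_gt[OF rad hom nz] by blast
  define q where "q = measure \<mu> (block_gt h i 1)"
  have q: "q > 0" using q0 by (simp add: q_def)
  have V0: "V x \<ge> 0" for x by (simp add: V_def)
  have "((\<lambda>x. measure (scale_measure (ennreal (1 / V x)) (lagged_law M X h x)) (block_gt h i 1)) \<longlongrightarrow> q) at_top"
    unfolding q_def
    by (rule vague_conv_continuity_set[OF metrizable_block_top0 locally_compact_block_top0 rad
          radon_scaled_law[OF X] vc homogeneous_sphere_null[OF rad hom i]
          compactin_closure_block[OF block_gt_subset_ge _ i]]) auto
  moreover have "measure (scale_measure (ennreal (1 / V x)) (lagged_law M X h x)) (block_gt h i 1) = W x / V x"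
    if "0 < x" for x
  proof -
    have "measure (lagged_law M X h x) (block_gt h i 1) = prob {\<omega> \<in> space M. X (int i) \<omega> \<in> {v. norm v > x}}"
      using lagged_scaled_block_gt[OF that i, of X]
      by (simp add: measure_lagged_law[OF X openin_borel_of[OF openin_block_gt[OF zero_less_one i]]])
    also have "\<dots> = W x"
      unfolding W_def by (subst stationary_marginal[OF X]) (auto intro!: borel_open open_Collect_less continuous_intros)
    finally show ?thesis using V0[of x] by (simp add: measure_scale_measure)
  qed
  then have "\<forall>\<^sub>F x in at_top. measure (scale_measure (ennreal (1 / V x)) (lagged_law M X h x)) (block_gt h i 1) = W x / V x"
    by (intro eventually_mono[OF eventually_gt_at_top[of 0]])
  ultimately have "((\<lambda>x. W x / V x) \<longlongrightarrow> q) at_top"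
    by (simp cong: tendsto_cong)
  then have ratio: "(\<lambda>n. W (a n) / V (a n)) \<longlonglongrightarrow> q"
    using a by (rule filterlim_compose)
  have "(\<lambda>n. W (a n) / (1 / real n)) \<longlonglongrightarrow> 1"
    unfolding W_def by (intro asymp_equivD_strong[OF an] eventually_mono[OF eventually_gt_at_top[of 0]]) simp
  then have nW: "(\<lambda>n. real n * W (a n)) \<longlonglongrightarrow> 1" by (simp add: mult.commute)
  have "(\<lambda>n. (real n * W (a n)) / (W (a n) / V (a n))) \<longlonglongrightarrow> 1 / q"
    using nW ratio q by (intro tendsto_divide) auto
  moreover have "\<forall>\<^sub>F n in sequentially. (real n * W (a n)) / (W (a n) / V (a n)) = real n * V (a n)"
  proof -
    have "\<forall>\<^sub>F n in sequentially. W (a n) / V (a n) > 0"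
      using ratio q by (rule order_tendstoD)
    then show ?thesis
      by eventually_elim (auto simp: field_simps zero_less_divide_iff)
  qed
  ultimately have nV: "(\<lambda>n. real n * V (a n)) \<longlonglongrightarrow> 1 / q"
    by (simp cong: tendsto_cong)
  have Vpos: "\<forall>\<^sub>F n in sequentially. V (a n) > 0"
    using order_tendstoD(1)[OF ratio q] by (rule eventually_mono) (use V0 in \<open>auto simp: zero_less_divide_iff less_le\<close>)
  \<comment> \<open>As \<open>n P(|X\<^sub>0| > a\<^sub>n)\<close> tends to \<open>1\<close>, the constant that turns \<open>\<mu>\<close> into the limit under the
    normalisation \<open>n\<close> is \<open>1 / q\<close>.\<close>
  define N where "N = scale_measure (ennreal (1 / q)) \<mu>"
  have radN: "radon_measure (block_top0 h) N"
    using rad q by (auto simp: radon_measure_def N_def space_scale_measure ennreal_mult_less_top)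
  have vcN: "vague_conv (block_top0 h) (\<lambda>n. scale_measure (ennreal (real n)) (lagged_law M X h (a n))) N sequentially"
    unfolding vague_conv_def
  proof (intro allI impI, elim conjE)
    fix f :: "(nat \<Rightarrow> ereal ^ 'd) \<Rightarrow> real"
    assume f: "continuous_map (block_top0 h) euclideanreal f"
      and c: "compactin (block_top0 h) (block_top0 h closure_of {x \<in> topspace (block_top0 h). f x \<noteq> 0})"
    have fm: "f \<in> borel_measurable \<mu>" using continuous_map_borel_measurable[OF f rad] .
    have fl: "f \<in> borel_measurable (lagged_law M X h x)" for x
      using continuous_map_borel_measurable[OF f radon_scaled_law[OF X, of h 1 x]] by simp
    have "((\<lambda>x. integral\<^sup>L (scale_measure (ennreal (1 / V x)) (lagged_law M X h x)) f) \<longlongrightarrow> integral\<^sup>L \<mu> f) at_top"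
      using vc f c unfolding vague_conv_def by blast
    then have "((\<lambda>x. 1 / V x * integral\<^sup>L (lagged_law M X h x) f) \<longlongrightarrow> integral\<^sup>L \<mu> f) at_top"
      using V0 fl by (simp add: integral_scale_measure)
    then have "(\<lambda>n. 1 / V (a n) * integral\<^sup>L (lagged_law M X h (a n)) f) \<longlonglongrightarrow> integral\<^sup>L \<mu> f"
      using a by (rule filterlim_compose)
    then have "(\<lambda>n. (real n * V (a n)) * (1 / V (a n) * integral\<^sup>L (lagged_law M X h (a n)) f)) \<longlonglongrightarrow> 1 / q * integral\<^sup>L \<mu> f"
      by (rule tendsto_mult[OF nV])
    moreover have "\<forall>\<^sub>F n in sequentially. (real n * V (a n)) * (1 / V (a n) * integral\<^sup>L (lagged_law M X h (a n)) f) =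
        integral\<^sup>L (scale_measure (ennreal (real n)) (lagged_law M X h (a n))) f"
      using Vpos by eventually_elim (simp add: integral_scale_measure fl)
    ultimately have "(\<lambda>n. integral\<^sup>L (scale_measure (ennreal (real n)) (lagged_law M X h (a n))) f) \<longlonglongrightarrow> 1 / q * integral\<^sup>L \<mu> f"
      by (rule Lim_transform_eventually)
    then show "(\<lambda>n. integral\<^sup>L (scale_measure (ennreal (real n)) (lagged_law M X h (a n))) f) \<longlonglongrightarrow> integral\<^sup>L N f"
      using q fm by (simp only: N_def integral_scale_measure zero_le_divide_1_iff less_imp_le)
  qed
  show ?thesis
    unfolding tail_measure_def vague_limit_def
    by (rule someI[where P="\<lambda>N. radon_measure (block_top0 h) N \<and> vague_conv (block_top0 h) (\<lambda>n. scale_measure (ennreal (real n)) (lagged_law M X h (a n))) N sequentially"])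
       (use radN vcN in blast)
qed

section \<open>Limits of exceedance probabilities\<close>

definition scaled_preimage :: "real \<Rightarrow> (ereal ^ 'd) set \<Rightarrow> (real ^ 'd) set" where
  "scaled_preimage u C = {x. ext_vec (inverse u *\<^sub>R x) \<in> C}"

lemma exceed_eq: "exceed X u C t = {\<omega>. X t \<omega> \<in> scaled_preimage u C}"
  by (simp add: exceed_def scaled_preimage_def)

lemma scaled_preimage_borel:
  assumes "C \<in> sets borel"
  shows "scaled_preimage u C \<in> sets borel"
proof -
  have "continuous_on UNIV (\<lambda>x::real ^ 'a. ext_vec (inverse u *\<^sub>R x))"
    by (intro continuous_on_compose2[OF continuous_on_ext_vec] continuous_intros) auto
  then have "(\<lambda>x::real ^ 'a. ext_vec (inverse u *\<^sub>R x)) \<in> borel_measurable borel"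
    by (rule borel_measurable_continuous_onI)
  from measurable_sets[OF this assms] show ?thesis
    by (simp add: scaled_preimage_def vimage_def)
qed

lemma scaled_preimage_norm:
  assumes "C \<subseteq> {x. ext_norm x > ereal \<epsilon>}" "0 < u" "x \<in> scaled_preimage u C"
  shows "norm x > \<epsilon> * u"
proof -
  have "ext_norm (ext_vec (inverse u *\<^sub>R x)) > ereal \<epsilon>"
    using assms by (auto simp: scaled_preimage_def)
  then show ?thesis using assms(2) by (simp add: ext_norm_ext_vec field_simps)
qed

lemma (in prob_space) tail_measure_limit:
  fixes X :: "int \<Rightarrow> 'a \<Rightarrow> real ^ 'd"
  assumes X: "strictly_stationary M X" and rv: "regularly_varying M X \<alpha>"
    and a: "filterlim a at_top sequentially"
    and an: "(\<lambda>n. prob {\<omega> \<in> space M. norm (X 0 \<omega>) > a n}) \<sim>[sequentially] (\<lambda>n. 1 / real n)"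
    and i: "i \<in> {1..h}" and s: "0 < s"
    and B: "continuity_set (block_top0 h) (tail_measure M X a h) B" "B \<subseteq> block_ge h i s"
  shows "(\<lambda>n. real n * prob {\<omega> \<in> space M. lagged_scaled X h (a n) \<omega> \<in> B}) \<longlonglongrightarrow>
    measure (tail_measure M X a h) B"
proof -
  have h: "1 \<le> h" using i by simp
  note ex = tail_measure_exists[OF X rv a an h]
  have "B \<in> sets (borel_of (block_top0 h))"
    using B(1) ex by (simp add: continuity_set_def radon_measure_def)
  moreover have "(\<lambda>n. measure (scale_measure (ennreal (real n)) (lagged_law M X h (a n))) B) \<longlonglongrightarrow>
      measure (tail_measure M X a h) B"
    by (rule vague_conv_continuity_set[OF metrizable_block_top0 locally_compact_block_top0 conjunct1[OF ex]
      radon_scaled_law[OF X] conjunct2[OF ex] B(1) compactin_closure_block[OF B(2) s i]])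
  ultimately show ?thesis
    by (simp add: measure_scale_measure measure_lagged_law[OF X])
qed

text \<open>
  The measure \<open>\<nu>\<^sub>1\<close> on vectors is the image of the one on blocks of length one under a continuous map, so
  the frontier of the preimage of \<open>C\<close> lies in the preimage of the frontier and is negligible as well.
\<close>

theorem (in prob_space) tail_measure1_limit:
  fixes X :: "int \<Rightarrow> 'a \<Rightarrow> real ^ 'd"
  assumes X: "strictly_stationary M X" and rv: "regularly_varying M X \<alpha>"
    and a: "filterlim a at_top sequentially"
    and an: "(\<lambda>n. prob {\<omega> \<in> space M. norm (X 0 \<omega>) > a n}) \<sim>[sequentially] (\<lambda>n. 1 / real n)"
    and Cb: "C \<in> sets borel" and C0: "bounded_away_from_zero C"
    and C: "continuity_set (top_of_set (- {0})) (tail_measure1 M X a) C"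
  shows "(\<lambda>n. real n * prob {\<omega> \<in> space M. X 0 \<omega> \<in> scaled_preimage (a n) C}) \<longlonglongrightarrow>
    measure (tail_measure1 M X a) C"
proof -
  let ?N = "tail_measure M X a 1" and ?S = "block_top0 1 :: (nat \<Rightarrow> ereal ^ 'd) topology"
  let ?Y = "top_of_set (- {0 :: ereal ^ 'd})" and ?p = "\<lambda>y :: nat \<Rightarrow> ereal ^ 'd. y 1"
  obtain \<epsilon> where \<epsilon>: "0 < \<epsilon>" "C \<subseteq> {x. ext_norm x > ereal \<epsilon>}"
    using C0 by (auto simp: bounded_away_from_zero_def)
  have rad: "radon_measure ?S ?N"
    using tail_measure_exists[OF X rv a an, of 1] by simp
  have "y 1 \<noteq> 0" if y: "y \<in> topspace ?S" for y
  proof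
    assume "y 1 = 0"
    moreover have "y \<in> extensional {1..1}" using y by (auto simp: topspace_block_top0 topspace_block_top PiE_def)
    ultimately have "y = (\<lambda>i\<in>{1..1}. 0)" by (auto simp: fun_eq_iff extensional_def restrict_def)
    then show False using y by (auto simp: topspace_block_top0)
  qed
  then have p: "continuous_map ?S ?Y ?p"
    unfolding continuous_map_in_subtopology
    using continuous_map_from_subtopology[OF continuous_block_coordinate[of 1 1]]
    by (auto simp: block_top0_def)
  have Csub: "C \<subseteq> - {0}"
    using \<epsilon> ext_norm_zero_iff[of "0 :: ereal ^ 'd"] by auto
  let ?B = "{y \<in> topspace ?S. y 1 \<in> C}"
  have pm: "?p \<in> ?N \<rightarrow>\<^sub>M borel_of ?Y"
    unfolding borel_of_def
  proof (rule measurable_measure_of)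
    show "?p \<in> space ?N \<rightarrow> topspace ?Y"
      using continuous_map_funspace[OF p] rad by (auto simp: radon_measure_def)
    fix U assume "U \<in> {U. openin ?Y U}"
    then have "openin ?S {y \<in> topspace ?S. y 1 \<in> U}"
      using openin_continuous_map_preimage[OF p] by blast
    then have "{y \<in> topspace ?S. y 1 \<in> U} \<in> sets ?N" by (rule radon_measure_openin[OF rad])
    then show "?p -` U \<inter> space ?N \<in> sets ?N"
      using rad by (simp add: radon_measure_def vimage_def Int_def conj_commute)
  qed (auto dest: openin_subset)
  have Cs: "C \<in> sets (borel_of ?Y)" and fr0: "emeasure (tail_measure1 M X a) (?Y frontier_of C) = 0"
    using C by (auto simp: continuity_set_def tail_measure1_def)
  have pre: "?p -` D \<inter> space ?N = {y \<in> topspace ?S. y 1 \<in> D}" for D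
    using rad by (auto simp: radon_measure_def)
  have Bs: "?B \<in> sets ?N"
    using measurable_sets[OF pm Cs] by (simp only: pre)
  have mB: "measure (tail_measure1 M X a) C = measure ?N ?B"
    unfolding tail_measure1_def measure_distr[OF pm Cs] pre ..
  let ?FR = "{y \<in> topspace ?S. y 1 \<in> ?Y frontier_of C}"
  have FRb: "?Y frontier_of C \<in> sets (borel_of ?Y)"
  proof -
    have "openin ?Y (topspace ?Y - ?Y frontier_of C)"
      using closedin_frontier_of[of ?Y C] by (simp only: closedin_def)
    then have "topspace ?Y - (topspace ?Y - ?Y frontier_of C) \<in> sets (borel_of ?Y)"
      using sets.compl_sets[OF openin_borel_of] by (metis space_borel_of)
    then show ?thesis
      using frontier_of_subset_topspace[of ?Y C] by (simp add: double_diff)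
  qed
  have FR0: "emeasure ?N ?FR = 0"
    using fr0 unfolding tail_measure1_def emeasure_distr[OF pm FRb] pre .
  have "?S frontier_of ?B \<subseteq> ?FR"
  proof
    fix y assume y: "y \<in> ?S frontier_of ?B"
    have cl: "?S closure_of ?B \<subseteq> {y \<in> topspace ?S. y 1 \<in> ?Y closure_of C}"
      using closure_of_subset[of C ?Y] Csub closedin_continuous_map_preimage[OF p closedin_closure_of]
      by (intro closure_of_minimal) auto
    have it: "{y \<in> topspace ?S. y 1 \<in> ?Y interior_of C} \<subseteq> ?S interior_of ?B"
      using interior_of_subset[of ?Y C] openin_continuous_map_preimage[OF p openin_interior_of]
      by (intro interior_of_maximal) auto
    show "y \<in> ?FR" using y cl it by (auto simp: frontier_of_def)
  qed
  then have "emeasure ?N (?S frontier_of ?B) \<le> emeasure ?N ?FR"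
    using measurable_sets[OF pm FRb] unfolding pre by (intro emeasure_mono)
  then have cB: "continuity_set ?S ?N ?B"
    using FR0 Bs by (simp add: continuity_set_def)
  have "?B \<subseteq> block_ge 1 1 \<epsilon>"
    using \<epsilon> by (auto simp: block_ge_def topspace_block_top0 intro: order.strict_implies_order)
  from tail_measure_limit[OF X rv a an _ \<epsilon>(1) cB this]
  have lim: "(\<lambda>n. real n * prob {\<omega> \<in> space M. lagged_scaled X 1 (a n) \<omega> \<in> ?B}) \<longlonglongrightarrow> measure ?N ?B"
    by simp
  have ext0: "ext_vec (0 :: real ^ 'd) = 0" by (simp add: ext_vec_def vec_eq_iff zero_ereal_def)
  have mem: "lagged_scaled X 1 u \<omega> \<in> ?B \<longleftrightarrow> X 1 \<omega> \<in> scaled_preimage u C" for u \<omega>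
  proof -
    have "lagged_scaled X 1 u \<omega> 1 = ext_vec (inverse u *\<^sub>R X 1 \<omega>)" by (simp add: lagged_scaled_def)
    moreover from this have "lagged_scaled X 1 u \<omega> \<in> topspace ?S" if "ext_vec (inverse u *\<^sub>R X 1 \<omega>) \<in> C"
      using that Csub by (auto simp: topspace_block_top0 topspace_block_top lagged_scaled_def fun_eq_iff)
    ultimately show ?thesis by (auto simp: scaled_preimage_def)
  qed
  have "prob {\<omega> \<in> space M. lagged_scaled X 1 u \<omega> \<in> ?B} = prob {\<omega> \<in> space M. X 0 \<omega> \<in> scaled_preimage u C}" for u
    unfolding mem by (rule stationary_marginal[OF X scaled_preimage_borel[OF Cb]])
  then show ?thesis using lim unfolding mB by simp
qed

text \<open>
  Since \<open>C\<close> is bounded away from zero, so is the first component of every block in \<open>ends_in h C\<close>; the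
  other components are unrestricted, yet the set is relatively compact in the punctured space.
\<close>

theorem (in prob_space) tau_limit:
  fixes X :: "int \<Rightarrow> 'a \<Rightarrow> real ^ 'd"
  assumes X: "strictly_stationary M X" and rv: "regularly_varying M X \<alpha>"
    and a: "filterlim a at_top sequentially"
    and an: "(\<lambda>n. prob {\<omega> \<in> space M. norm (X 0 \<omega>) > a n}) \<sim>[sequentially] (\<lambda>n. 1 / real n)"
    and Cb: "C \<in> sets borel" and C0: "bounded_away_from_zero C" and h: "1 \<le> h"
    and C: "continuity_set (block_top0 (h + 1)) (tail_measure M X a (h + 1)) (ends_in h C)"
  shows "(\<lambda>n. real n * prob {\<omega> \<in> space M. X 0 \<omega> \<in> scaled_preimage (a n) C \<and> X (int h) \<omega> \<in> scaled_preimage (a n) C})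
    \<longlonglongrightarrow> tau M X a C h"
proof -
  obtain \<epsilon> where \<epsilon>: "0 < \<epsilon>" "C \<subseteq> {x. ext_norm x > ereal \<epsilon>}"
    using C0 by (auto simp: bounded_away_from_zero_def)
  have sub: "ends_in h C \<subseteq> block_ge (h + 1) 1 \<epsilon>"
  proof
    fix y assume y: "y \<in> ends_in h C"
    then have "y 1 \<in> C" using PiE_mem[OF y[unfolded ends_in_def], of 1] by simp
    then have "ereal \<epsilon> \<le> ext_norm (y 1)" using \<epsilon>(2) by (auto intro: order.strict_implies_order)
    moreover have "y \<in> topspace (block_top (h + 1))"
      using y by (auto simp: ends_in_def topspace_block_top PiE_def)
    ultimately show "y \<in> block_ge (h + 1) 1 \<epsilon>" by (simp add: block_ge_def)
  qed
  from tail_measure_limit[OF X rv a an _ \<epsilon>(1) C sub]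
  have lim: "(\<lambda>n. real n * prob {\<omega> \<in> space M. lagged_scaled X (h + 1) (a n) \<omega> \<in> ends_in h C})
      \<longlonglongrightarrow> tau M X a C h"
    by (simp add: tau_def)
  have mem: "lagged_scaled X (h + 1) u \<omega> \<in> ends_in h C \<longleftrightarrow>
      X (0 + 1) \<omega> \<in> scaled_preimage u C \<and> X (int h + 1) \<omega> \<in> scaled_preimage u C" for u \<omega>
  proof -
    have "lagged_scaled X (h + 1) u \<omega> \<in> ends_in h C \<longleftrightarrow>
       (\<forall>i\<in>{1..h + 1}. i = 1 \<or> i = h + 1 \<longrightarrow> X (int i) \<omega> \<in> scaled_preimage u C)"
      by (auto simp: lagged_scaled_def ends_in_def PiE_iff scaled_preimage_def)
    also have "\<dots> \<longleftrightarrow> X (0 + 1) \<omega> \<in> scaled_preimage u C \<and> X (int h + 1) \<omega> \<in> scaled_preimage u C"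
      using h by (auto simp: add.commute)
    finally show ?thesis .
  qed
  show ?thesis
    using lim unfolding mem stationary_pair[OF X scaled_preimage_borel[OF Cb]] .
qed

section \<open>Mixing and covariances\<close>

lemma card_multiples_below:
  assumes "0 \<le> u" "u \<le> 1" "0 < n"
  shows "\<bar>u - (\<Sum>k=1..n. of_bool (u \<ge> real k / real n)) / real n\<bar> \<le> 1 / real n"
proof -
  define m where "m = nat \<lfloor>real n * u\<rfloor>"
  have f0: "0 \<le> \<lfloor>real n * u\<rfloor>" using assms by simp
  have m: "real m \<le> real n * u" "real n * u < real m + 1"
    using f0 unfolding m_def by (simp_all add: of_nat_nat)
  have "real n * u \<le> real n * 1" using assms by (intro mult_left_mono) auto
  then have "m \<le> n" using m(1) by linarith
  have "{k \<in> {1..n}. u \<ge> real k / real n} = {1..m}"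
  proof (intro equalityI subsetI)
    fix k assume k: "k \<in> {k \<in> {1..n}. u \<ge> real k / real n}"
    then have "real k \<le> real n * u" using assms(3) by (simp add: field_simps)
    then have "real k < real m + 1" using m by linarith
    then show "k \<in> {1..m}" using k by simp
  next
    fix k assume k: "k \<in> {1..m}"
    then have "real k \<le> real n * u" using m(1) by (simp add: order_trans[OF _ m(1)])
    then show "k \<in> {k \<in> {1..n}. u \<ge> real k / real n}" using k \<open>m \<le> n\<close> assms(3) by (simp add: field_simps)
  qed
  then have "(\<Sum>k=1..n. of_bool (u \<ge> real k / real n) :: real) = real m"
    by (simp add: sum.If_cases of_bool_def Int_def)
  moreover have "\<bar>u - real m / real n\<bar> = \<bar>real n * u - real m\<bar> / real n"
  proof -
    have "u - real m / real n = (real n * u - real m) / real n" using assms(3) by (simp add: field_simps)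
    then show ?thesis by (simp only: abs_divide abs_of_nat)
  qed
  moreover have "\<bar>real n * u - real m\<bar> / real n \<le> 1 / real n"
    using m by (intro divide_right_mono) auto
  ultimately show ?thesis by simp
qed

text \<open>
  Staircase approximation turns a function with values in the unit interval into an average of
  indicators of its level sets; the covariance is then an average of covariances of events.
\<close>

lemma (in prob_space) covariance_le_events_unit:
  fixes U V :: "'a \<Rightarrow> real"
  assumes U[measurable]: "U \<in> borel_measurable M" and V[measurable]: "V \<in> borel_measurable M"
    and U01: "\<And>\<omega>. 0 \<le> U \<omega>" "\<And>\<omega>. U \<omega> \<le> 1" and V01: "\<And>\<omega>. 0 \<le> V \<omega>" "\<And>\<omega>. V \<omega> \<le> 1"
    and ev: "\<And>s t. \<bar>prob {\<omega> \<in> space M. U \<omega> \<ge> s \<and> V \<omega> \<ge> t} -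
       prob {\<omega> \<in> space M. U \<omega> \<ge> s} * prob {\<omega> \<in> space M. V \<omega> \<ge> t}\<bar> \<le> c"
  shows "\<bar>expectation (\<lambda>\<omega>. U \<omega> * V \<omega>) - expectation U * expectation V\<bar> \<le> c"
proof -
  have main: "\<bar>expectation (\<lambda>\<omega>. U \<omega> * V \<omega>) - expectation U * expectation V\<bar> \<le> c + 4 / real n"
    if n: "0 < n" for n
  proof -
    define stair where "stair W \<omega> = (\<Sum>k=1..n. of_bool (W \<omega> \<ge> real k / real n)) / real n"
      for W :: "'a \<Rightarrow> real" and \<omega>
    have st[measurable]: "stair W \<in> borel_measurable M" if [measurable]: "W \<in> borel_measurable M" for W
      unfolding stair_def by measurable
    have st01: "0 \<le> stair W \<omega>" "stair W \<omega> \<le> 1" for W \<omega>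
    proof -
      have "(\<Sum>k=1..n. of_bool (W \<omega> \<ge> real k / real n) :: real) \<le> (\<Sum>k=1..n. 1)"
        by (intro sum_mono) auto
      then show "0 \<le> stair W \<omega>" "stair W \<omega> \<le> 1"
        using n by (auto simp: stair_def field_simps intro!: sum_nonneg divide_nonneg_nonneg)
    qed
    have dU: "\<bar>U \<omega> - stair U \<omega>\<bar> \<le> 1 / real n" for \<omega>
      using card_multiples_below[OF U01 n] by (simp add: stair_def)
    have dV: "\<bar>V \<omega> - stair V \<omega>\<bar> \<le> 1 / real n" for \<omega>
      using card_multiples_below[OF V01 n] by (simp add: stair_def)
    have intb: "integrable M W" if "W \<in> borel_measurable M" "\<And>\<omega>. 0 \<le> W \<omega>" "\<And>\<omega>. W \<omega> \<le> 1" for W :: "'a \<Rightarrow> real"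
      using that by (intro integrable_const_bound[of _ 1]) (auto intro!: AE_I2)
    have prod01: "0 \<le> x * y" "x * y \<le> 1" if "0 \<le> x" "x \<le> 1" "0 \<le> y" "y \<le> 1" for x y :: real
      using that mult_le_one[of x y] by auto
    have prodd: "\<bar>x * y - x' * y'\<bar> \<le> 2 * d" if "\<bar>x - x'\<bar> \<le> d" "\<bar>y - y'\<bar> \<le> d"
      "0 \<le> x" "x \<le> 1" "0 \<le> y'" "y' \<le> 1" for x y x' y' d :: real
    proof -
      have "x * y - x' * y' = x * (y - y') + (x - x') * y'" by (simp add: algebra_simps)
      then have "\<bar>x * y - x' * y'\<bar> \<le> \<bar>x\<bar> * \<bar>y - y'\<bar> + \<bar>x - x'\<bar> * \<bar>y'\<bar>"
        by (metis abs_triangle_ineq abs_mult)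
      also have "\<dots> \<le> 1 * d + d * 1" using that by (intro add_mono mult_mono) auto
      finally show ?thesis by simp
    qed
    have expd: "\<bar>expectation W - expectation W'\<bar> \<le> d"
      if "integrable M W" "integrable M W'" "\<And>\<omega>. \<bar>W \<omega> - W' \<omega>\<bar> \<le> d" for W W' :: "'a \<Rightarrow> real" and d
    proof -
      have "\<bar>expectation W - expectation W'\<bar> = \<bar>expectation (\<lambda>\<omega>. W \<omega> - W' \<omega>)\<bar>" using that by simp
      also have "\<dots> \<le> expectation (\<lambda>\<omega>. \<bar>W \<omega> - W' \<omega>\<bar>)" by (rule integral_abs_bound)
      also have "\<dots> \<le> d" using that by (intro integral_le_const) (auto intro!: AE_I2)
      finally show ?thesis .
    qed
    have E01: "0 \<le> expectation W \<and> expectation W \<le> 1" if "W \<in> borel_measurable M" "\<And>\<omega>. 0 \<le> W \<omega>" "\<And>\<omega>. W \<omega> \<le> 1" for W :: "'a \<Rightarrow> real"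
      using intb[OF that] that by (auto intro!: integral_le_const AE_I2)
    have d1: "\<bar>expectation (\<lambda>\<omega>. U \<omega> * V \<omega>) - expectation (\<lambda>\<omega>. stair U \<omega> * stair V \<omega>)\<bar> \<le> 2 * (1 / real n)"
      by (intro expd intb prodd dU dV U01 V01 st01 prod01) measurable
    have d2: "\<bar>expectation U * expectation V - expectation (stair U) * expectation (stair V)\<bar> \<le> 2 * (1 / real n)"
      using E01[OF U U01] E01[OF st[OF V] st01]
      by (intro prodd expd intb dU dV U V U01 V01 st01 st) auto
    let ?e = "\<lambda>s t. prob {\<omega> \<in> space M. U \<omega> \<ge> s \<and> V \<omega> \<ge> t} -
       prob {\<omega> \<in> space M. U \<omega> \<ge> s} * prob {\<omega> \<in> space M. V \<omega> \<ge> t}"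
    have ind: "expectation (\<lambda>\<omega>. of_bool (P \<omega>) :: real) = prob {\<omega> \<in> space M. P \<omega>}" if "{\<omega> \<in> space M. P \<omega>} \<in> sets M" for P
    proof -
      have "expectation (\<lambda>\<omega>. of_bool (P \<omega>) :: real) = expectation (indicator {\<omega> \<in> space M. P \<omega>})"
        by (intro Bochner_Integration.integral_cong) (auto simp: indicator_def)
      then show ?thesis using that by simp
    qed
    have intbool: "integrable M (\<lambda>\<omega>. of_bool (P \<omega>) :: real)" if "Measurable.pred M P" for P
      using that by (intro intb) auto
    have EW: "expectation (stair W) = (\<Sum>k=1..n. prob {\<omega> \<in> space M. W \<omega> \<ge> real k / real n}) / real n"
      if [measurable]: "W \<in> borel_measurable M" for W
      unfolding stair_def by (simp add: intbool ind del: sum_of_bool_eq)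
    have "expectation (\<lambda>\<omega>. stair U \<omega> * stair V \<omega>) =
        expectation (\<lambda>\<omega>. (\<Sum>k=1..n. \<Sum>l=1..n. of_bool (U \<omega> \<ge> real k / real n \<and> V \<omega> \<ge> real l / real n)) / (real n * real n))"
      unfolding stair_def by (simp add: sum_product of_bool_conj del: sum_of_bool_eq)
    also have "\<dots> = (\<Sum>k=1..n. \<Sum>l=1..n. prob {\<omega> \<in> space M. U \<omega> \<ge> real k / real n \<and> V \<omega> \<ge> real l / real n}) / (real n * real n)"
      by (simp add: intbool ind del: of_bool_conj sum_of_bool_eq)
    finally have "expectation (\<lambda>\<omega>. stair U \<omega> * stair V \<omega>) - expectation (stair U) * expectation (stair V) =
        (\<Sum>k=1..n. \<Sum>l=1..n. ?e (real k / real n) (real l / real n)) / (real n * real n)"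
      by (simp add: EW sum_product sum_subtractf diff_divide_distrib)
    also have "\<bar>\<dots>\<bar> \<le> (\<Sum>k=1..n. \<Sum>l=1..n. c) / (real n * real n)"
      unfolding abs_divide by (intro divide_mono order_trans[OF sum_abs] sum_mono ev) (use n in auto)
    also have "\<dots> = c" using n by simp
    finally have "\<bar>expectation (\<lambda>\<omega>. stair U \<omega> * stair V \<omega>) - expectation (stair U) * expectation (stair V)\<bar> \<le> c" .
    then show ?thesis using d1 d2 by (simp add: abs_le_iff)
  qed
  show ?thesis
  proof (rule field_le_epsilon)
    fix e :: real assume "0 < e"
    then obtain n where n: "inverse (real (Suc n)) < e / 4"
      using reals_Archimedean[of "e / 4"] by auto
    then have "4 / real (Suc n) \<le> e" by (simp add: field_simps)
    then show "\<bar>expectation (\<lambda>\<omega>. U \<omega> * V \<omega>) - expectation U * expectation V\<bar> \<le> c + e"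
      using main[of "Suc n"] by linarith
  qed
qed

lemma (in prob_space) covariance_le_events:
  fixes U V :: "'a \<Rightarrow> real"
  assumes U[measurable]: "U \<in> borel_measurable M" and V[measurable]: "V \<in> borel_measurable M"
    and U1: "\<And>\<omega>. \<bar>U \<omega>\<bar> \<le> 1" and V1: "\<And>\<omega>. \<bar>V \<omega>\<bar> \<le> 1"
    and ev: "\<And>s t. \<bar>prob {\<omega> \<in> space M. U \<omega> \<ge> s \<and> V \<omega> \<ge> t} -
       prob {\<omega> \<in> space M. U \<omega> \<ge> s} * prob {\<omega> \<in> space M. V \<omega> \<ge> t}\<bar> \<le> c"
  shows "\<bar>expectation (\<lambda>\<omega>. U \<omega> * V \<omega>) - expectation U * expectation V\<bar> \<le> 4 * c"
proof -
  let ?h = "\<lambda>W \<omega>. (W \<omega> + 1) / 2 :: real"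
  have int: "integrable M U" "integrable M V" "integrable M (\<lambda>\<omega>. U \<omega> * V \<omega>)"
    using U1 V1 mult_mono[OF U1 V1] by (auto intro!: integrable_const_bound[of _ 1] AE_I2 simp: abs_mult)
  have lev: "{\<omega> \<in> space M. ?h W \<omega> \<ge> s} = {\<omega> \<in> space M. W \<omega> \<ge> 2 * s - 1}" for W s
    by (auto simp: field_simps)
  have lev2: "{\<omega> \<in> space M. ?h U \<omega> \<ge> s \<and> ?h V \<omega> \<ge> t} = {\<omega> \<in> space M. U \<omega> \<ge> 2 * s - 1 \<and> V \<omega> \<ge> 2 * t - 1}" for s t
    by (auto simp: field_simps)
  have "\<bar>expectation (\<lambda>\<omega>. ?h U \<omega> * ?h V \<omega>) - expectation (?h U) * expectation (?h V)\<bar> \<le> c"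
  proof (rule covariance_le_events_unit)
    show "0 \<le> ?h U \<omega>" "?h U \<omega> \<le> 1" "0 \<le> ?h V \<omega>" "?h V \<omega> \<le> 1" for \<omega>
      using U1[of \<omega>] V1[of \<omega>] by auto
    show "\<bar>prob {\<omega> \<in> space M. ?h U \<omega> \<ge> s \<and> ?h V \<omega> \<ge> t} -
      prob {\<omega> \<in> space M. ?h U \<omega> \<ge> s} * prob {\<omega> \<in> space M. ?h V \<omega> \<ge> t}\<bar> \<le> c" for s t
      unfolding lev lev2 by (rule ev)
  qed auto
  moreover have "expectation (\<lambda>\<omega>. ?h U \<omega> * ?h V \<omega>) = (expectation (\<lambda>\<omega>. U \<omega> * V \<omega>) + expectation U + expectation V + 1) / 4"
  proof -
    have "(\<lambda>\<omega>. ?h U \<omega> * ?h V \<omega>) = (\<lambda>\<omega>. (U \<omega> * V \<omega> + U \<omega> + V \<omega> + 1) / 4)"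
      by (auto simp: field_simps)
    then show ?thesis using int by (simp add: prob_space)
  qed
  moreover have "expectation (?h U) = (expectation U + 1) / 2" "expectation (?h V) = (expectation V + 1) / 2"
    using int by (simp_all add: prob_space)
  ultimately have "\<bar>(expectation (\<lambda>\<omega>. U \<omega> * V \<omega>) - expectation U * expectation V) / 4\<bar> \<le> c"
    by (simp add: field_simps)
  then show ?thesis by simp
qed

text \<open>Splitting into real and imaginary parts costs a factor of four.\<close>

lemma (in prob_space) covariance_complex_le:
  fixes U V :: "'a \<Rightarrow> complex"
  assumes U[measurable]: "U \<in> borel_measurable M" and V[measurable]: "V \<in> borel_measurable M"
    and U1: "\<And>\<omega>. cmod (U \<omega>) \<le> 1" and V1: "\<And>\<omega>. cmod (V \<omega>) \<le> 1"
    and cov: "\<And>f g. f \<in> {Re, Im} \<Longrightarrow> g \<in> {Re, Im} \<Longrightarrow>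
       \<bar>expectation (\<lambda>\<omega>. f (U \<omega>) * g (V \<omega>)) - expectation (\<lambda>\<omega>. f (U \<omega>)) * expectation (\<lambda>\<omega>. g (V \<omega>))\<bar> \<le> c"
  shows "cmod (expectation (\<lambda>\<omega>. U \<omega> * V \<omega>) - expectation U * expectation V) \<le> 4 * c"
proof -
  have le1: "\<bar>f (U \<omega>)\<bar> \<le> 1" "\<bar>f (V \<omega>)\<bar> \<le> 1" if "f \<in> {Re, Im}" for f \<omega>
    using that U1[of \<omega>] V1[of \<omega>] abs_Re_le_cmod[of "U \<omega>"] abs_Im_le_cmod[of "U \<omega>"]
      abs_Re_le_cmod[of "V \<omega>"] abs_Im_le_cmod[of "V \<omega>"] by auto
  have mfs: "(\<lambda>\<omega>. f (U \<omega>)) \<in> borel_measurable M" "(\<lambda>\<omega>. f (V \<omega>)) \<in> borel_measurable M" if "f \<in> {Re, Im}" for f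
    using that by auto
  define cv where "cv f g = expectation (\<lambda>\<omega>. f (U \<omega>) * g (V \<omega>)) - expectation (\<lambda>\<omega>. f (U \<omega>)) * expectation (\<lambda>\<omega>. g (V \<omega>))"
    for f g :: "complex \<Rightarrow> real"
  have cv: "\<bar>cv f g\<bar> \<le> c" if "f \<in> {Re, Im}" "g \<in> {Re, Im}" for f g
    unfolding cv_def using that by (rule cov)
  have intR: "integrable M (\<lambda>\<omega>. f (U \<omega>) * g (V \<omega>))" if "f \<in> {Re, Im}" "g \<in> {Re, Im}" for f g
    using mfs[OF that(1)] mfs[OF that(2)] mult_mono[OF le1(1)[OF that(1)] le1(2)[OF that(2)]]
    by (auto intro!: integrable_const_bound[of _ 1] AE_I2 simp: abs_mult)
  have intUV: "integrable M U" "integrable M V"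
    using U1 V1 by (auto intro!: integrable_const_bound[of _ 1] AE_I2)
  have intP: "integrable M (\<lambda>\<omega>. U \<omega> * V \<omega>)"
    using mult_mono[OF U1 V1] by (auto intro!: integrable_const_bound[of _ 1] AE_I2 simp: norm_mult)
  have "expectation (\<lambda>\<omega>. U \<omega> * V \<omega>) - expectation U * expectation V =
      Complex (cv Re Re - cv Im Im) (cv Re Im + cv Im Re)"
    using intR intUV intP
    by (simp add: complex_eq_iff cv_def integral_Re[symmetric] integral_Im[symmetric]
        del: integral_Re integral_Im)
  also have "cmod \<dots> \<le> \<bar>cv Re Re - cv Im Im\<bar> + \<bar>cv Re Im + cv Im Re\<bar>"
    using cmod_le[of "Complex (cv Re Re - cv Im Im) (cv Re Im + cv Im Re)"] by simp
  also have "\<dots> \<le> 4 * c"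
    using cv[of Re Re] cv[of Re Im] cv[of Im Re] cv[of Im Im] by auto
  finally show ?thesis .
qed

lemma (in prob_space) mixing_rate_upper:
  assumes "A \<in> generated_events M X {..0}" "B \<in> generated_events M X {int h..}"
  shows "\<bar>prob (A \<inter> B) - prob A * prob B\<bar> \<le> mixing_rate M X h"
  unfolding mixing_rate_def
proof (rule cSup_upper)
  have "\<bar>prob (A \<inter> B) - prob A * prob B\<bar> \<le> 1" for A B
  proof -
    have "prob A * prob B \<le> 1" "0 \<le> prob A * prob B" by (auto intro: mult_le_one)
    then show ?thesis using prob_le_1[of "A \<inter> B"] measure_nonneg[of M "A \<inter> B"] by linarith
  qed
  then show "bdd_above {\<bar>prob (A \<inter> B) - prob A * prob B\<bar> |A B.
      A \<in> generated_events M X {..0} \<and> B \<in> generated_events M X {int h..}}"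
    by (intro bdd_aboveI[of _ 1]) auto
qed (use assms in blast)

lemma (in prob_space) mixing_rate_nonneg: "0 \<le> mixing_rate M X h"
  using mixing_rate_upper[of "{}" X "{}" h] by (simp add: generated_events_def sigma_sets.Empty)

lemma finite_block_generated:
  fixes X :: "int \<Rightarrow> 'a \<Rightarrow> real ^ 'd"
  assumes "finite J" and sub: "(\<lambda>s. s + k) ` J \<subseteq> T"
    and S: "S \<in> sets (\<Pi>\<^sub>M s\<in>J. borel)"
  shows "{\<omega> \<in> space M. (\<lambda>s\<in>J. X (s + k) \<omega>) \<in> S} \<in> generated_events M X T"
proof -
  let ?A = "\<Union>s\<in>T. {X s -` B \<inter> space M | B. B \<in> sets borel}"
  let ?G = "sigma (space M) ?A"
  have AP: "?A \<subseteq> Pow (space M)" by auto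
  have sp: "space ?G = space M" using AP by (rule space_measure_of)
  have st: "sets ?G = generated_events M X T"
    unfolding generated_events_def using AP by (rule sets_measure_of)
  have "X (s + k) \<in> ?G \<rightarrow>\<^sub>M borel" if "s \<in> J" for s
  proof (rule measurableI)
    fix B :: "(real ^ 'd) set" assume "B \<in> sets borel"
    then have "X (s + k) -` B \<inter> space M \<in> ?A" using that sub by blast
    then show "X (s + k) -` B \<inter> space ?G \<in> sets ?G"
      unfolding sp by (intro in_measure_of AP)
  qed auto
  then have "(\<lambda>\<omega>. \<lambda>s\<in>J. X (s + k) \<omega>) \<in> ?G \<rightarrow>\<^sub>M (\<Pi>\<^sub>M s\<in>J. borel)"
    by (intro measurable_restrict)
  from measurable_sets[OF this S] have "(\<lambda>\<omega>. \<lambda>s\<in>J. X (s + k) \<omega>) -` S \<inter> space M \<in> generated_events M X T"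
    by (simp only: sp st)
  also have "(\<lambda>\<omega>. \<lambda>s\<in>J. X (s + k) \<omega>) -` S \<inter> space M = {\<omega> \<in> space M. (\<lambda>s\<in>J. X (s + k) \<omega>) \<in> S}"
    by auto
  finally show ?thesis .
qed

lemma restrict_in_space_PiM_borel: "restrict f L \<in> space (\<Pi>\<^sub>M s\<in>L. borel)"
  by (simp add: space_PiM)

text \<open>
  The rate is defined with the past at time \<open>0\<close>; stationarity moves any two finite blocks separated
  by a gap \<open>h\<close> there.
\<close>

lemma (in prob_space) mixing_finite_blocks:
  assumes X: "strictly_stationary M X" and J: "finite J" "J \<subseteq> {..t}" and K: "finite K" "K \<subseteq> {t + int h..}"
    and S: "S \<in> sets (\<Pi>\<^sub>M s\<in>J. borel)" and R: "R \<in> sets (\<Pi>\<^sub>M s\<in>K. borel)"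
  shows "\<bar>prob {\<omega> \<in> space M. (\<lambda>s\<in>J. X s \<omega>) \<in> S \<and> (\<lambda>s\<in>K. X s \<omega>) \<in> R} -
    prob {\<omega> \<in> space M. (\<lambda>s\<in>J. X s \<omega>) \<in> S} * prob {\<omega> \<in> space M. (\<lambda>s\<in>K. X s \<omega>) \<in> R}\<bar> \<le> mixing_rate M X h"
proof -
  note Xm = strictly_stationary_measurable[OF X]
  have mJ: "(\<lambda>\<omega>. \<lambda>s\<in>J'. X (s + k) \<omega>) \<in> M \<rightarrow>\<^sub>M (\<Pi>\<^sub>M s\<in>J'. borel)" for J' k
    using Xm by (intro measurable_restrict) auto
  have shift: "prob {\<omega> \<in> space M. (\<lambda>s\<in>J. X (s + k) \<omega>) \<in> S' \<and> (\<lambda>s\<in>K. X (s + k) \<omega>) \<in> R'} =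
      prob {\<omega> \<in> space M. (\<lambda>s\<in>J. X s \<omega>) \<in> S' \<and> (\<lambda>s\<in>K. X s \<omega>) \<in> R'}"
    if S': "S' \<in> sets (\<Pi>\<^sub>M s\<in>J. borel)" and R': "R' \<in> sets (\<Pi>\<^sub>M s\<in>K. borel)" for S' R' k
  proof -
    let ?f = "\<lambda>y. indicat_real S' (restrict y J) * indicat_real R' (restrict y K)"
    have rJ: "(\<lambda>y. restrict y L) \<in> (\<Pi>\<^sub>M s\<in>J \<union> K. borel) \<rightarrow>\<^sub>M (\<Pi>\<^sub>M s\<in>L. borel)" if "L \<subseteq> J \<union> K" for L
      using that by (rule measurable_restrict_subset)
    have fm: "?f \<in> borel_measurable (\<Pi>\<^sub>M s\<in>J \<union> K. borel)"
      using measurable_compose[OF rJ[of J] borel_measurable_indicator[OF S']]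
        measurable_compose[OF rJ[of K] borel_measurable_indicator[OF R']]
      by (intro borel_measurable_times) auto
    have restr: "restrict (\<lambda>s\<in>J \<union> K. X (s + j) \<omega>) J = (\<lambda>s\<in>J. X (s + j) \<omega>)"
      "restrict (\<lambda>s\<in>J \<union> K. X (s + j) \<omega>) K = (\<lambda>s\<in>K. X (s + j) \<omega>)" for j \<omega>
      by (auto simp: fun_eq_iff)
    have "expectation (\<lambda>\<omega>. ?f (\<lambda>s\<in>J \<union> K. X (s + j) \<omega>)) =
        prob {\<omega> \<in> space M. (\<lambda>s\<in>J. X (s + j) \<omega>) \<in> S' \<and> (\<lambda>s\<in>K. X (s + j) \<omega>) \<in> R'}" for j
    proof -
      have "expectation (\<lambda>\<omega>. ?f (\<lambda>s\<in>J \<union> K. X (s + j) \<omega>)) =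
        expectation (indicator {\<omega> \<in> space M. (\<lambda>s\<in>J. X (s + j) \<omega>) \<in> S' \<and> (\<lambda>s\<in>K. X (s + j) \<omega>) \<in> R'})"
        unfolding restr by (intro Bochner_Integration.integral_cong) (auto simp: indicator_def)
      moreover have "{\<omega> \<in> space M. (\<lambda>s\<in>J. X (s + j) \<omega>) \<in> S' \<and> (\<lambda>s\<in>K. X (s + j) \<omega>) \<in> R'} \<in> sets M"
      proof -
        have "{\<omega> \<in> space M. (\<lambda>s\<in>J. X (s + j) \<omega>) \<in> S' \<and> (\<lambda>s\<in>K. X (s + j) \<omega>) \<in> R'} =
          ((\<lambda>\<omega>. \<lambda>s\<in>J. X (s + j) \<omega>) -` S' \<inter> space M) \<inter> ((\<lambda>\<omega>. \<lambda>s\<in>K. X (s + j) \<omega>) -` R' \<inter> space M)" by auto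
        then show ?thesis using measurable_sets[OF mJ S'] measurable_sets[OF mJ R'] by (simp only: sets.Int)
      qed
      ultimately show ?thesis by simp
    qed
    from this[of k] this[of 0] stationary_integral[OF X _ fm, of k] J(1) K(1) show ?thesis by simp
  qed
  define A where "A = {\<omega> \<in> space M. (\<lambda>s\<in>J. X (s + - t) \<omega>) \<in> S}"
  define B where "B = {\<omega> \<in> space M. (\<lambda>s\<in>K. X (s + - t) \<omega>) \<in> R}"
  have "A \<in> generated_events M X {..0}" "B \<in> generated_events M X {int h..}"
    unfolding A_def B_def using J K
    by (intro finite_block_generated[OF _ _ S] finite_block_generated[OF _ _ R]; auto)+
  from mixing_rate_upper[OF this] have "\<bar>prob (A \<inter> B) - prob A * prob B\<bar> \<le> mixing_rate M X h" .
  moreover have "A \<inter> B = {\<omega> \<in> space M. (\<lambda>s\<in>J. X (s + - t) \<omega>) \<in> S \<and> (\<lambda>s\<in>K. X (s + - t) \<omega>) \<in> R}"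
    by (auto simp: A_def B_def)
  then have "prob (A \<inter> B) = prob {\<omega> \<in> space M. (\<lambda>s\<in>J. X s \<omega>) \<in> S \<and> (\<lambda>s\<in>K. X s \<omega>) \<in> R}"
    using shift[OF S R, of "- t"] by simp
  moreover have "prob A = prob {\<omega> \<in> space M. (\<lambda>s\<in>J. X s \<omega>) \<in> S}"
    using shift[OF S sets.top, of "- t"] by (simp add: A_def restrict_in_space_PiM_borel)
  moreover have "prob B = prob {\<omega> \<in> space M. (\<lambda>s\<in>K. X s \<omega>) \<in> R}"
    using shift[OF sets.top R, of "- t"] by (simp add: B_def restrict_in_space_PiM_borel)
  ultimately show ?thesis by simp
qed

lemma (in prob_space) mixing_covariance:
  fixes u v :: "(int \<Rightarrow> real ^ 'd) \<Rightarrow> real"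
  assumes X: "strictly_stationary M X" and J: "finite J" "J \<subseteq> {..t}" and K: "finite K" "K \<subseteq> {t + int h..}"
    and u: "u \<in> borel_measurable (\<Pi>\<^sub>M s\<in>J. borel)" "\<And>y. \<bar>u y\<bar> \<le> 1"
    and v: "v \<in> borel_measurable (\<Pi>\<^sub>M s\<in>K. borel)" "\<And>y. \<bar>v y\<bar> \<le> 1"
  shows "\<bar>expectation (\<lambda>\<omega>. u (\<lambda>s\<in>J. X s \<omega>) * v (\<lambda>s\<in>K. X s \<omega>)) -
    expectation (\<lambda>\<omega>. u (\<lambda>s\<in>J. X s \<omega>)) * expectation (\<lambda>\<omega>. v (\<lambda>s\<in>K. X s \<omega>))\<bar> \<le> 4 * mixing_rate M X h"
proof (rule covariance_le_events)
  note Xm = strictly_stationary_measurable[OF X]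
  have m: "(\<lambda>\<omega>. \<lambda>s\<in>L. X s \<omega>) \<in> M \<rightarrow>\<^sub>M (\<Pi>\<^sub>M s\<in>L. borel)" for L
    using Xm by (intro measurable_restrict) auto
  have sp: "(\<lambda>s\<in>L. X s \<omega>) \<in> space (\<Pi>\<^sub>M s\<in>L. borel)" for L \<omega> by (auto simp: space_PiM)
  show "(\<lambda>\<omega>. u (\<lambda>s\<in>J. X s \<omega>)) \<in> borel_measurable M" "(\<lambda>\<omega>. v (\<lambda>s\<in>K. X s \<omega>)) \<in> borel_measurable M"
    using measurable_compose[OF m u(1)] measurable_compose[OF m v(1)] by auto
  fix p q :: real
  have "{y \<in> space (\<Pi>\<^sub>M s\<in>J. borel). u y \<ge> p} \<in> sets (\<Pi>\<^sub>M s\<in>J. borel)"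
    "{y \<in> space (\<Pi>\<^sub>M s\<in>K. borel). v y \<ge> q} \<in> sets (\<Pi>\<^sub>M s\<in>K. borel)"
    using u(1) v(1) by measurable
  from mixing_finite_blocks[OF X J K this]
  show "\<bar>prob {\<omega> \<in> space M. u (\<lambda>s\<in>J. X s \<omega>) \<ge> p \<and> v (\<lambda>s\<in>K. X s \<omega>) \<ge> q} -
      prob {\<omega> \<in> space M. u (\<lambda>s\<in>J. X s \<omega>) \<ge> p} * prob {\<omega> \<in> space M. v (\<lambda>s\<in>K. X s \<omega>) \<ge> q}\<bar> \<le> mixing_rate M X h"
    by (simp add: sp)
qed (use u v in auto)

lemma (in prob_space) mixing_covariance_complex:
  fixes u v :: "(int \<Rightarrow> real ^ 'd) \<Rightarrow> complex"
  assumes X: "strictly_stationary M X" and J: "finite J" "J \<subseteq> {..t}" and K: "finite K" "K \<subseteq> {t + int h..}"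
    and u: "u \<in> borel_measurable (\<Pi>\<^sub>M s\<in>J. borel)" "\<And>y. cmod (u y) \<le> 1"
    and v: "v \<in> borel_measurable (\<Pi>\<^sub>M s\<in>K. borel)" "\<And>y. cmod (v y) \<le> 1"
  shows "cmod (expectation (\<lambda>\<omega>. u (\<lambda>s\<in>J. X s \<omega>) * v (\<lambda>s\<in>K. X s \<omega>)) -
    expectation (\<lambda>\<omega>. u (\<lambda>s\<in>J. X s \<omega>)) * expectation (\<lambda>\<omega>. v (\<lambda>s\<in>K. X s \<omega>))) \<le> 16 * mixing_rate M X h"
proof -
  have m: "(\<lambda>\<omega>. \<lambda>s\<in>L. X s \<omega>) \<in> M \<rightarrow>\<^sub>M (\<Pi>\<^sub>M s\<in>L. borel)" for L
    using strictly_stationary_measurable[OF X] by (intro measurable_restrict) auto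
  have part: "(\<lambda>y. f (w y)) \<in> borel_measurable (\<Pi>\<^sub>M s\<in>L. borel)" "\<bar>f (w y)\<bar> \<le> 1"
    if "f \<in> {Re, Im}" "w \<in> borel_measurable (\<Pi>\<^sub>M s\<in>L. borel)" "\<And>y. cmod (w y) \<le> 1"
    for f L y and w :: "(int \<Rightarrow> real ^ 'd) \<Rightarrow> complex"
    using that by (auto intro: order_trans[OF abs_Re_le_cmod] order_trans[OF abs_Im_le_cmod])
  have "cmod (expectation (\<lambda>\<omega>. u (\<lambda>s\<in>J. X s \<omega>) * v (\<lambda>s\<in>K. X s \<omega>)) -
    expectation (\<lambda>\<omega>. u (\<lambda>s\<in>J. X s \<omega>)) * expectation (\<lambda>\<omega>. v (\<lambda>s\<in>K. X s \<omega>))) \<le> 4 * (4 * mixing_rate M X h)"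
  proof (rule covariance_complex_le)
    show "(\<lambda>\<omega>. u (\<lambda>s\<in>J. X s \<omega>)) \<in> borel_measurable M" "(\<lambda>\<omega>. v (\<lambda>s\<in>K. X s \<omega>)) \<in> borel_measurable M"
      using measurable_compose[OF m u(1)] measurable_compose[OF m v(1)] by auto
    show "\<bar>expectation (\<lambda>\<omega>. f (u (\<lambda>s\<in>J. X s \<omega>)) * g (v (\<lambda>s\<in>K. X s \<omega>))) -
        expectation (\<lambda>\<omega>. f (u (\<lambda>s\<in>J. X s \<omega>))) * expectation (\<lambda>\<omega>. g (v (\<lambda>s\<in>K. X s \<omega>)))\<bar> \<le> 4 * mixing_rate M X h"
      if "f \<in> {Re, Im}" "g \<in> {Re, Im}" for f g
      by (rule mixing_covariance[OF X J K part[OF that(1) u] part[OF that(2) v]])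
  qed (use u v in auto)
  then show ?thesis by simp
qed

section \<open>Moments of centred indicators\<close>

text \<open>
  The exceedances enter the limit theorem only through the indicators of a Borel set \<open>D\<close> for a fixed sample
  size. Their centred versions \<open>xi t\<close> form a stationary sequence with autocovariances \<open>gam h\<close>.
\<close>

locale stationary_indicator = prob_space M for M :: "'a measure" +
  fixes X :: "int \<Rightarrow> 'a \<Rightarrow> real ^ 'd" and D :: "(real ^ 'd) set"
  assumes stationary: "strictly_stationary M X" and D[measurable]: "D \<in> sets borel"
begin

definition p :: real where "p = prob {\<omega> \<in> space M. X 0 \<omega> \<in> D}"

definition xi :: "nat \<Rightarrow> 'a \<Rightarrow> real" where "xi t \<omega> = indicator D (X (int t) \<omega>) - p"

definition gam :: "nat \<Rightarrow> real" where "gam h = expectation (\<lambda>\<omega>. xi 0 \<omega> * xi h \<omega>)"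

lemma X_measurable[measurable]: "X t \<in> borel_measurable M"
  using stationary by (rule strictly_stationary_measurable)

lemma xi_measurable[measurable]: "xi t \<in> borel_measurable M"
  unfolding xi_def by measurable

lemma p_bounds: "0 \<le> p" "p \<le> 1"
  by (auto simp: p_def)

lemma xi_bound: "\<bar>xi t \<omega>\<bar> \<le> 1"
  using p_bounds by (auto simp: xi_def indicator_def)

lemma prod_xi_bound: "\<bar>\<Prod>i\<in>I. xi (t i) \<omega>\<bar> \<le> 1"
proof (cases "finite I")
  case True
  then show ?thesis by (auto simp: abs_prod intro!: prod_le_1 xi_bound)
qed simp

lemma integrable_bounded: "f \<in> borel_measurable M \<Longrightarrow> (\<And>\<omega>. \<bar>f \<omega>\<bar> \<le> c) \<Longrightarrow> integrable M (f :: 'a \<Rightarrow> real)"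
  by (intro integrable_const_bound[of _ c]) (auto intro!: AE_I2)

lemma integrable_prod_xi: "integrable M (\<lambda>\<omega>. \<Prod>i\<in>I. xi (t i) \<omega>)"
  by (rule integrable_bounded[of _ 1]) (auto intro: prod_xi_bound)

lemma integrable_xi: "integrable M (xi t)"
  by (rule integrable_bounded[of _ 1]) (auto intro: xi_bound)

lemma integrable_xi_mult: "integrable M (\<lambda>\<omega>. xi s \<omega> * xi t \<omega>)"
  using mult_mono[OF xi_bound xi_bound]
  by (intro integrable_bounded[of _ 1]) (auto simp: abs_mult)

text \<open>
  Each \<open>xi t\<close> is one and the same function of \<open>X t\<close>, so the shift invariance of the joint laws is inherited.
\<close>

lemma xi_shift:
  fixes f :: "(nat \<Rightarrow> real) \<Rightarrow> 'b::{banach, second_countable_topology}"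
  assumes J: "finite J" and f: "f \<in> borel_measurable (\<Pi>\<^sub>M t\<in>J. borel)"
  shows "expectation (\<lambda>\<omega>. f (\<lambda>t\<in>J. xi (t + k) \<omega>)) = expectation (\<lambda>\<omega>. f (\<lambda>t\<in>J. xi t \<omega>))"
proof -
  let ?g = "\<lambda>y :: int \<Rightarrow> real ^ 'd. \<lambda>t\<in>J. indicator D (y (int t)) - p :: real"
  have "?g \<in> (\<Pi>\<^sub>M t\<in>int ` J. borel) \<rightarrow>\<^sub>M (\<Pi>\<^sub>M t\<in>J. borel)"
  proof (rule measurable_restrict)
    fix t assume "t \<in> J"
    then have [measurable]: "(\<lambda>y :: int \<Rightarrow> real ^ 'd. y (int t)) \<in> (\<Pi>\<^sub>M t\<in>int ` J. borel) \<rightarrow>\<^sub>M borel"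
      by (intro measurable_component_singleton) auto
    show "(\<lambda>y. indicator D (y (int t)) - p :: real) \<in> (\<Pi>\<^sub>M t\<in>int ` J. borel) \<rightarrow>\<^sub>M borel"
      by measurable
  qed
  from measurable_compose[OF this f]
  have "(\<lambda>y. f (?g y)) \<in> borel_measurable (\<Pi>\<^sub>M t\<in>int ` J. borel)" .
  from stationary_integral[OF stationary _ this, of "int k"] J
  have "expectation (\<lambda>\<omega>. f (?g (\<lambda>t\<in>int ` J. X (t + int k) \<omega>))) = expectation (\<lambda>\<omega>. f (?g (\<lambda>t\<in>int ` J. X t \<omega>)))"
    by simp
  moreover have "?g (\<lambda>t\<in>int ` J. X (t + int k) \<omega>) = (\<lambda>t\<in>J. xi (t + k) \<omega>)"
    "?g (\<lambda>t\<in>int ` J. X t \<omega>) = (\<lambda>t\<in>J. xi t \<omega>)" for \<omega>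
    by (auto simp: xi_def fun_eq_iff)
  ultimately show ?thesis by simp
qed

lemma prob_eq_p: "prob {\<omega> \<in> space M. X t \<omega> \<in> D} = p"
  unfolding p_def by (rule stationary_marginal[OF stationary D])

lemma expectation_indicator: "expectation (\<lambda>\<omega>. indicat_real D (X t \<omega>)) = p"
proof -
  have "expectation (\<lambda>\<omega>. indicat_real D (X t \<omega>)) = expectation (indicat_real {\<omega> \<in> space M. X t \<omega> \<in> D})"
    by (intro Bochner_Integration.integral_cong) (auto simp: indicator_def)
  then show ?thesis using prob_eq_p[of t] by simp
qed

lemma integrable_indicator_D: "integrable M (\<lambda>\<omega>. indicator D (X t \<omega>) :: real)"
  by (rule integrable_bounded[of _ 1]) (auto simp: indicator_def)

lemma expectation_xi: "expectation (xi t) = 0"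
  unfolding xi_def by (simp add: expectation_indicator integrable_indicator_D prob_space)

lemma expectation_abs_xi: "expectation (\<lambda>\<omega>. \<bar>xi t \<omega>\<bar>) \<le> 2 * p"
proof -
  have "expectation (\<lambda>\<omega>. \<bar>xi t \<omega>\<bar>) \<le> expectation (\<lambda>\<omega>. indicator D (X (int t) \<omega>) + p)"
    using integrable_xi integrable_indicator_D p_bounds
    by (intro integral_mono) (auto simp: xi_def indicator_def)
  also have "\<dots> = 2 * p"
    by (simp add: expectation_indicator integrable_indicator_D prob_space)
  finally show ?thesis .
qed

lemma expectation_xi_mult: "expectation (\<lambda>\<omega>. xi s \<omega> * xi (s + h) \<omega>) = gam h"
proof -
  let ?f = "\<lambda>y :: nat \<Rightarrow> real. y 0 * y h"
  have "?f \<in> borel_measurable (\<Pi>\<^sub>M t\<in>{0, h}. borel)" by measurable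
  from xi_shift[OF _ this, of s] show ?thesis
    by (simp add: gam_def add.commute)
qed

lemma gam_eq: "gam h = prob {\<omega> \<in> space M. X 0 \<omega> \<in> D \<and> X (int h) \<omega> \<in> D} - p\<^sup>2"
proof -
  have i2: "integrable M (\<lambda>\<omega>. indicator D (X 0 \<omega>) * indicator D (X (int h) \<omega>) :: real)"
    by (rule integrable_bounded[of _ 1]) (auto simp: indicator_def)
  have e2: "expectation (\<lambda>\<omega>. indicat_real D (X 0 \<omega>) * indicator D (X (int h) \<omega>)) =
      prob {\<omega> \<in> space M. X 0 \<omega> \<in> D \<and> X (int h) \<omega> \<in> D}"
  proof -
    have "expectation (\<lambda>\<omega>. indicat_real D (X 0 \<omega>) * indicator D (X (int h) \<omega>)) =
        expectation (indicat_real {\<omega> \<in> space M. X 0 \<omega> \<in> D \<and> X (int h) \<omega> \<in> D})"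
      by (intro Bochner_Integration.integral_cong) (auto simp: indicator_def)
    then show ?thesis by simp
  qed
  have "xi 0 \<omega> * xi h \<omega> = indicator D (X 0 \<omega>) * indicator D (X (int h) \<omega>)
      - p * indicator D (X 0 \<omega>) - p * indicator D (X (int h) \<omega>) + p\<^sup>2" for \<omega>
    by (simp add: xi_def algebra_simps power2_eq_square)
  then have "gam h = expectation (\<lambda>\<omega>. indicat_real D (X 0 \<omega>) * indicator D (X (int h) \<omega>)
      - p * indicator D (X 0 \<omega>) - p * indicator D (X (int h) \<omega>) + p\<^sup>2)"
    by (simp add: gam_def)
  also have "\<dots> = prob {\<omega> \<in> space M. X 0 \<omega> \<in> D \<and> X (int h) \<omega> \<in> D} - p * p - p * p + p\<^sup>2"
    using i2 integrable_indicator_D by (simp add: e2 expectation_indicator prob_space)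
  finally show ?thesis by (simp add: power2_eq_square)
qed

lemma gam_zero: "gam 0 = p - p\<^sup>2"
  by (simp add: gam_eq p_def)

lemma gam_zero_nonneg: "0 \<le> gam 0"
  by (simp add: gam_def integral_nonneg)

lemma abs_gam_le: "\<bar>gam h\<bar> \<le> prob {\<omega> \<in> space M. X 0 \<omega> \<in> D \<and> X (int h) \<omega> \<in> D} + p\<^sup>2"
  unfolding gam_eq by (simp add: abs_le_iff add_increasing)

lemma expectation_power2_sum:
  assumes "finite T"
  shows "expectation (\<lambda>\<omega>. (\<Sum>t\<in>T. xi t \<omega>)\<^sup>2) = (\<Sum>s\<in>T. \<Sum>t\<in>T. expectation (\<lambda>\<omega>. xi s \<omega> * xi t \<omega>))"
  by (simp add: power2_eq_square sum_product integrable_xi_mult)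

lemma expectation_xi_mult_abs: "\<bar>expectation (\<lambda>\<omega>. xi s \<omega> * xi t \<omega>)\<bar> = (if s \<le> t then \<bar>gam (t - s)\<bar> else \<bar>gam (s - t)\<bar>)"
proof (cases "s \<le> t")
  case True
  then show ?thesis using expectation_xi_mult[of s "t - s"] by simp
next
  case False
  then have "expectation (\<lambda>\<omega>. xi t \<omega> * xi s \<omega>) = gam (s - t)" using expectation_xi_mult[of t "s - t"] by simp
  then show ?thesis using False by (simp add: mult.commute)
qed

text \<open>
  A bound for the absolute row sums of the covariance matrix of \<open>xi 1, \<dots>, xi N\<close>, hence for the variance
  contributed by each summand of any subset sum.
\<close>

definition Gam :: "nat \<Rightarrow> real" where "Gam N = gam 0 + 2 * (\<Sum>h=1..N. \<bar>gam h\<bar>)"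

lemma sum_abs_gam_le: "(\<Sum>h\<le>N. \<bar>gam h\<bar>) \<le> Gam N"
proof -
  have "{..N} = insert 0 {1..N}" by auto
  then have "(\<Sum>h\<le>N. \<bar>gam h\<bar>) = \<bar>gam 0\<bar> + (\<Sum>h=1..N. \<bar>gam h\<bar>)" by simp
  then show ?thesis using gam_zero_nonneg sum_nonneg[of "{1..N}" "\<lambda>h. \<bar>gam h\<bar>"] by (simp add: Gam_def)
qed

lemma Gam_nonneg: "0 \<le> Gam N"
  by (simp add: Gam_def gam_zero_nonneg sum_nonneg)

lemma variance_sum_le:
  assumes T: "T \<subseteq> {1..N}"
  shows "expectation (\<lambda>\<omega>. (\<Sum>t\<in>T. xi t \<omega>)\<^sup>2) \<le> real (card T) * Gam N"
proof -
  have fT: "finite T" using T finite_subset by blast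
  have inner: "(\<Sum>t\<in>T. \<bar>expectation (\<lambda>\<omega>. xi s \<omega> * xi t \<omega>)\<bar>) \<le> Gam N" if s: "s \<in> T" for s
  proof -
    let ?e = "\<lambda>t. \<bar>expectation (\<lambda>\<omega>. xi s \<omega> * xi t \<omega>)\<bar>"
    have sN: "1 \<le> s" "s \<le> N" using s T by auto
    have "(\<Sum>t\<in>T. ?e t) \<le> (\<Sum>t\<in>{1..N}. ?e t)" using T by (intro sum_mono2) auto
    also have "{1..N} = {1..<s} \<union> ({s} \<union> {s<..N})" using sN by auto
    also have "(\<Sum>t\<in>{1..<s} \<union> ({s} \<union> {s<..N}). ?e t) = (\<Sum>t\<in>{1..<s}. ?e t) + (\<Sum>t\<in>{s} \<union> {s<..N}. ?e t)"
      by (intro sum.union_disjoint) auto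
    also have "(\<Sum>t\<in>{s} \<union> {s<..N}. ?e t) = ?e s + (\<Sum>t\<in>{s<..N}. ?e t)" by simp
    also have "(\<Sum>t\<in>{1..<s}. ?e t) = (\<Sum>t\<in>{1..<s}. \<bar>gam (s - t)\<bar>)"
      by (intro sum.cong) (auto simp: expectation_xi_mult_abs)
    also have "\<dots> = (\<Sum>h\<in>(\<lambda>t. s - t) ` {1..<s}. \<bar>gam h\<bar>)"
      by (subst sum.reindex) (auto intro!: inj_onI)
    also have "\<dots> \<le> (\<Sum>h=1..N. \<bar>gam h\<bar>)" using sN by (intro sum_mono2) auto
    also have "(\<Sum>t\<in>{s<..N}. ?e t) = (\<Sum>t\<in>{s<..N}. \<bar>gam (t - s)\<bar>)"
      by (intro sum.cong) (auto simp: expectation_xi_mult_abs)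
    also have "\<dots> = (\<Sum>h\<in>(\<lambda>t. t - s) ` {s<..N}. \<bar>gam h\<bar>)"
      by (subst sum.reindex) (auto intro!: inj_onI)
    also have "\<dots> \<le> (\<Sum>h=1..N. \<bar>gam h\<bar>)" using sN by (intro sum_mono2) auto
    also have "?e s = gam 0" using gam_zero_nonneg by (simp add: expectation_xi_mult_abs)
    finally show ?thesis by (simp add: Gam_def)
  qed
  have "expectation (\<lambda>\<omega>. (\<Sum>t\<in>T. xi t \<omega>)\<^sup>2) \<le> (\<Sum>s\<in>T. \<Sum>t\<in>T. \<bar>expectation (\<lambda>\<omega>. xi s \<omega> * xi t \<omega>)\<bar>)"
    unfolding expectation_power2_sum[OF fT] by (intro sum_mono) auto
  also have "\<dots> \<le> (\<Sum>s\<in>T. Gam N)" by (intro sum_mono inner)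
  finally show ?thesis by simp
qed

lemma variance_sum:
  "expectation (\<lambda>\<omega>. (\<Sum>t=1..N. xi t \<omega>)\<^sup>2) = real N * gam 0 + 2 * (\<Sum>h=1..N. (real N - real h) * gam h)"
proof (induction N)
  case (Suc N)
  let ?S = "\<lambda>\<omega>. \<Sum>t=1..N. xi t \<omega>"
  have iS: "integrable M (\<lambda>\<omega>. (?S \<omega>)\<^sup>2)"
    by (simp add: power2_eq_square sum_product integrable_xi_mult)
  have iX: "integrable M (\<lambda>\<omega>. ?S \<omega> * xi (Suc N) \<omega>)"
    by (simp add: sum_distrib_right integrable_xi_mult)
  have "(\<Sum>t=1..Suc N. xi t \<omega>)\<^sup>2 = (?S \<omega>)\<^sup>2 + 2 * (?S \<omega> * xi (Suc N) \<omega>) + xi (Suc N) \<omega> * xi (Suc N) \<omega>" for \<omega>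
    by (simp add: power2_eq_square algebra_simps)
  then have "expectation (\<lambda>\<omega>. (\<Sum>t=1..Suc N. xi t \<omega>)\<^sup>2) =
      expectation (\<lambda>\<omega>. (?S \<omega>)\<^sup>2) + 2 * expectation (\<lambda>\<omega>. ?S \<omega> * xi (Suc N) \<omega>) + gam 0"
    using iS iX integrable_xi_mult expectation_xi_mult[of "Suc N" 0] by simp
  also have "expectation (\<lambda>\<omega>. ?S \<omega> * xi (Suc N) \<omega>) = (\<Sum>t=1..N. gam (Suc N - t))"
  proof -
    have "expectation (\<lambda>\<omega>. ?S \<omega> * xi (Suc N) \<omega>) = (\<Sum>t=1..N. expectation (\<lambda>\<omega>. xi t \<omega> * xi (Suc N) \<omega>))"
      by (simp add: sum_distrib_right integrable_xi_mult)
    also have "\<dots> = (\<Sum>t=1..N. gam (Suc N - t))"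
    proof (intro sum.cong refl)
      fix t assume "t \<in> {1..N}"
      then show "expectation (\<lambda>\<omega>. xi t \<omega> * xi (Suc N) \<omega>) = gam (Suc N - t)"
        using expectation_xi_mult[of t "Suc N - t"] by simp
    qed
    finally show ?thesis .
  qed
  also have "(\<Sum>t=1..N. gam (Suc N - t)) = (\<Sum>h=1..N. gam h)"
    by (rule sum.reindex_bij_witness[of _ "\<lambda>h. Suc N - h" "\<lambda>h. Suc N - h"]) auto
  finally have "expectation (\<lambda>\<omega>. (\<Sum>t=1..Suc N. xi t \<omega>)\<^sup>2) =
    real N * gam 0 + 2 * (\<Sum>h=1..N. (real N - real h) * gam h) + 2 * (\<Sum>h=1..N. gam h) + gam 0"
    using Suc.IH by simp
  also have "\<dots> = real (Suc N) * gam 0 + 2 * (\<Sum>h=1..N. (real N - real h) * gam h + gam h)"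
    by (simp add: sum.distrib distrib_left distrib_right)
  also have "(\<Sum>h=1..N. (real N - real h) * gam h + gam h) = (\<Sum>h=1..N. (real (Suc N) - real h) * gam h)"
    by (intro sum.cong refl) (simp add: left_diff_distrib distrib_right)
  also have "\<dots> = (\<Sum>h=1..Suc N. (real (Suc N) - real h) * gam h)"
    by simp
  finally show ?case .
qed simp

abbreviation rate :: "nat \<Rightarrow> real" where "rate \<equiv> mixing_rate M X"

lemma prod_xi_covariance:
  assumes I: "finite I" "\<And>i. i \<in> I \<Longrightarrow> t i \<le> k" and K: "finite K" "\<And>i. i \<in> K \<Longrightarrow> k + h \<le> t i"
  shows "\<bar>expectation (\<lambda>\<omega>. (\<Prod>i\<in>I. xi (t i) \<omega>) * (\<Prod>i\<in>K. xi (t i) \<omega>)) -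
    expectation (\<lambda>\<omega>. \<Prod>i\<in>I. xi (t i) \<omega>) * expectation (\<lambda>\<omega>. \<Prod>i\<in>K. xi (t i) \<omega>)\<bar> \<le> 4 * rate h"
proof -
  define u where "u L y = (\<Prod>i\<in>L. indicator D (y (int (t i))) - p)" for L :: "'b set" and y :: "int \<Rightarrow> real ^ 'd"
  have um: "u L \<in> borel_measurable (\<Pi>\<^sub>M s\<in>int ` t ` L. borel)" for L
    unfolding u_def
  proof (intro borel_measurable_prod)
    fix i assume "i \<in> L"
    then have [measurable]: "(\<lambda>y :: int \<Rightarrow> real ^ 'd. y (int (t i))) \<in> (\<Pi>\<^sub>M s\<in>int ` t ` L. borel) \<rightarrow>\<^sub>M borel"
      by (intro measurable_component_singleton) auto
    show "(\<lambda>y. indicator D (y (int (t i))) - p :: real) \<in> borel_measurable (\<Pi>\<^sub>M s\<in>int ` t ` L. borel)"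
      by measurable
  qed
  have ub: "\<bar>u L y\<bar> \<le> 1" if "finite L" for L y
    unfolding u_def abs_prod using p_bounds by (intro prod_le_1) (auto simp: indicator_def)
  have ux: "u L (\<lambda>s\<in>int ` t ` L. X s \<omega>) = (\<Prod>i\<in>L. xi (t i) \<omega>)" for L \<omega>
    unfolding u_def by (intro prod.cong) (auto simp: xi_def)
  have "int ` t ` I \<subseteq> {..int k}" "int ` t ` K \<subseteq> {int k + int h..}"
    using I(2) K(2) by (auto simp flip: of_nat_add)
  from mixing_covariance[OF stationary _ this(1) _ this(2) um ub[OF I(1)] um ub[OF K(1)]] I(1) K(1)
  show ?thesis by (simp add: ux)
qed

text \<open>
  Imaginary exponentials have modulus one for sums of any length, so the covariance bound is uniform in
  the lengths of the two blocks.
\<close>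

lemma iexp_sum_covariance:
  assumes J: "finite J" "\<And>t. t \<in> J \<Longrightarrow> t \<le> k" and K: "finite K" "\<And>t. t \<in> K \<Longrightarrow> k + h \<le> t"
  shows "cmod (expectation (\<lambda>\<omega>. iexp (c * (\<Sum>t\<in>J. xi t \<omega>)) * iexp (c * (\<Sum>t\<in>K. xi t \<omega>))) -
    expectation (\<lambda>\<omega>. iexp (c * (\<Sum>t\<in>J. xi t \<omega>))) * expectation (\<lambda>\<omega>. iexp (c * (\<Sum>t\<in>K. xi t \<omega>)))) \<le> 16 * rate h"
proof -
  define v where "v L y = c * (\<Sum>t\<in>L. indicator D (y (int t)) - p)" for L and y :: "int \<Rightarrow> real ^ 'd"
  have vm: "(\<lambda>y. iexp (v L y)) \<in> borel_measurable (\<Pi>\<^sub>M s\<in>int ` L. borel)" for L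
  proof -
    have [measurable]: "v L \<in> borel_measurable (\<Pi>\<^sub>M s\<in>int ` L. borel)"
      unfolding v_def
    proof (intro borel_measurable_times borel_measurable_sum borel_measurable_const)
      fix i assume "i \<in> L"
      then have [measurable]: "(\<lambda>y :: int \<Rightarrow> real ^ 'd. y (int i)) \<in> (\<Pi>\<^sub>M s\<in>int ` L. borel) \<rightarrow>\<^sub>M borel"
        by (intro measurable_component_singleton) auto
      show "(\<lambda>y. indicator D (y (int i)) - p :: real) \<in> borel_measurable (\<Pi>\<^sub>M s\<in>int ` L. borel)"
        by measurable
    qed
    show ?thesis by measurable
  qed
  have vx: "v L (\<lambda>s\<in>int ` L. X s \<omega>) = c * (\<Sum>t\<in>L. xi t \<omega>)" for L \<omega>
    unfolding v_def by (intro arg_cong2[where f="(*)"] sum.cong) (auto simp: xi_def)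
  have "int ` J \<subseteq> {..int k}" "int ` K \<subseteq> {int k + int h..}"
    using J(2) K(2) by (auto simp flip: of_nat_add)
  from mixing_covariance_complex[OF stationary _ this(1) _ this(2) vm _ vm] J(1) K(1)
  show ?thesis by (simp add: vx)
qed

lemma iexp_sum_shift:
  "expectation (\<lambda>\<omega>. iexp (c * (\<Sum>t=k + 1..k + N. xi t \<omega>))) = expectation (\<lambda>\<omega>. iexp (c * (\<Sum>t=1..N. xi t \<omega>)))"
proof -
  let ?f = "\<lambda>y :: nat \<Rightarrow> real. iexp (c * (\<Sum>t=1..N. y t))"
  have [measurable]: "(\<lambda>y :: nat \<Rightarrow> real. c * (\<Sum>t=1..N. y t)) \<in> borel_measurable (\<Pi>\<^sub>M t\<in>{1..N}. borel)"
    by (intro borel_measurable_times borel_measurable_sum borel_measurable_const measurable_component_singleton)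
  have "?f \<in> borel_measurable (\<Pi>\<^sub>M t\<in>{1..N}. borel)" by measurable
  from xi_shift[OF _ this, of k]
  have "expectation (\<lambda>\<omega>. iexp (c * (\<Sum>t=1..N. xi (t + k) \<omega>))) = expectation (\<lambda>\<omega>. iexp (c * (\<Sum>t=1..N. xi t \<omega>)))"
    by simp
  moreover have "(\<Sum>t=k + 1..k + N. xi t \<omega>) = (\<Sum>t=1..N. xi (t + k) \<omega>)" for \<omega>
    using sum.shift_bounds_cl_nat_ivl[of "\<lambda>t. xi t \<omega>" 1 k N] by (simp add: add.commute)
  ultimately show ?thesis by simp
qed

end

lemma sorting_permutation:
  fixes t :: "nat \<Rightarrow> nat"
  obtains \<pi> where "\<pi> permutes {..<n}" "mono_on {..<n} (t \<circ> \<pi>)"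
proof -
  let ?xs = "map t [0..<n]"
  obtain \<pi> where \<pi>: "\<pi> permutes {..<length ?xs}" "permute_list \<pi> ?xs = sort ?xs"
    using mset_eq_permutation[of "sort ?xs" ?xs] by auto
  have "sort ?xs ! i = t (\<pi> i)" if "i < n" for i
  proof -
    have "\<pi> i < n" using \<pi>(1) that permutes_in_image[of \<pi> "{..<n}" i] by simp
    then show ?thesis using that permute_list_nth[OF \<pi>(1), of i] \<pi>(2) by simp
  qed
  moreover have "sort ?xs ! i \<le> sort ?xs ! j" if "i \<le> j" "j < n" for i j
    using that sorted_nth_mono[OF sorted_sort, of i j ?xs] by simp
  ultimately have "t (\<pi> i) \<le> t (\<pi> j)" if "i \<le> j" "j < n" for i j
    using that le_less_trans[of i j n] by metis
  then have "mono_on {..<n} (t \<circ> \<pi>)"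
    by (intro mono_onI) auto
  then show ?thesis using that \<pi>(1) by simp
qed

text \<open>Each tuple is a permutation of a sorted one, and there are \<open>n!\<close> permutations.\<close>

lemma sum_tuples_le_sorted:
  fixes f :: "(nat \<Rightarrow> nat) \<Rightarrow> real"
  assumes A: "finite A" and f0: "\<And>t. 0 \<le> f t"
    and sym: "\<And>t \<pi>. \<pi> permutes {..<n} \<Longrightarrow> f (t \<circ> \<pi>) = f t"
  shows "(\<Sum>t\<in>{..<n} \<rightarrow>\<^sub>E A. f t) \<le> fact n * (\<Sum>t\<in>{t \<in> {..<n} \<rightarrow>\<^sub>E A. mono_on {..<n} t}. f t)"
proof -
  let ?T = "{..<n} \<rightarrow>\<^sub>E A" and ?P = "{\<pi>. \<pi> permutes {..<n}}"
  have fin: "finite ?P" "finite ?T" using A by (auto simp: finite_permutations finite_PiE)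
  have le: "f t \<le> (\<Sum>\<pi>\<in>?P. of_bool (mono_on {..<n} (t \<circ> \<pi>)) * f (t \<circ> \<pi>))" for t
  proof -
    obtain \<pi> where \<pi>: "\<pi> permutes {..<n}" "mono_on {..<n} (t \<circ> \<pi>)" using sorting_permutation .
    have "f t = of_bool (mono_on {..<n} (t \<circ> \<pi>)) * f (t \<circ> \<pi>)" using \<pi> sym by simp
    also have "\<dots> \<le> (\<Sum>\<pi>\<in>?P. of_bool (mono_on {..<n} (t \<circ> \<pi>)) * f (t \<circ> \<pi>))"
      using \<pi>(1) fin f0 by (intro member_le_sum) auto
    finally show ?thesis .
  qed
  have bij: "bij_betw (\<lambda>t. t \<circ> \<pi>) ?T ?T" if \<pi>: "\<pi> permutes {..<n}" for \<pi>
  proof (rule bij_betwI[where g="\<lambda>t. t \<circ> inv \<pi>"])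
    have cl: "t \<circ> \<rho> \<in> ?T" if \<rho>: "\<rho> permutes {..<n}" and t: "t \<in> ?T" for \<rho> t
    proof (rule PiE_I)
      fix i assume "i \<in> {..<n}"
      then have "\<rho> i \<in> {..<n}" using permutes_in_image[OF \<rho>] by blast
      then show "(t \<circ> \<rho>) i \<in> A" using t by auto
    next
      fix i assume "i \<notin> {..<n}"
      then show "(t \<circ> \<rho>) i = undefined" using t permutes_not_in[OF \<rho>] by (auto simp: PiE_def extensional_def)
    qed
    show "(\<lambda>t. t \<circ> \<pi>) \<in> ?T \<rightarrow> ?T" "(\<lambda>t. t \<circ> inv \<pi>) \<in> ?T \<rightarrow> ?T"
      using cl[OF \<pi>] cl[OF permutes_inv[OF \<pi>]] by auto
    show "(t \<circ> \<pi>) \<circ> inv \<pi> = t" "(t \<circ> inv \<pi>) \<circ> \<pi> = t" for t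
      using permutes_inv_o[OF \<pi>] by (simp_all add: comp_assoc)
  qed
  have "(\<Sum>t\<in>?T. f t) \<le> (\<Sum>t\<in>?T. \<Sum>\<pi>\<in>?P. of_bool (mono_on {..<n} (t \<circ> \<pi>)) * f (t \<circ> \<pi>))"
    by (intro sum_mono le)
  also have "\<dots> = (\<Sum>\<pi>\<in>?P. \<Sum>t\<in>?T. of_bool (mono_on {..<n} (t \<circ> \<pi>)) * f (t \<circ> \<pi>))"
    by (rule sum.swap)
  also have "\<dots> = (\<Sum>\<pi>\<in>?P. \<Sum>t\<in>?T. of_bool (mono_on {..<n} t) * f t)"
  proof (rule sum.cong[OF refl])
    fix \<pi> assume "\<pi> \<in> ?P"
    then have "bij_betw (\<lambda>t. t \<circ> \<pi>) ?T ?T" using bij by simp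
    from sum.reindex_bij_betw[OF this, of "\<lambda>t. of_bool (mono_on {..<n} t) * f t"]
    show "(\<Sum>t\<in>?T. of_bool (mono_on {..<n} (t \<circ> \<pi>)) * f (t \<circ> \<pi>)) = (\<Sum>t\<in>?T. of_bool (mono_on {..<n} t) * f t)" .
  qed
  also have "\<dots> = fact n * (\<Sum>t\<in>?T. of_bool (mono_on {..<n} t) * f t)"
    using card_permutations[of "{..<n}" n] by simp
  also have "(\<Sum>t\<in>?T. of_bool (mono_on {..<n} t) * f t) = (\<Sum>t\<in>{t \<in> ?T. mono_on {..<n} t}. f t)"
    using fin(2) by (simp add: sum.inter_filter of_bool_def if_distrib if_distribR cong: if_cong)
  finally show ?thesis .
qed

context stationary_indicator
begin

definition far_rate :: "nat \<Rightarrow> nat \<Rightarrow> real" where "far_rate r g = (if r < g then rate g else 0)"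

lemma far_rate_nonneg: "0 \<le> far_rate r g"
  by (simp add: far_rate_def mixing_rate_nonneg)

text \<open>
  A large gap in an ordered quadruple decouples the variables on both sides of it; with no gap
  above \<open>r\<close> the trivial bound by the first variable alone remains.
\<close>

lemma quadruple_bound:
  fixes t :: "nat \<Rightarrow> nat"
  assumes t: "mono_on {..<4} t"
  shows "\<bar>expectation (\<lambda>\<omega>. \<Prod>i<4. xi (t i) \<omega>)\<bar> \<le>
    4 * far_rate r (t 1 - t 0) + 4 * far_rate r (t 2 - t 1) + 4 * far_rate r (t 3 - t 2) +
    \<bar>gam (t 1 - t 0)\<bar> * \<bar>gam (t 3 - t 2)\<bar> +
    2 * p * of_bool (t 1 - t 0 \<le> r \<and> t 2 - t 1 \<le> r \<and> t 3 - t 2 \<le> r)"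
    (is "\<bar>?E\<bar> \<le> 4 * ?A + 4 * ?B + 4 * ?C + ?g + ?q")
proof -
  have o: "t 0 \<le> t 1" "t 1 \<le> t 2" "t 2 \<le> t 3" using mono_onD[OF t] by auto
  have split4: "(\<Prod>i<4. xi (t i) \<omega>) = xi (t 0) \<omega> * xi (t 1) \<omega> * xi (t 2) \<omega> * xi (t 3) \<omega>" for \<omega>
    by (simp add: eval_nat_numeral lessThan_Suc mult_ac)
  have A0: "0 \<le> ?A" "0 \<le> ?B" "0 \<le> ?C" "0 \<le> ?g" "0 \<le> ?q"
    using far_rate_nonneg p_bounds by auto
  have weaken: "x \<le> 4 * a + 4 * b + 4 * c + g + q"
    if "x \<le> 4 * a \<or> x \<le> 4 * c \<or> x \<le> 4 * b + g \<or> x \<le> q" "0 \<le> a" "0 \<le> b" "0 \<le> c" "0 \<le> g" "0 \<le> q"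
    for x a b c g q :: real
    using that by linarith
  consider (a) "r < t 1 - t 0" | (c) "r < t 3 - t 2" | (b) "r < t 2 - t 1" |
      (n) "t 1 - t 0 \<le> r" "t 2 - t 1 \<le> r" "t 3 - t 2 \<le> r" by linarith
  then show ?thesis
  proof cases
    case a
    have "\<bar>expectation (\<lambda>\<omega>. (\<Prod>i\<in>{0}. xi (t i) \<omega>) * (\<Prod>i\<in>{1, 2, 3}. xi (t i) \<omega>)) -
        expectation (\<lambda>\<omega>. \<Prod>i\<in>{0}. xi (t i) \<omega>) * expectation (\<lambda>\<omega>. \<Prod>i\<in>{1, 2, 3}. xi (t i) \<omega>)\<bar> \<le> 4 * rate (t 1 - t 0)"
      using o by (intro prod_xi_covariance[where k="t 0"]) auto
    then have "\<bar>?E\<bar> \<le> 4 * ?A"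
      using a by (simp add: split4 expectation_xi far_rate_def mult.assoc)
    then show ?thesis by (intro weaken A0) blast
  next
    case c
    have "\<bar>expectation (\<lambda>\<omega>. (\<Prod>i\<in>{0, 1, 2}. xi (t i) \<omega>) * (\<Prod>i\<in>{3}. xi (t i) \<omega>)) -
        expectation (\<lambda>\<omega>. \<Prod>i\<in>{0, 1, 2}. xi (t i) \<omega>) * expectation (\<lambda>\<omega>. \<Prod>i\<in>{3}. xi (t i) \<omega>)\<bar> \<le> 4 * rate (t 3 - t 2)"
      using o by (intro prod_xi_covariance[where k="t 2"]) auto
    then have "\<bar>?E\<bar> \<le> 4 * ?C"
      using c by (simp add: split4 expectation_xi far_rate_def mult.assoc)
    then show ?thesis by (intro weaken A0) blast
  next
    case b
    have "\<bar>expectation (\<lambda>\<omega>. (\<Prod>i\<in>{0, 1}. xi (t i) \<omega>) * (\<Prod>i\<in>{2, 3}. xi (t i) \<omega>)) -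
        expectation (\<lambda>\<omega>. \<Prod>i\<in>{0, 1}. xi (t i) \<omega>) * expectation (\<lambda>\<omega>. \<Prod>i\<in>{2, 3}. xi (t i) \<omega>)\<bar> \<le> 4 * rate (t 2 - t 1)"
      using o by (intro prod_xi_covariance[where k="t 1"]) auto
    moreover have "expectation (\<lambda>\<omega>. xi (t 0) \<omega> * xi (t 1) \<omega>) = gam (t 1 - t 0)"
      "expectation (\<lambda>\<omega>. xi (t 2) \<omega> * xi (t 3) \<omega>) = gam (t 3 - t 2)"
      using expectation_xi_mult[of "t 0" "t 1 - t 0"] expectation_xi_mult[of "t 2" "t 3 - t 2"] o by auto
    ultimately have "\<bar>?E - gam (t 1 - t 0) * gam (t 3 - t 2)\<bar> \<le> 4 * ?B"
      using b by (simp add: split4 far_rate_def mult.assoc)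
    moreover have "\<bar>gam (t 1 - t 0) * gam (t 3 - t 2)\<bar> = ?g" by (rule abs_mult)
    moreover have "\<bar>e\<bar> \<le> b + g" if "\<bar>e - x\<bar> \<le> b" "\<bar>x\<bar> = g" for e x b g :: real
      using that by linarith
    ultimately have "\<bar>?E\<bar> \<le> 4 * ?B + ?g" by blast
    then show ?thesis by (intro weaken A0) blast
  next
    case n
    have "\<bar>?E\<bar> \<le> expectation (\<lambda>\<omega>. \<bar>\<Prod>i<4. xi (t i) \<omega>\<bar>)" by (rule integral_abs_bound)
    also have "\<dots> \<le> expectation (\<lambda>\<omega>. \<bar>xi (t 0) \<omega>\<bar>)"
    proof (intro integral_mono integrable_abs integrable_prod_xi integrable_xi)
      fix \<omega>
      have "\<bar>\<Prod>i<4. xi (t i) \<omega>\<bar> = \<bar>xi (t 0) \<omega>\<bar> * \<bar>\<Prod>i\<in>{1, 2, 3}. xi (t i) \<omega>\<bar>"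
        by (simp add: split4 abs_mult)
      also have "\<dots> \<le> \<bar>xi (t 0) \<omega>\<bar> * 1" by (intro mult_left_mono prod_xi_bound) auto
      finally show "\<bar>\<Prod>i<4. xi (t i) \<omega>\<bar> \<le> \<bar>xi (t 0) \<omega>\<bar>" by simp
    qed
    also have "\<dots> \<le> 2 * p" by (rule expectation_abs_xi)
    finally have "\<bar>?E\<bar> \<le> ?q" using n by simp
    then show ?thesis by (intro weaken A0) blast
  qed
qed

text \<open>
  Ordered quadruples are parametrised by their first entry and three gaps. The sum over the entry gives
  the factor \<open>N\<close>, a large gap leaves two free gaps and the sum of the mixing rates, and quadruples
  without large gap number at most \<open>(r + 1)\<^sup>3\<close> for each first entry; a product of two covariances
  leaves only the middle gap free.
\<close>

lemma fourth_moment_sum: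
  "expectation (\<lambda>\<omega>. (\<Sum>t=1..N. xi t \<omega>) ^ 4) \<le>
    24 * (real N * (12 * (real N + 1)\<^sup>2 * (\<Sum>g=r + 1..N. rate g) + (real N + 1) * (Gam N)\<^sup>2 + 2 * p * (real r + 1) ^ 3))"
proof -
  let ?T = "{..<4::nat} \<rightarrow>\<^sub>E {1..N}"
  let ?S = "{t \<in> ?T. mono_on {..<4} t}"
  define G where "G t = \<bar>expectation (\<lambda>\<omega>. \<Prod>i<4. xi (t i) \<omega>)\<bar>" for t :: "nat \<Rightarrow> nat"
  define F where "F u v w = 4 * far_rate r u + 4 * far_rate r v + 4 * far_rate r w + \<bar>gam u\<bar> * \<bar>gam w\<bar> +
    2 * p * (of_bool (u \<le> r) * (of_bool (v \<le> r) * of_bool (w \<le> r)))" for u v w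
  define SA where "SA = (\<Sum>g=r + 1..N. rate g)"
  have finT: "finite ?T" by (simp add: finite_PiE)
  have F0: "0 \<le> F u v w" for u v w
    using far_rate_nonneg p_bounds by (auto simp: F_def)
  have "(\<Sum>t=1..N. xi t \<omega>) ^ 4 = (\<Sum>t\<in>?T. \<Prod>i<4. xi (t i) \<omega>)" for \<omega>
    using prod_sum_PiE[of "{..<4::nat}" "\<lambda>_. {1..N}" "\<lambda>_ t. xi t \<omega>"] by simp
  then have "expectation (\<lambda>\<omega>. (\<Sum>t=1..N. xi t \<omega>) ^ 4) = (\<Sum>t\<in>?T. expectation (\<lambda>\<omega>. \<Prod>i<4. xi (t i) \<omega>))"
    by (simp add: integrable_prod_xi)
  also have "\<dots> \<le> (\<Sum>t\<in>?T. G t)" by (intro sum_mono) (simp add: G_def)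
  also have "\<dots> \<le> fact 4 * (\<Sum>t\<in>?S. G t)"
  proof (rule sum_tuples_le_sorted)
    fix t :: "nat \<Rightarrow> nat" and \<pi> assume "\<pi> permutes {..<4::nat}"
    then have "(\<Prod>i<4. xi ((t \<circ> \<pi>) i) \<omega>) = (\<Prod>i<4. xi (t i) \<omega>)" for \<omega>
      using prod.permute[of \<pi> "{..<4}" "\<lambda>i. xi (t i) \<omega>"] by (simp add: o_def)
    then show "G (t \<circ> \<pi>) = G t" by (simp add: G_def)
  qed (auto simp: G_def)
  also have "(\<Sum>t\<in>?S. G t) \<le> (\<Sum>t\<in>?S. F (t 1 - t 0) (t 2 - t 1) (t 3 - t 2))"
    unfolding G_def F_def using quadruple_bound[where r=r]
    by (intro sum_mono) (simp only: of_bool_conj mem_Collect_eq)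
  also have "\<dots> = (\<Sum>x\<in>(\<lambda>t. (t 0, t 1 - t 0, t 2 - t 1, t 3 - t 2)) ` ?S. case x of (i, u, v, w) \<Rightarrow> F u v w)"
  proof (subst sum.reindex)
    show "inj_on (\<lambda>t. (t 0, t 1 - t 0, t 2 - t 1, t 3 - t 2)) ?S"
    proof (rule inj_onI)
      fix s t assume s: "s \<in> ?S" and t: "t \<in> ?S"
        and eq: "(s 0, s 1 - s 0, s 2 - s 1, s 3 - s 2) = (t 0, t 1 - t 0, t 2 - t 1, t 3 - t 2)"
      have os: "s 0 \<le> s 1" "s 1 \<le> s 2" "s 2 \<le> s 3" using s by (auto intro: mono_onD)
      have ot: "t 0 \<le> t 1" "t 1 \<le> t 2" "t 2 \<le> t 3" using t by (auto intro: mono_onD)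
      have e: "s 0 = t 0" "s 1 = t 1" "s 2 = t 2" "s 3 = t 3" using eq os ot by auto
      show "s = t"
      proof (rule PiE_ext[of s "{..<4}" "\<lambda>_. {1..N}"])
        fix i assume "i \<in> {..<4::nat}"
        then have "i = 0 \<or> i = 1 \<or> i = 2 \<or> i = 3" by auto
        then show "s i = t i" using e by auto
      qed (use s t in auto)
    qed
  qed (simp add: o_def)
  also have "\<dots> \<le> (\<Sum>x\<in>{1..N} \<times> {..N} \<times> {..N} \<times> {..N}. case x of (i, u, v, w) \<Rightarrow> F u v w)"
  proof (rule sum_mono2)
    show "(\<lambda>t. (t 0, t 1 - t 0, t 2 - t 1, t 3 - t 2)) ` ?S \<subseteq> {1..N} \<times> {..N} \<times> {..N} \<times> {..N}"
    proof (rule image_subsetI)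
      fix t assume "t \<in> ?S"
      then have t: "t i \<in> {1..N}" if "i < 4" for i using that PiE_mem[of t "{..<4}" "\<lambda>_. {1..N}" i] by simp
      show "(t 0, t 1 - t 0, t 2 - t 1, t 3 - t 2) \<in> {1..N} \<times> {..N} \<times> {..N} \<times> {..N}"
        using t[of 0] t[of 1] t[of 2] t[of 3] by (auto intro: le_trans[OF diff_le_self])
    qed
  qed (use F0 in auto)
  also have "\<dots> = real N * (\<Sum>u\<le>N. \<Sum>v\<le>N. \<Sum>w\<le>N. F u v w)"
    by (simp add: sum.cartesian_product[symmetric])
  also have "(\<Sum>u\<le>N. \<Sum>v\<le>N. \<Sum>w\<le>N. F u v w) =
      12 * (real N + 1)\<^sup>2 * (\<Sum>g\<le>N. far_rate r g) + (real N + 1) * (\<Sum>u\<le>N. \<bar>gam u\<bar>)\<^sup>2 +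
      2 * p * (\<Sum>u\<le>N. of_bool (u \<le> r)) ^ 3"
    by (simp add: F_def sum.distrib sum_distrib_left[symmetric] sum_distrib_right[symmetric]
        power2_eq_square power3_eq_cube algebra_simps del: sum_of_bool_eq)
  also have "\<dots> \<le> 12 * (real N + 1)\<^sup>2 * SA + (real N + 1) * (Gam N)\<^sup>2 + 2 * p * (real r + 1) ^ 3"
  proof (intro add_mono mult_left_mono power_mono sum_abs_gam_le sum_nonneg)
    have "(\<Sum>g\<le>N. far_rate r g) = SA"
      unfolding SA_def far_rate_def by (intro sum.mono_neutral_cong_right) auto
    then show "(\<Sum>g\<le>N. far_rate r g) \<le> SA" by simp
    have "(\<Sum>u\<le>N. of_bool (u \<le> r)) = real (card ({..N} \<inter> {..r}))"
      by (simp add: Int_def)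
    also have "\<dots> \<le> real (card {..r})" by (intro of_nat_mono card_mono) auto
    finally show "(\<Sum>u\<le>N. of_bool (u \<le> r)) \<le> real r + 1" by simp
  qed (use p_bounds in auto)
  finally show ?thesis by (simp add: SA_def fact_numeral mult_left_mono)
qed

end

section \<open>Big blocks and characteristic functions\<close>

lemma exp_minus_linear_bound:
  fixes x :: real
  assumes "0 \<le> x"
  shows "\<bar>exp (- x) - (1 - x)\<bar> \<le> x\<^sup>2"
proof -
  have lo: "1 - x \<le> exp (- x)" using exp_ge_add_one_self[of "- x"] by simp
  have "exp (- x) \<le> 1 / (1 + x)"
    using exp_ge_add_one_self[of x] assms by (simp add: exp_minus inverse_eq_divide frac_le)
  also have "1 / (1 + x) \<le> 1 - x + x\<^sup>2"
  proof -
    have "(1 - x + x\<^sup>2) * (1 + x) = 1 + x ^ 3" by (simp add: algebra_simps power2_eq_square power3_eq_cube)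
    then show ?thesis using assms by (simp add: divide_le_eq)
  qed
  finally show ?thesis using lo by simp
qed

lemma norm_iexp_diff_le: "cmod (iexp x - iexp y) \<le> \<bar>x - y\<bar>"
proof -
  have "iexp x - iexp y = iexp y * (iexp (x - y) - 1)"
    by (simp add: right_diff_distrib exp_diff)
  then have "cmod (iexp x - iexp y) = cmod (iexp (x - y) - 1)" by (simp add: norm_mult)
  also have "\<dots> \<le> \<bar>x - y\<bar>" using iexp_approx1[of "x - y" 0] by simp
  finally show ?thesis .
qed

lemma (in prob_space) expectation_abs_le_sqrt:
  fixes Y :: "'a \<Rightarrow> real"
  assumes "integrable M Y" "integrable M (\<lambda>\<omega>. (Y \<omega>)\<^sup>2)"
  shows "expectation (\<lambda>\<omega>. \<bar>Y \<omega>\<bar>) \<le> sqrt (expectation (\<lambda>\<omega>. (Y \<omega>)\<^sup>2))"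
proof -
  have "0 \<le> variance (\<lambda>\<omega>. \<bar>Y \<omega>\<bar>)" by (rule variance_positive)
  also have "\<dots> = expectation (\<lambda>\<omega>. (Y \<omega>)\<^sup>2) - (expectation (\<lambda>\<omega>. \<bar>Y \<omega>\<bar>))\<^sup>2"
    using assms by (subst variance_eq) auto
  finally show ?thesis by (intro real_le_rsqrt) simp
qed

context stationary_indicator
begin

text \<open>
  The big blocks. For \<open>N + r = m\<close> consecutive ones are separated by \<open>r\<close> omitted indices.
\<close>

definition blocks :: "nat \<Rightarrow> nat \<Rightarrow> nat \<Rightarrow> nat set" where
  "blocks m N k = (\<Union>i<k. {i * m + 1..i * m + N})"

lemma finite_blocks: "finite (blocks m N k)"
  by (simp add: blocks_def)

lemma blocks_Suc: "blocks m N (Suc k) = blocks m N k \<union> {k * m + 1..k * m + N}"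
  by (simp add: blocks_def lessThan_Suc Un_commute)

lemma blocks_upper:
  assumes "N + r = m" "t \<in> blocks m N k"
  shows "t + r \<le> k * m"
proof -
  obtain i where i: "i < k" "t \<le> i * m + N" using assms(2) by (auto simp: blocks_def)
  have "t + r \<le> Suc i * m" using i(2) assms(1) by simp
  also have "\<dots> \<le> k * m" using i(1) by (intro mult_le_mono1) simp
  finally show ?thesis .
qed

lemma card_blocks:
  assumes "N + r = m"
  shows "card (blocks m N k) = k * N"
proof (induction k)
  case (Suc k)
  have "blocks m N k \<inter> {k * m + 1..k * m + N} = {}"
    using blocks_upper[OF assms, of _ k] by fastforce
  then show ?case
    using Suc by (simp add: blocks_Suc card_Un_disjoint finite_blocks)
qed (simp add: blocks_def)

definition block_char :: "nat \<Rightarrow> real \<Rightarrow> complex" where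
  "block_char N s = expectation (\<lambda>\<omega>. iexp (s * (\<Sum>t=1..N. xi t \<omega>)))"

lemma cmod_block_char_le_1: "cmod (block_char N s) \<le> 1"
proof -
  have "cmod (block_char N s) \<le> expectation (\<lambda>\<omega>. cmod (iexp (s * (\<Sum>t=1..N. xi t \<omega>))))"
    unfolding block_char_def by (rule integral_norm_bound)
  then show ?thesis by (simp add: prob_space)
qed

text \<open>
  Peeling off the last block costs one covariance across a gap, and all blocks have the same law.
\<close>

lemma blocks_factorise:
  assumes m: "N + r = m"
  shows "cmod (expectation (\<lambda>\<omega>. iexp (s * (\<Sum>t\<in>blocks m N k. xi t \<omega>))) - block_char N s ^ k) \<le>
    real k * (16 * rate r)"
proof (induction k)
  case 0
  then show ?case by (simp add: blocks_def prob_space)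
next
  case (Suc k)
  let ?J = "blocks m N k" and ?K = "{k * m + 1..k * m + N}"
  let ?U = "\<lambda>\<omega>. iexp (s * (\<Sum>t\<in>?J. xi t \<omega>))" and ?V = "\<lambda>\<omega>. iexp (s * (\<Sum>t\<in>?K. xi t \<omega>))"
  have dis: "?J \<inter> ?K = {}" using blocks_upper[OF m, of _ k] by fastforce
  have prod: "iexp (s * (\<Sum>t\<in>blocks m N (Suc k). xi t \<omega>)) = ?U \<omega> * ?V \<omega>" for \<omega>
    unfolding blocks_Suc
    by (subst sum.union_disjoint[OF finite_blocks finite_atLeastAtMost dis]) (simp add: distrib_left exp_add)
  have V: "expectation ?V = block_char N s"
    unfolding block_char_def by (rule iexp_sum_shift)
  have cov: "cmod (expectation (\<lambda>\<omega>. ?U \<omega> * ?V \<omega>) - expectation ?U * expectation ?V) \<le> 16 * rate r"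
  proof (cases k)
    case 0
    then show ?thesis by (simp add: blocks_def prob_space mixing_rate_nonneg)
  next
    case (Suc k')
    have "r \<le> k * m" using m Suc by simp
    show ?thesis
    proof (rule iexp_sum_covariance[where k="k * m - r", OF finite_blocks])
      show "t \<le> k * m - r" if "t \<in> ?J" for t using blocks_upper[OF m that] by simp
      show "k * m - r + r \<le> t" if "t \<in> ?K" for t using that \<open>r \<le> k * m\<close> by simp
    qed simp
  qed
  have alg: "x - z ^ Suc k = (x - u * z) + (u - z ^ k) * z" for x u z :: complex
    by (simp add: algebra_simps)
  have eq: "expectation (\<lambda>\<omega>. ?U \<omega> * ?V \<omega>) - block_char N s ^ Suc k =
      (expectation (\<lambda>\<omega>. ?U \<omega> * ?V \<omega>) - expectation ?U * expectation ?V) +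
      (expectation ?U - block_char N s ^ k) * block_char N s"
    unfolding V by (rule alg)
  have "cmod (expectation (\<lambda>\<omega>. ?U \<omega> * ?V \<omega>) - block_char N s ^ Suc k) \<le>
      16 * rate r + cmod (expectation ?U - block_char N s ^ k) * cmod (block_char N s)"
    unfolding eq using cov by (intro order_trans[OF norm_triangle_ineq] add_mono) (simp_all add: norm_mult)
  also have "\<dots> \<le> 16 * rate r + (real k * (16 * rate r)) * 1"
    by (rule add_left_mono[OF mult_mono[OF Suc.IH cmod_block_char_le_1]])
       (simp_all only: mixing_rate_nonneg norm_ge_zero mult_nonneg_nonneg of_nat_0_le_iff zero_le_numeral)
  also have "\<dots> = real (Suc k) * (16 * rate r)" by (simp add: distrib_right)
  finally show ?case unfolding prod .
qed

lemma abs_sum_xi_le: "\<bar>\<Sum>t\<in>T. xi t \<omega>\<bar> \<le> real (card T)"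
  using sum_abs[of "\<lambda>t. xi t \<omega>" T] sum_mono[of T "\<lambda>t. \<bar>xi t \<omega>\<bar>" "\<lambda>_. 1"] xi_bound by (auto intro: order_trans)

lemma integrable_power_sum_xi: "integrable M (\<lambda>\<omega>. \<bar>\<Sum>t\<in>T. xi t \<omega>\<bar> ^ j)"
  by (rule integrable_bounded[of _ "real (card T) ^ j"])
    (auto simp: power_abs intro!: power_mono abs_sum_xi_le)

lemma integrable_sum_xi: "integrable M (\<lambda>\<omega>. \<Sum>t\<in>T. xi t \<omega>)"
  by (rule integrable_bounded[OF _ abs_sum_xi_le]) auto

lemma integrable_power2_sum_xi: "integrable M (\<lambda>\<omega>. (\<Sum>t\<in>T. xi t \<omega>)\<^sup>2)"
  using integrable_power_sum_xi[of T 2] by simp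

lemma expectation_sum_xi: "expectation (\<lambda>\<omega>. \<Sum>t\<in>T. xi t \<omega>) = 0"
  by (simp add: integrable_xi expectation_xi)

text \<open>
  Characteristic functions are Lipschitz in the mean of the absolute difference, which is at most the
  standard deviation of the sum over the omitted indices.
\<close>

lemma char_discard:
  assumes J: "J \<subseteq> {1..n}"
  shows "cmod (expectation (\<lambda>\<omega>. iexp (s * (\<Sum>t=1..n. xi t \<omega>))) - expectation (\<lambda>\<omega>. iexp (s * (\<Sum>t\<in>J. xi t \<omega>))))
    \<le> \<bar>s\<bar> * sqrt ((real n - real (card J)) * Gam n)"
proof -
  let ?T = "{1..n} - J"
  have ii: "integrable M (\<lambda>\<omega>. iexp (s * (\<Sum>t\<in>L. xi t \<omega>)))" for L
    by (rule integrable_const_bound[of _ 1]) (auto intro!: AE_I2)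
  have iT: "integrable M (\<lambda>\<omega>. \<Sum>t\<in>?T. xi t \<omega>)" by (rule integrable_sum_xi)
  have "cmod (expectation (\<lambda>\<omega>. iexp (s * (\<Sum>t=1..n. xi t \<omega>))) - expectation (\<lambda>\<omega>. iexp (s * (\<Sum>t\<in>J. xi t \<omega>))))
      = cmod (expectation (\<lambda>\<omega>. iexp (s * (\<Sum>t=1..n. xi t \<omega>)) - iexp (s * (\<Sum>t\<in>J. xi t \<omega>))))"
    using ii by simp
  also have "\<dots> \<le> expectation (\<lambda>\<omega>. cmod (iexp (s * (\<Sum>t=1..n. xi t \<omega>)) - iexp (s * (\<Sum>t\<in>J. xi t \<omega>))))"
    by (rule integral_norm_bound)
  also have "\<dots> \<le> expectation (\<lambda>\<omega>. \<bar>s\<bar> * \<bar>\<Sum>t\<in>?T. xi t \<omega>\<bar>)"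
  proof (rule integral_mono)
    fix \<omega>
    have "cmod (iexp (s * (\<Sum>t=1..n. xi t \<omega>)) - iexp (s * (\<Sum>t\<in>J. xi t \<omega>))) \<le>
      \<bar>s * (\<Sum>t=1..n. xi t \<omega>) - s * (\<Sum>t\<in>J. xi t \<omega>)\<bar>" by (rule norm_iexp_diff_le)
    also have "\<dots> = \<bar>s\<bar> * \<bar>\<Sum>t\<in>?T. xi t \<omega>\<bar>"
      using J by (simp add: sum_diff abs_mult[symmetric] right_diff_distrib)
    finally show "cmod (iexp (s * (\<Sum>t=1..n. xi t \<omega>)) - iexp (s * (\<Sum>t\<in>J. xi t \<omega>))) \<le> \<bar>s\<bar> * \<bar>\<Sum>t\<in>?T. xi t \<omega>\<bar>" .
  qed (use ii iT in \<open>auto intro!: integrable_norm Bochner_Integration.integrable_diff\<close>)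
  also have "\<dots> = \<bar>s\<bar> * expectation (\<lambda>\<omega>. \<bar>\<Sum>t\<in>?T. xi t \<omega>\<bar>)" using iT by simp
  also have "\<dots> \<le> \<bar>s\<bar> * sqrt (expectation (\<lambda>\<omega>. (\<Sum>t\<in>?T. xi t \<omega>)\<^sup>2))"
    by (intro mult_left_mono expectation_abs_le_sqrt iT integrable_power2_sum_xi) auto
  also have "\<dots> \<le> \<bar>s\<bar> * sqrt (real (card ?T) * Gam n)"
    by (intro mult_left_mono real_sqrt_le_mono variance_sum_le) auto
  also have "real (card ?T) = real n - real (card J)"
    using J card_mono[of "{1..n}" J] by (simp add: card_Diff_subset finite_subset of_nat_diff)
  finally show ?thesis .
qed

definition block_var :: "nat \<Rightarrow> real" where
  "block_var N = expectation (\<lambda>\<omega>. (\<Sum>t=1..N. xi t \<omega>)\<^sup>2)"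

text \<open>
  Second order Taylor expansion, with \<open>1 - x\<close> exchanged for \<open>exp (- x)\<close>: both factors compared later
  then have modulus at most one whatever the size of \<open>x\<close>.
\<close>

lemma block_char_approx:
  "cmod (block_char N s - complex_of_real (exp (- (s\<^sup>2 * block_var N / 2)))) \<le>
    \<bar>s\<bar> ^ 3 / 6 * expectation (\<lambda>\<omega>. \<bar>\<Sum>t=1..N. xi t \<omega>\<bar> ^ 3) + (s\<^sup>2 * block_var N / 2)\<^sup>2"
proof -
  define v where "v = block_var N"
  let ?Y = "\<lambda>\<omega>. \<Sum>t=1..N. xi t \<omega>"
  have v0: "0 \<le> v" unfolding v_def block_var_def by (simp add: integral_nonneg)
  have rv: "random_variable borel ?Y" by measurable
  have bc: "block_char N s = char (distr M borel ?Y) s"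
    unfolding block_char_def char_def by (subst integral_distr) auto
  have "variance ?Y = v" unfolding v_def block_var_def expectation_sum_xi by simp
  from char_approx3'[OF rv integrable_sum_xi integrable_power2_sum_xi expectation_sum_xi this refl, of s]
  have "cmod (block_char N s - (1 - s\<^sup>2 * v / 2)) \<le>
      s\<^sup>2 / 6 * expectation (\<lambda>\<omega>. min (6 * (?Y \<omega>)\<^sup>2) (\<bar>s\<bar> * \<bar>?Y \<omega>\<bar> ^ 3))"
    by (simp add: bc)
  also have "\<dots> \<le> s\<^sup>2 / 6 * expectation (\<lambda>\<omega>. \<bar>s\<bar> * \<bar>?Y \<omega>\<bar> ^ 3)"
    using integrable_power_sum_xi[of "{1..N}" 3] integrable_power2_sum_xi[of "{1..N}"]
    by (intro mult_left_mono integral_mono integrable_min integrable_mult_right) auto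
  also have "\<dots> = \<bar>s\<bar> ^ 3 / 6 * expectation (\<lambda>\<omega>. \<bar>?Y \<omega>\<bar> ^ 3)"
    by (simp add: power3_eq_cube power2_eq_square abs_mult_self_eq)
  finally have a: "cmod (block_char N s - (1 - s\<^sup>2 * v / 2)) \<le> \<bar>s\<bar> ^ 3 / 6 * expectation (\<lambda>\<omega>. \<bar>?Y \<omega>\<bar> ^ 3)" .
  have "cmod (complex_of_real (1 - s\<^sup>2 * v / 2) - complex_of_real (exp (- (s\<^sup>2 * v / 2)))) =
      \<bar>exp (- (s\<^sup>2 * v / 2)) - (1 - s\<^sup>2 * v / 2)\<bar>"
    by (simp only: of_real_diff[symmetric] norm_of_real abs_minus_commute)
  also have "\<dots> \<le> (s\<^sup>2 * v / 2)\<^sup>2"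
    using v0 by (intro exp_minus_linear_bound) auto
  finally have b: "cmod (complex_of_real (1 - s\<^sup>2 * v / 2) - complex_of_real (exp (- (s\<^sup>2 * v / 2)))) \<le> (s\<^sup>2 * v / 2)\<^sup>2" .
  have "cmod (block_char N s - complex_of_real (exp (- (s\<^sup>2 * v / 2)))) \<le>
      cmod (block_char N s - complex_of_real (1 - s\<^sup>2 * v / 2)) +
      cmod (complex_of_real (1 - s\<^sup>2 * v / 2) - complex_of_real (exp (- (s\<^sup>2 * v / 2))))"
    using norm_triangle_ineq[of "block_char N s - complex_of_real (1 - s\<^sup>2 * v / 2)"
      "complex_of_real (1 - s\<^sup>2 * v / 2) - complex_of_real (exp (- (s\<^sup>2 * v / 2)))"] by simp
  then show ?thesis using a b unfolding v_def by linarith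
qed

text \<open>
  The three error terms stem from the omitted indices, from replacing the blocks by independent ones, and
  from the Gaussian approximation of each block.
\<close>

theorem char_sum_gaussian:
  assumes m: "N + r = m" and k: "k * m \<le> n"
  shows "cmod (expectation (\<lambda>\<omega>. iexp (s * (\<Sum>t=1..n. xi t \<omega>))) - complex_of_real (exp (- (s\<^sup>2 * (real k * block_var N) / 2)))) \<le>
    \<bar>s\<bar> * sqrt ((real n - real k * real N) * Gam n) + real k * (16 * rate r) +
    real k * (\<bar>s\<bar> ^ 3 / 6 * expectation (\<lambda>\<omega>. \<bar>\<Sum>t=1..N. xi t \<omega>\<bar> ^ 3) + (s\<^sup>2 * block_var N / 2)\<^sup>2)"
proof -
  define v where "v = block_var N"
  let ?J = "blocks m N k" and ?e = "complex_of_real (exp (- (s\<^sup>2 * v / 2)))"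
  let ?A = "expectation (\<lambda>\<omega>. iexp (s * (\<Sum>t=1..n. xi t \<omega>)))" and ?B = "expectation (\<lambda>\<omega>. iexp (s * (\<Sum>t\<in>?J. xi t \<omega>)))"
  have v0: "0 \<le> v" unfolding v_def block_var_def by (simp add: integral_nonneg)
  have J: "?J \<subseteq> {1..n}"
  proof
    fix t assume t: "t \<in> ?J"
    then have "1 \<le> t" by (auto simp: blocks_def)
    moreover have "t \<le> n" using blocks_upper[OF m t] k by linarith
    ultimately show "t \<in> {1..n}" by simp
  qed
  have 1: "cmod (?A - ?B) \<le> \<bar>s\<bar> * sqrt ((real n - real k * real N) * Gam n)"
    using char_discard[OF J, of s] by (simp add: card_blocks[OF m])
  have 2: "cmod (?B - block_char N s ^ k) \<le> real k * (16 * rate r)" by (rule blocks_factorise[OF m])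
  have "cmod (block_char N s ^ k - ?e ^ k) \<le> real k * cmod (block_char N s - ?e)"
    using v0 by (intro norm_power_diff cmod_block_char_le_1) auto
  also have "\<dots> \<le> real k * (\<bar>s\<bar> ^ 3 / 6 * expectation (\<lambda>\<omega>. \<bar>\<Sum>t=1..N. xi t \<omega>\<bar> ^ 3) + (s\<^sup>2 * v / 2)\<^sup>2)"
    using block_char_approx[of N s] unfolding v_def by (intro mult_left_mono) auto
  finally have 3: "cmod (block_char N s ^ k - ?e ^ k) \<le>
      real k * (\<bar>s\<bar> ^ 3 / 6 * expectation (\<lambda>\<omega>. \<bar>\<Sum>t=1..N. xi t \<omega>\<bar> ^ 3) + (s\<^sup>2 * v / 2)\<^sup>2)" .
  have "?e ^ k = complex_of_real (exp (- (s\<^sup>2 * (real k * v) / 2)))"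
    by (simp only: of_real_power[symmetric] exp_of_nat_mult[symmetric]) (simp add: algebra_simps)
  then have "cmod (?A - complex_of_real (exp (- (s\<^sup>2 * (real k * v) / 2)))) = cmod ((?A - ?B) + ((?B - block_char N s ^ k) + (block_char N s ^ k - ?e ^ k)))"
    by simp
  also have "\<dots> \<le> cmod (?A - ?B) + (cmod (?B - block_char N s ^ k) + cmod (block_char N s ^ k - ?e ^ k))"
    by (intro order_trans[OF norm_triangle_ineq] add_left_mono norm_triangle_ineq)
  finally show ?thesis using 1 2 3 unfolding v_def by linarith
qed

lemma abs_gam_le_rate: "\<bar>gam h\<bar> \<le> 4 * rate h"
proof -
  have "\<bar>expectation (\<lambda>\<omega>. (\<Prod>i\<in>{0}. xi i \<omega>) * (\<Prod>i\<in>{h}. xi i \<omega>)) -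
        expectation (\<lambda>\<omega>. \<Prod>i\<in>{0}. xi i \<omega>) * expectation (\<lambda>\<omega>. \<Prod>i\<in>{h}. xi i \<omega>)\<bar> \<le> 4 * rate h"
    by (intro prod_xi_covariance[where k=0]) auto
  then show ?thesis by (simp add: gam_def expectation_xi)
qed

end

section \<open>Asymptotics along the sample size\<close>

lemma real_distribution_centred_normal:
  assumes "0 \<le> v"
  shows "real_distribution (centred_normal v)"
proof (cases "v = 0")
  case True
  then show ?thesis
    by (auto simp: centred_normal_def real_distribution_def real_distribution_axioms_def prob_space_return)
next
  case False
  then have "prob_space (density lborel (normal_density 0 (sqrt v)))"
    using assms by (intro prob_space_normal_density) auto
  then show ?thesis
    using False by (auto simp: centred_normal_def real_distribution_def real_distribution_axioms_def)
qed

lemma char_centred_normal: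
  assumes "0 \<le> v"
  shows "char (centred_normal v) t = complex_of_real (exp (- (t\<^sup>2 * v / 2)))"
proof (cases "v = 0")
  case True
  then show ?thesis by (simp add: centred_normal_def char_def integral_return)
next
  case False
  then have s: "sqrt v > 0" using assms by simp
  interpret S: prob_space std_normal_distribution
    using prob_space_normal_density[of 1 0] by simp
  have "distributed std_normal_distribution lborel (\<lambda>x. x) std_normal_density"
    by (auto simp: distributed_def distr_id2)
  from S.normal_density_affine[OF this, of "sqrt v" 0] s
  have "distributed std_normal_distribution lborel (\<lambda>x. sqrt v * x) (normal_density 0 (sqrt v))" by simp
  then have eq: "centred_normal v = distr std_normal_distribution lborel (\<lambda>x. sqrt v * x)"
    using False by (simp add: centred_normal_def distributed_def)
  have "char (centred_normal v) t = char std_normal_distribution (sqrt v * t)"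
    unfolding eq char_def by (subst integral_distr) (auto simp: mult_ac)
  also have "(sqrt v * t)\<^sup>2 = t\<^sup>2 * v"
    using assms by (simp add: power_mult_distrib mult.commute)
  then have "char std_normal_distribution (sqrt v * t) = complex_of_real (exp (- (t\<^sup>2 * v / 2)))"
    by (simp only: char_std_normal_distribution minus_divide_left)
  finally show ?thesis .
qed

text \<open>
  A variant of Tannery's theorem: domination is replaced by uniform smallness of the tails, which also
  yields the summability of the limits.
\<close>

lemma tannery_tails:
  fixes b :: "nat \<Rightarrow> nat \<Rightarrow> real" and w :: "nat \<Rightarrow> nat \<Rightarrow> real" and \<tau> :: "nat \<Rightarrow> real"
  assumes lim: "\<And>h. 1 \<le> h \<Longrightarrow> (\<lambda>n. b n h) \<longlonglongrightarrow> \<tau> h"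
    and wlim: "\<And>h. (\<lambda>n. w n h) \<longlonglongrightarrow> 1"
    and wb: "\<forall>\<^sub>F n in sequentially. \<forall>h\<le>N n. \<bar>w n h\<bar> \<le> 1"
    and N: "filterlim N at_top sequentially"
    and tail: "\<And>\<epsilon>. 0 < \<epsilon> \<Longrightarrow> \<exists>k\<ge>1. \<forall>\<^sub>F n in sequentially. (\<Sum>h=k..N n. \<bar>b n h\<bar>) \<le> \<epsilon>"
  shows "summable (\<lambda>h. \<tau> (Suc h))"
    and "(\<lambda>n. \<Sum>h=1..N n. w n h * b n h) \<longlonglongrightarrow> (\<Sum>h. \<tau> (Suc h))"
proof -
  have tau_tail: "(\<Sum>h=k..K. \<bar>\<tau> h\<bar>) \<le> \<epsilon>"
    if k: "1 \<le> k" and ev: "\<forall>\<^sub>F n in sequentially. (\<Sum>h=k..N n. \<bar>b n h\<bar>) \<le> \<epsilon>" for k K \<epsilon>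
  proof (rule tendsto_upperbound)
    show "(\<lambda>n. \<Sum>h=k..K. \<bar>b n h\<bar>) \<longlonglongrightarrow> (\<Sum>h=k..K. \<bar>\<tau> h\<bar>)"
      using k by (intro tendsto_sum tendsto_rabs lim) auto
    have "\<forall>\<^sub>F n in sequentially. K \<le> N n" using N by (simp add: filterlim_at_top)
    with ev show "\<forall>\<^sub>F n in sequentially. (\<Sum>h=k..K. \<bar>b n h\<bar>) \<le> \<epsilon>"
    proof eventually_elim
      case (elim n)
      have "(\<Sum>h=k..K. \<bar>b n h\<bar>) \<le> (\<Sum>h=k..N n. \<bar>b n h\<bar>)" using elim(2) by (intro sum_mono2) auto
      then show ?case using elim(1) by linarith
    qed
  qed simp
  obtain k1 where k1: "1 \<le> k1" "\<forall>\<^sub>F n in sequentially. (\<Sum>h=k1..N n. \<bar>b n h\<bar>) \<le> 1" using tail[of 1] by auto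
  have "(\<Sum>i<n. \<bar>\<tau> (Suc i)\<bar>) \<le> (\<Sum>h=1..<k1. \<bar>\<tau> h\<bar>) + 1" for n
  proof -
    have "(\<Sum>i<n. \<bar>\<tau> (Suc i)\<bar>) = (\<Sum>h=1..n. \<bar>\<tau> h\<bar>)"
      by (rule sum.reindex_bij_witness[of _ "\<lambda>h. h - 1" Suc]) auto
    also have "\<dots> \<le> (\<Sum>h\<in>{1..<k1} \<union> {k1..n}. \<bar>\<tau> h\<bar>)" by (intro sum_mono2) auto
    also have "\<dots> = (\<Sum>h=1..<k1. \<bar>\<tau> h\<bar>) + (\<Sum>h=k1..n. \<bar>\<tau> h\<bar>)" by (intro sum.union_disjoint) auto
    also have "\<dots> \<le> (\<Sum>h=1..<k1. \<bar>\<tau> h\<bar>) + 1" using tau_tail[OF k1, of n] by simp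
    finally show ?thesis .
  qed
  then have abs_summable: "summable (\<lambda>h. \<bar>\<tau> (Suc h)\<bar>)"
    by (intro summableI_nonneg_bounded) auto
  then show summable: "summable (\<lambda>h. \<tau> (Suc h))" by (rule summable_rabs_cancel)
  show "(\<lambda>n. \<Sum>h=1..N n. w n h * b n h) \<longlonglongrightarrow> (\<Sum>h. \<tau> (Suc h))"
  proof (rule LIMSEQ_I)
    fix e :: real assume e: "0 < e"
    obtain k where k: "1 \<le> k" "\<forall>\<^sub>F n in sequentially. (\<Sum>h=k..N n. \<bar>b n h\<bar>) \<le> e / 4"
      using tail[of "e / 4"] e by auto
    have rest: "\<bar>(\<Sum>h. \<tau> (Suc h)) - (\<Sum>h=1..<k. \<tau> h)\<bar> \<le> e / 4"
    proof (rule tendsto_upperbound)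
      have "(\<lambda>n. \<Sum>i<n. \<tau> (Suc i)) \<longlonglongrightarrow> (\<Sum>h. \<tau> (Suc h))" using summable by (rule summable_LIMSEQ)
      then show "(\<lambda>n. \<bar>(\<Sum>i<n. \<tau> (Suc i)) - (\<Sum>h=1..<k. \<tau> h)\<bar>) \<longlonglongrightarrow> \<bar>(\<Sum>h. \<tau> (Suc h)) - (\<Sum>h=1..<k. \<tau> h)\<bar>"
        by (intro tendsto_intros)
      show "\<forall>\<^sub>F n in sequentially. \<bar>(\<Sum>i<n. \<tau> (Suc i)) - (\<Sum>h=1..<k. \<tau> h)\<bar> \<le> e / 4"
        using eventually_ge_at_top[of k]
      proof eventually_elim
        case (elim n)
        have "(\<Sum>i<n. \<tau> (Suc i)) = (\<Sum>h=1..n. \<tau> h)"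
          by (rule sum.reindex_bij_witness[of _ "\<lambda>h. h - 1" Suc]) auto
        also have "{1..n} = {1..<k} \<union> {k..n}" using elim k(1) by auto
        also have "(\<Sum>h\<in>{1..<k} \<union> {k..n}. \<tau> h) = (\<Sum>h=1..<k. \<tau> h) + (\<Sum>h=k..n. \<tau> h)"
          by (intro sum.union_disjoint) auto
        finally have "\<bar>(\<Sum>i<n. \<tau> (Suc i)) - (\<Sum>h=1..<k. \<tau> h)\<bar> = \<bar>\<Sum>h=k..n. \<tau> h\<bar>" by simp
        also have "\<dots> \<le> (\<Sum>h=k..n. \<bar>\<tau> h\<bar>)" by (rule sum_abs)
        finally show ?case using tau_tail[OF k, of n] by linarith
      qed
    qed simp
    have "(\<lambda>n. \<Sum>h=1..<k. w n h * b n h) \<longlonglongrightarrow> (\<Sum>h=1..<k. 1 * \<tau> h)"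
      by (intro tendsto_sum tendsto_mult wlim lim) auto
    then have "\<forall>\<^sub>F n in sequentially. \<bar>(\<Sum>h=1..<k. w n h * b n h) - (\<Sum>h=1..<k. \<tau> h)\<bar> < e / 4"
      using e tendstoD[of _ _ _ "e / 4"] by (fastforce simp: dist_real_def)
    moreover have "\<forall>\<^sub>F n in sequentially. k \<le> N n" using N by (simp add: filterlim_at_top)
    ultimately have "\<forall>\<^sub>F n in sequentially. norm ((\<Sum>h=1..N n. w n h * b n h) - (\<Sum>h. \<tau> (Suc h))) < e"
      using k(2) wb
    proof eventually_elim
      case (elim n)
      have "{1..N n} = {1..<k} \<union> {k..N n}" using elim(2) k(1) by auto
      then have split: "(\<Sum>h=1..N n. w n h * b n h) = (\<Sum>h=1..<k. w n h * b n h) + (\<Sum>h=k..N n. w n h * b n h)"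
        by (simp only:) (intro sum.union_disjoint; auto)
      have "\<bar>\<Sum>h=k..N n. w n h * b n h\<bar> \<le> (\<Sum>h=k..N n. \<bar>w n h * b n h\<bar>)" by (rule sum_abs)
      also have "\<dots> \<le> (\<Sum>h=k..N n. \<bar>b n h\<bar>)"
        using elim(4) by (intro sum_mono) (auto simp: abs_mult intro!: mult_left_le_one_le)
      finally have "\<bar>\<Sum>h=k..N n. w n h * b n h\<bar> \<le> e / 4" using elim(3) by linarith
      then show ?case
        unfolding split real_norm_def using elim(1) rest e by linarith
    qed
    then show "\<exists>no. \<forall>n\<ge>no. norm ((\<Sum>h=1..N n. w n h * b n h) - (\<Sum>h. \<tau> (Suc h))) < e"
      by (simp add: eventually_sequentially)
  qed
qed

text \<open>
  The asymptotic hypotheses without any reference to extremes: along the sample size \<open>n\<close>, the sets \<open>D n\<close>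
  become rare at the rate \<open>1 / m n\<close>, and joint visits to \<open>D n\<close> have limits \<open>\<tau> h\<close> on the same scale.
\<close>

locale indicator_array = prob_space M for M :: "'a measure" +
  fixes X :: "int \<Rightarrow> 'a \<Rightarrow> real ^ 'd" and D :: "nat \<Rightarrow> (real ^ 'd) set" and m r :: "nat \<Rightarrow> nat"
    and mu :: real and \<tau> :: "nat \<Rightarrow> real"
  assumes stationary: "strictly_stationary M X" and D: "\<And>n. D n \<in> sets borel"
    and m_top: "filterlim m at_top sequentially" and r_top: "filterlim r at_top sequentially"
    and m_n: "(\<lambda>n. real (m n) / real n) \<longlonglongrightarrow> 0" and r_m: "(\<lambda>n. real (r n) / real (m n)) \<longlonglongrightarrow> 0"
    and rate_summable: "summable (mixing_rate M X)"
    and rate_tail: "(\<lambda>n. real (m n) * (\<Sum>h. mixing_rate M X (r n + h))) \<longlonglongrightarrow> 0"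
    and rate_blocks: "(\<lambda>n. real n / real (m n) * mixing_rate M X (r n)) \<longlonglongrightarrow> 0"
    and lim_marginal: "(\<lambda>n. real (m n) * prob {\<omega> \<in> space M. X 0 \<omega> \<in> D n}) \<longlonglongrightarrow> mu"
    and lim_pair: "\<And>h. 1 \<le> h \<Longrightarrow>
      (\<lambda>n. real (m n) * prob {\<omega> \<in> space M. X 0 \<omega> \<in> D n \<and> X (int h) \<omega> \<in> D n}) \<longlonglongrightarrow> \<tau> h"
    and anticluster: "\<And>\<epsilon>. 0 < \<epsilon> \<Longrightarrow> \<exists>k. \<forall>\<^sub>F n in sequentially.
      real (m n) * (\<Sum>h=k..r n. prob {\<omega> \<in> space M. X 0 \<omega> \<in> D n \<and> X (int h) \<omega> \<in> D n}) \<le> \<epsilon>"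
begin

lemma row: "stationary_indicator M X (D n)"
  by (intro stationary_indicator.intro stationary_indicator_axioms.intro prob_space_axioms stationary D)

definition p where "p n = stationary_indicator.p M X (D n)"
definition xi where "xi n = stationary_indicator.xi M X (D n)"
definition gam where "gam n = stationary_indicator.gam M X (D n)"
definition Gam where "Gam n = stationary_indicator.Gam M X (D n)"
definition var where "var n = stationary_indicator.block_var M X (D n)"

text \<open>
  Blocks have length \<open>m n\<close>, of which \<open>N n\<close> indices are kept; \<open>k n\<close> complete blocks fit into the sample.
\<close>

definition N where "N n = m n - r n"
definition k where "k n = n div m n"

abbreviation rate where "rate \<equiv> mixing_rate M X"

lemmas p_bounds = stationary_indicator.p_bounds[OF row, folded p_def]
lemmas gam_eq = stationary_indicator.gam_eq[OF row, folded gam_def p_def]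
lemmas gam_zero = stationary_indicator.gam_zero[OF row, folded gam_def p_def]
lemmas abs_gam_le = stationary_indicator.abs_gam_le[OF row, folded gam_def p_def]
lemmas abs_gam_le_rate = stationary_indicator.abs_gam_le_rate[OF row, folded gam_def]
lemmas Gam_eq = stationary_indicator.Gam_def[OF row, folded Gam_def gam_def]
lemmas Gam_nonneg = stationary_indicator.Gam_nonneg[OF row, folded Gam_def]
lemmas var_eq = stationary_indicator.variance_sum[OF row, folded stationary_indicator.block_var_def[OF row], folded var_def gam_def]

lemma good: "\<forall>\<^sub>F n in sequentially. 0 < n \<and> 0 < m n \<and> 1 \<le> r n \<and> r n \<le> m n \<and> m n \<le> n"
proof -
  have "\<forall>\<^sub>F n in sequentially. 1 \<le> m n" "\<forall>\<^sub>F n in sequentially. 1 \<le> r n"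
    using m_top r_top by (simp_all add: filterlim_at_top)
  moreover have "\<forall>\<^sub>F n in sequentially. real (m n) / real n < 1" "\<forall>\<^sub>F n in sequentially. real (r n) / real (m n) < 1"
    using order_tendstoD(2)[OF m_n, of 1] order_tendstoD(2)[OF r_m, of 1] by simp_all
  ultimately show ?thesis
    using eventually_gt_at_top[of 0]
    by eventually_elim (auto simp: divide_less_eq)
qed

lemma inverse_m: "(\<lambda>n. 1 / real (m n)) \<longlonglongrightarrow> 0"
  by (rule tendsto_divide_0[OF tendsto_const])
     (rule filterlim_at_top_imp_at_infinity[OF filterlim_compose[OF filterlim_real_sequentially m_top]])

lemma const_over_m: "(\<lambda>n. c / real (m n)) \<longlonglongrightarrow> 0"
  using tendsto_mult_left[OF inverse_m, of c] by simp

lemma m_p: "(\<lambda>n. real (m n) * p n) \<longlonglongrightarrow> mu"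
  using lim_marginal unfolding p_def stationary_indicator.p_def[OF row] .

lemma m_p2: "(\<lambda>n. real (m n) * (p n)\<^sup>2) \<longlonglongrightarrow> 0"
proof -
  have "(\<lambda>n. (real (m n) * p n) * (real (m n) * p n) * (1 / real (m n))) \<longlonglongrightarrow> mu * mu * 0"
    by (intro tendsto_mult m_p inverse_m)
  moreover have "(real (m n) * p n) * (real (m n) * p n) * (1 / real (m n)) = real (m n) * (p n)\<^sup>2" for n
    by (cases "m n = 0") (simp_all add: power2_eq_square)
  ultimately show ?thesis by simp
qed

lemma m_gam0: "(\<lambda>n. real (m n) * gam n 0) \<longlonglongrightarrow> mu"
  using tendsto_diff[OF m_p m_p2] by (simp add: gam_zero right_diff_distrib)

lemma m_gam: "1 \<le> h \<Longrightarrow> (\<lambda>n. real (m n) * gam n h) \<longlonglongrightarrow> \<tau> h"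
  using tendsto_diff[OF lim_pair m_p2] by (simp add: gam_eq right_diff_distrib)

lemma sum_rate_le:
  assumes "A \<subseteq> {j..}" "finite A"
  shows "(\<Sum>h\<in>A. rate h) \<le> (\<Sum>h. rate (j + h))"
proof -
  have "(\<Sum>h\<in>A. rate h) = (\<Sum>i\<in>(\<lambda>h. h - j) ` A. rate (j + i))"
    using assms by (subst sum.reindex) (auto intro!: inj_on_diff_nat sum.cong simp: subset_iff)
  also have "\<dots> \<le> (\<Sum>h. rate (j + h))"
    using assms summable_ignore_initial_segment[OF rate_summable, of j] mixing_rate_nonneg
    by (intro sum_le_suminf) (auto simp: add.commute)
  finally show ?thesis .
qed

text \<open>
  Up to lag \<open>r n\<close> the covariances are controlled by the anti-clustering condition, beyond it by the
  mixing rates.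
\<close>

lemma gam_tail:
  assumes e: "0 < \<epsilon>"
  shows "\<exists>j\<ge>1. \<forall>\<^sub>F n in sequentially. (\<Sum>h=j..n. \<bar>real (m n) * gam n h\<bar>) \<le> \<epsilon>"
proof -
  define P where "P n h = prob {\<omega> \<in> space M. X 0 \<omega> \<in> D n \<and> X (int h) \<omega> \<in> D n}" for n h
  obtain j0 where j0: "\<forall>\<^sub>F n in sequentially. real (m n) * (\<Sum>h=j0..r n. P n h) \<le> \<epsilon> / 3"
    using anticluster[of "\<epsilon> / 3"] e unfolding P_def by auto
  have "(\<lambda>n. (real (m n) * p n) * (real (m n) * p n) * (real (r n) / real (m n))) \<longlonglongrightarrow> mu * mu * 0"
    by (intro tendsto_mult m_p r_m)
  then have lim2: "\<forall>\<^sub>F n in sequentially. (real (m n) * p n) * (real (m n) * p n) * (real (r n) / real (m n)) < \<epsilon> / 3"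
    using e by (intro order_tendstoD) auto
  have "(\<lambda>n. 4 * (real (m n) * (\<Sum>h. rate (r n + h)))) \<longlonglongrightarrow> 4 * 0"
    by (intro tendsto_mult tendsto_const rate_tail)
  then have lim3: "\<forall>\<^sub>F n in sequentially. 4 * (real (m n) * (\<Sum>h. rate (r n + h))) < \<epsilon> / 3"
    using e order_tendstoD(2)[of _ "4 * 0" sequentially "\<epsilon> / 3"] by fastforce
  have "\<forall>\<^sub>F n in sequentially. (\<Sum>h=Suc j0..n. \<bar>real (m n) * gam n h\<bar>) \<le> \<epsilon>"
    using j0 lim2 lim3 good
  proof eventually_elim
    case (elim n)
    have P0: "0 \<le> P n h" for h by (simp add: P_def)
    have "(\<Sum>h=Suc j0..n. \<bar>gam n h\<bar>) \<le> (\<Sum>h\<in>{Suc j0..r n} \<union> {r n<..n}. \<bar>gam n h\<bar>)"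
      by (intro sum_mono2) auto
    also have "\<dots> = (\<Sum>h=Suc j0..r n. \<bar>gam n h\<bar>) + (\<Sum>h\<in>{r n<..n}. \<bar>gam n h\<bar>)"
      by (intro sum.union_disjoint) auto
    also have "(\<Sum>h=Suc j0..r n. \<bar>gam n h\<bar>) \<le> (\<Sum>h=Suc j0..r n. P n h + (p n)\<^sup>2)"
      unfolding P_def by (intro sum_mono abs_gam_le)
    also have "\<dots> = (\<Sum>h=Suc j0..r n. P n h) + real (r n - j0) * (p n)\<^sup>2"
      by (simp add: sum.distrib)
    also have "(\<Sum>h=Suc j0..r n. P n h) \<le> (\<Sum>h=j0..r n. P n h)"
      using P0 by (intro sum_mono2) auto
    also have "real (r n - j0) * (p n)\<^sup>2 \<le> real (r n) * (p n)\<^sup>2"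
      by (intro mult_right_mono) auto
    also have "(\<Sum>h\<in>{r n<..n}. \<bar>gam n h\<bar>) \<le> (\<Sum>h\<in>{r n<..n}. 4 * rate h)"
      by (intro sum_mono abs_gam_le_rate)
    also have "\<dots> = 4 * (\<Sum>h\<in>{r n<..n}. rate h)" by (simp add: sum_distrib_left)
    also have "(\<Sum>h\<in>{r n<..n}. rate h) \<le> (\<Sum>h. rate (r n + h))"
      by (rule sum_rate_le) auto
    finally have "(\<Sum>h=Suc j0..n. \<bar>gam n h\<bar>) \<le>
      (\<Sum>h=j0..r n. P n h) + real (r n) * (p n)\<^sup>2 + 4 * (\<Sum>h. rate (r n + h))" by simp
    then have "real (m n) * (\<Sum>h=Suc j0..n. \<bar>gam n h\<bar>) \<le>
      real (m n) * ((\<Sum>h=j0..r n. P n h) + real (r n) * (p n)\<^sup>2 + 4 * (\<Sum>h. rate (r n + h)))"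
      by (intro mult_left_mono) auto
    also have "\<dots> = real (m n) * (\<Sum>h=j0..r n. P n h) +
      (real (m n) * p n) * (real (m n) * p n) * (real (r n) / real (m n)) + 4 * (real (m n) * (\<Sum>h. rate (r n + h)))"
      using elim(4) by (simp add: distrib_left power2_eq_square)
    also have "\<dots> \<le> \<epsilon>" using elim(1-3) by linarith
    finally show ?case by (simp add: abs_mult sum_distrib_left)
  qed
  then show ?thesis by (intro exI[of _ "Suc j0"]) auto
qed

lemma N_le: "N n \<le> m n"
  by (simp add: N_def)

lemma N_over_m: "(\<lambda>n. real (N n) / real (m n)) \<longlonglongrightarrow> 1"
proof -
  have "(\<lambda>n. 1 - real (r n) / real (m n)) \<longlonglongrightarrow> 1 - 0"
    by (intro tendsto_diff tendsto_const r_m)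
  moreover have "\<forall>\<^sub>F n in sequentially. 1 - real (r n) / real (m n) = real (N n) / real (m n)"
    using good by eventually_elim (simp add: N_def of_nat_diff diff_divide_distrib)
  ultimately show ?thesis by (simp add: tendsto_cong)
qed

lemma N_top: "filterlim N at_top sequentially"
proof -
  have "filterlim (\<lambda>n. real (N n) / real (m n) * real (m n)) at_top sequentially"
    by (rule filterlim_tendsto_pos_mult_at_top[OF N_over_m _ filterlim_compose[OF filterlim_real_sequentially m_top]]) simp
  moreover have "\<forall>\<^sub>F n in sequentially. real (N n) / real (m n) * real (m n) = real (N n)"
    using good by eventually_elim simp
  ultimately have "filterlim (\<lambda>n. real (N n)) at_top sequentially"
    by (rule filterlim_cong[THEN iffD1, OF refl refl, rotated])
  then have "\<forall>\<^sub>F n in sequentially. real Z \<le> real (N n)" for Z :: nat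
    unfolding filterlim_at_top by blast
  then show ?thesis by (simp add: filterlim_at_top)
qed

lemma weight_lim: "(\<lambda>n. (real (N n) - real h) / real (m n)) \<longlonglongrightarrow> 1"
  using tendsto_diff[OF N_over_m const_over_m[of "real h"]] by (simp add: diff_divide_distrib)

lemma
  shows tau_summable: "summable (\<lambda>h. \<tau> (Suc h))"
    and cov_sum_lim: "(\<lambda>n. \<Sum>h=1..N n. (real (N n) - real h) / real (m n) * (real (m n) * gam n h)) \<longlonglongrightarrow> (\<Sum>h. \<tau> (Suc h))"
proof -
  have wb: "\<forall>\<^sub>F n in sequentially. \<forall>h\<le>N n. \<bar>(real (N n) - real h) / real (m n)\<bar> \<le> 1"
    using good
  proof eventually_elim
    case (elim n)
    then show ?case using N_le[of n] by (auto simp: divide_le_eq)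
  qed
  have tail: "\<exists>j\<ge>1. \<forall>\<^sub>F n in sequentially. (\<Sum>h=j..N n. \<bar>real (m n) * gam n h\<bar>) \<le> \<epsilon>" if e: "0 < \<epsilon>" for \<epsilon>
  proof -
    obtain j where j: "1 \<le> j" "\<forall>\<^sub>F n in sequentially. (\<Sum>h=j..n. \<bar>real (m n) * gam n h\<bar>) \<le> \<epsilon>"
      using gam_tail[OF e] by auto
    from j(2) good have "\<forall>\<^sub>F n in sequentially. (\<Sum>h=j..N n. \<bar>real (m n) * gam n h\<bar>) \<le> \<epsilon>"
    proof eventually_elim
      case (elim n)
      have "(\<Sum>h=j..N n. \<bar>real (m n) * gam n h\<bar>) \<le> (\<Sum>h=j..n. \<bar>real (m n) * gam n h\<bar>)"
        using elim(2) N_le[of n] by (intro sum_mono2) auto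
      then show ?case using elim(1) by linarith
    qed
    then show ?thesis using j(1) by blast
  qed
  note T = tannery_tails[OF m_gam weight_lim wb N_top tail]
  show "summable (\<lambda>h. \<tau> (Suc h))" by (rule T(1))
  show "(\<lambda>n. \<Sum>h=1..N n. (real (N n) - real h) / real (m n) * (real (m n) * gam n h)) \<longlonglongrightarrow> (\<Sum>h. \<tau> (Suc h))"
    by (rule T(2))
qed

definition sig2 where "sig2 = mu + 2 * (\<Sum>h. \<tau> (Suc h))"

lemma var_lim: "(\<lambda>n. var n (N n)) \<longlonglongrightarrow> sig2"
proof -
  have "(\<lambda>n. real (N n) / real (m n) * (real (m n) * gam n 0) +
      2 * (\<Sum>h=1..N n. (real (N n) - real h) / real (m n) * (real (m n) * gam n h))) \<longlonglongrightarrow> 1 * mu + 2 * (\<Sum>h. \<tau> (Suc h))"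
    by (intro tendsto_add tendsto_mult tendsto_const N_over_m m_gam0 cov_sum_lim)
  moreover have "\<forall>\<^sub>F n in sequentially. real (N n) / real (m n) * (real (m n) * gam n 0) +
      2 * (\<Sum>h=1..N n. (real (N n) - real h) / real (m n) * (real (m n) * gam n h)) = var n (N n)"
    using good by eventually_elim (simp add: var_eq)
  ultimately show ?thesis by (simp add: sig2_def tendsto_cong)
qed

lemma var_nonneg: "0 \<le> var n j"
  unfolding var_def stationary_indicator.block_var_def[OF row] by (simp add: integral_nonneg)

lemma sig2_nonneg: "0 \<le> sig2"
  using var_lim by (rule LIMSEQ_le_const) (auto intro: var_nonneg)

text \<open>
  Together with the variance bound for subset sums this makes each summand contribute a variance of
  order \<open>1 / m n\<close>.
\<close>

lemma m_Gam_bounded: obtains B where "0 \<le> B" "\<forall>\<^sub>F n in sequentially. real (m n) * Gam n n \<le> B"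
proof -
  obtain j where j: "1 \<le> j" "\<forall>\<^sub>F n in sequentially. (\<Sum>h=j..n. \<bar>real (m n) * gam n h\<bar>) \<le> 1"
    using gam_tail[of 1] by auto
  define L where "L = mu + 2 * (\<Sum>h=1..<j. \<bar>\<tau> h\<bar>)"
  have "(\<lambda>n. real (m n) * gam n 0 + 2 * (\<Sum>h=1..<j. \<bar>real (m n) * gam n h\<bar>)) \<longlonglongrightarrow> L"
    unfolding L_def by (intro tendsto_add tendsto_mult tendsto_const m_gam0 tendsto_sum tendsto_rabs m_gam) auto
  then have "\<forall>\<^sub>F n in sequentially. real (m n) * gam n 0 + 2 * (\<Sum>h=1..<j. \<bar>real (m n) * gam n h\<bar>) < L + 1"
    by (rule order_tendstoD) simp
  with j(2) have "\<forall>\<^sub>F n in sequentially. real (m n) * Gam n n \<le> \<bar>L\<bar> + 3"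
  proof eventually_elim
    case (elim n)
    have "(\<Sum>h=1..n. \<bar>real (m n) * gam n h\<bar>) \<le> (\<Sum>h\<in>{1..<j} \<union> {j..n}. \<bar>real (m n) * gam n h\<bar>)"
      by (intro sum_mono2) auto
    also have "\<dots> = (\<Sum>h=1..<j. \<bar>real (m n) * gam n h\<bar>) + (\<Sum>h=j..n. \<bar>real (m n) * gam n h\<bar>)"
      by (intro sum.union_disjoint) auto
    finally have "(\<Sum>h=1..n. \<bar>real (m n) * gam n h\<bar>) \<le> (\<Sum>h=1..<j. \<bar>real (m n) * gam n h\<bar>) + 1"
      using elim(1) by linarith
    moreover have "real (m n) * Gam n n = real (m n) * gam n 0 + 2 * (\<Sum>h=1..n. \<bar>real (m n) * gam n h\<bar>)"
      by (simp add: Gam_eq distrib_left sum_distrib_left abs_mult mult_ac)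
    ultimately show ?case using elim(2) by linarith
  qed
  then show ?thesis using that[of "\<bar>L\<bar> + 3"] by simp
qed

lemma k_m_over_n: "(\<lambda>n. real (k n) * real (m n) / real n) \<longlonglongrightarrow> 1"
proof (rule tendsto_sandwich)
  show "(\<lambda>n. 1 - real (m n) / real n) \<longlonglongrightarrow> 1"
    using tendsto_diff[OF tendsto_const m_n, of 1] by simp
  show "\<forall>\<^sub>F n in sequentially. 1 - real (m n) / real n \<le> real (k n) * real (m n) / real n"
    using good
  proof eventually_elim
    case (elim n)
    have "n = k n * m n + n mod m n" by (simp add: k_def)
    moreover have "n mod m n < m n" using elim by simp
    ultimately have "n \<le> k n * m n + m n" by linarith
    then have "real n \<le> real (k n) * real (m n) + real (m n)" by (simp flip: of_nat_mult of_nat_add)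
    then have "real n / real n \<le> (real (k n) * real (m n) + real (m n)) / real n"
      by (intro divide_right_mono) auto
    then show ?case using elim by (simp add: add_divide_distrib)
  qed
  show "\<forall>\<^sub>F n in sequentially. real (k n) * real (m n) / real n \<le> 1"
    using good
  proof eventually_elim
    case (elim n)
    have "k n * m n \<le> n" by (simp add: k_def)
    then have "real (k n) * real (m n) \<le> real n" by (simp flip: of_nat_mult)
    then show ?case using elim by (simp add: divide_le_eq)
  qed
qed auto

lemma k_le: "real (k n) \<le> real n / real (m n)"
  by (simp add: k_def of_nat_div_le_of_nat)

end

context indicator_array
begin

definition E3 where "E3 n = expectation (\<lambda>\<omega>. \<bar>\<Sum>t=1..N n. xi n t \<omega>\<bar> ^ 3)"
definition E4 where "E4 n = expectation (\<lambda>\<omega>. (\<Sum>t=1..N n. xi n t \<omega>) ^ 4)"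

lemma var_xi: "var n j = expectation (\<lambda>\<omega>. (\<Sum>t=1..j. xi n t \<omega>)\<^sup>2)"
  unfolding var_def xi_def by (rule stationary_indicator.block_var_def[OF row])

lemma integrable_abs_power: "integrable M (\<lambda>\<omega>. \<bar>\<Sum>t\<in>T. xi n t \<omega>\<bar> ^ j)"
  unfolding xi_def by (rule stationary_indicator.integrable_power_sum_xi[OF row])

lemma integrable_square: "integrable M (\<lambda>\<omega>. (\<Sum>t\<in>T. xi n t \<omega>)\<^sup>2)"
  unfolding xi_def by (rule stationary_indicator.integrable_power2_sum_xi[OF row])

lemma abs_sum_xi_le: "\<bar>\<Sum>t\<in>T. xi n t \<omega>\<bar> \<le> real (card T)"
  unfolding xi_def by (rule stationary_indicator.abs_sum_xi_le[OF row])

lemma integrable_fourth: "integrable M (\<lambda>\<omega>. (\<Sum>t\<in>T. xi n t \<omega>) ^ 4)"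
  using integrable_abs_power[where n=n and T=T and j=4] by simp

lemma E3_nonneg: "0 \<le> E3 n" and E4_nonneg: "0 \<le> E4 n"
  by (auto simp: E3_def E4_def intro!: integral_nonneg)

text \<open>The block sum is bounded by the number of its terms, so that \<open>(m n)\<^sup>3 = o(n)\<close> suffices.\<close>

lemma third_moment_small_blocks:
  assumes "(\<lambda>n. real (m n)) \<in> o(\<lambda>n. real n powr (1 / 3))"
  shows "(\<lambda>n. sqrt (real (m n) / real n) * E3 n) \<longlonglongrightarrow> 0"
proof -
  let ?q = "\<lambda>n. real (m n) / real n powr (1 / 3)"
  have "?q \<longlonglongrightarrow> 0" using assms by (rule smalloD_tendsto)
  then have "(\<lambda>n. sqrt (?q n ^ 3) * var n (N n)) \<longlonglongrightarrow> sqrt (0 ^ 3) * sig2"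
    by (intro tendsto_mult tendsto_real_sqrt tendsto_power var_lim)
  then have lim: "(\<lambda>n. sqrt (?q n ^ 3) * var n (N n)) \<longlonglongrightarrow> 0" by simp
  show ?thesis
  proof (rule Lim_null_comparison[OF _ lim])
    show "\<forall>\<^sub>F n in sequentially. norm (sqrt (real (m n) / real n) * E3 n) \<le> sqrt (?q n ^ 3) * var n (N n)"
      using good
    proof eventually_elim
      case (elim n)
      have "E3 n \<le> expectation (\<lambda>\<omega>. real (m n) * (\<Sum>t=1..N n. xi n t \<omega>)\<^sup>2)"
        unfolding E3_def
      proof (intro integral_mono integrable_abs_power integrable_mult_right integrable_square)
        fix \<omega>
        have "\<bar>\<Sum>t=1..N n. xi n t \<omega>\<bar> \<le> real (m n)"
          using abs_sum_xi_le[where n=n and T="{1..N n}" and \<omega>=\<omega>] N_le[of n] by simp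
        then have "\<bar>\<Sum>t=1..N n. xi n t \<omega>\<bar> * \<bar>\<Sum>t=1..N n. xi n t \<omega>\<bar>\<^sup>2 \<le> real (m n) * \<bar>\<Sum>t=1..N n. xi n t \<omega>\<bar>\<^sup>2"
          by (intro mult_right_mono) auto
        then show "\<bar>\<Sum>t=1..N n. xi n t \<omega>\<bar> ^ 3 \<le> real (m n) * (\<Sum>t=1..N n. xi n t \<omega>)\<^sup>2"
          by (simp add: power3_eq_cube power2_eq_square abs_mult_self_eq mult.assoc)
      qed
      also have "\<dots> = real (m n) * var n (N n)" by (simp add: var_xi)
      finally have E3: "E3 n \<le> real (m n) * var n (N n)" .
      have "(real n powr (1 / 3)) ^ 3 = real n" using elim by (simp add: powr_power)
      then have "?q n ^ 3 = real (m n) / real n * (real (m n))\<^sup>2"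
        by (simp add: power_divide power3_eq_cube power2_eq_square)
      then have "sqrt (?q n ^ 3) = sqrt (real (m n) / real n) * real (m n)"
        by (simp only: real_sqrt_mult[of "real (m n) / real n"] real_sqrt_abs abs_of_nat)
      then have eq: "sqrt (?q n ^ 3) * var n (N n) = sqrt (real (m n) / real n) * (real (m n) * var n (N n))"
        by simp
      have "norm (sqrt (real (m n) / real n) * E3 n) = sqrt (real (m n) / real n) * E3 n"
        using E3_nonneg[of n] by simp
      also have "\<dots> \<le> sqrt (real (m n) / real n) * (real (m n) * var n (N n))"
        by (intro mult_left_mono E3) simp
      finally show ?case unfolding eq .
    qed
  qed
qed

lemma fourth_moment_bound:
  "E4 n \<le> 24 * (real (N n) * (12 * (real (N n) + 1)\<^sup>2 * (\<Sum>g=r n + 1..N n. rate g) +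
    (real (N n) + 1) * (stationary_indicator.Gam M X (D n) (N n))\<^sup>2 + 2 * p n * (real (r n) + 1) ^ 3))"
  unfolding E4_def xi_def p_def
  by (rule stationary_indicator.fourth_moment_sum[OF row])

lemma Gam_mono: "j \<le> n \<Longrightarrow> stationary_indicator.Gam M X (D n) j \<le> Gam n n"
  unfolding Gam_def stationary_indicator.Gam_def[OF row]
  by (intro add_left_mono mult_left_mono sum_mono2) auto

text \<open>
  The three terms of the fourth moment bound correspond to the first hypothesis, to \<open>m n / n\<close> tending to
  \<open>0\<close>, and to the second hypothesis.
\<close>

lemma fourth_moment_lim:
  assumes a: "(\<lambda>n. real (m n) ^ 4 / real n * (\<Sum>j=r n..m n. rate j)) \<longlonglongrightarrow> 0"
    and b: "(\<lambda>n. real (m n) * real (r n) ^ 3 / real n) \<longlonglongrightarrow> 0"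
  shows "(\<lambda>n. real (m n) / real n * E4 n) \<longlonglongrightarrow> 0"
proof -
  obtain B where B: "0 \<le> B" "\<forall>\<^sub>F n in sequentially. real (m n) * Gam n n \<le> B"
    using m_Gam_bounded by blast
  let ?R = "\<lambda>n. \<Sum>j=r n..m n. rate j"
  \<comment> \<open>The constants come from \<open>N n + 1 \<le> 2 * m n\<close> and \<open>r n + 1 \<le> 2 * r n\<close>.\<close>
  let ?b = "\<lambda>n. 24 * (48 * (real (m n) ^ 4 / real n * ?R n) + 2 * (B\<^sup>2 * (real (m n) / real n)) +
    16 * ((real (m n) * p n) * (real (m n) * real (r n) ^ 3 / real n)))"
  have "?b \<longlonglongrightarrow> 24 * (48 * 0 + 2 * (B\<^sup>2 * 0) + 16 * (mu * 0))"
    by (intro tendsto_mult tendsto_add tendsto_const a b m_n m_p)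
  then have lim: "?b \<longlonglongrightarrow> 0" by simp
  show ?thesis
  proof (rule Lim_null_comparison[OF _ lim])
    show "\<forall>\<^sub>F n in sequentially. norm (real (m n) / real n * E4 n) \<le> ?b n"
      using good B(2)
    proof eventually_elim
      case (elim n)
      define u where "u = real (m n)"
      have u: "1 \<le> u" "real (N n) \<le> u" "real (N n) + 1 \<le> 2 * u" "1 \<le> real (r n)"
        using elim(1) N_le[of n] by (auto simp: u_def)
      have R: "(\<Sum>g=r n + 1..N n. rate g) \<le> ?R n"
        using N_le[of n] by (intro sum_mono2) (auto simp: mixing_rate_nonneg)
      have R0: "0 \<le> ?R n" by (intro sum_nonneg mixing_rate_nonneg)
      have G: "stationary_indicator.Gam M X (D n) (N n) \<le> Gam n n" "0 \<le> stationary_indicator.Gam M X (D n) (N n)"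
        using elim(1) N_le[of n] Gam_mono[of "N n" n] stationary_indicator.Gam_nonneg[OF row] by auto
      have G2: "u * stationary_indicator.Gam M X (D n) (N n) \<le> B"
        using mult_left_mono[OF G(1), of u] elim(2) u(1) unfolding u_def by linarith
      let ?G = "stationary_indicator.Gam M X (D n) (N n)"
      have t1: "real (N n) * (12 * (real (N n) + 1)\<^sup>2 * (\<Sum>g=r n + 1..N n. rate g)) \<le> u * (12 * (2 * u)\<^sup>2 * ?R n)"
        using u R R0 by (intro mult_mono power_mono mult_nonneg_nonneg sum_nonneg mixing_rate_nonneg) auto
      have "real (N n) * ((real (N n) + 1) * ?G\<^sup>2) \<le> u * ((2 * u) * ?G\<^sup>2)"
        using u by (intro mult_mono mult_nonneg_nonneg) auto
      also have "\<dots> = 2 * (u * ?G)\<^sup>2" by (simp add: power2_eq_square)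
      also have "\<dots> \<le> 2 * B\<^sup>2" using G2 G(2) u by (intro mult_left_mono power_mono) auto
      finally have t2: "real (N n) * ((real (N n) + 1) * ?G\<^sup>2) \<le> 2 * B\<^sup>2" .
      have t3: "real (N n) * (2 * p n * (real (r n) + 1) ^ 3) \<le> u * (2 * p n * (2 * real (r n)) ^ 3)"
        using u p_bounds by (intro mult_mono power_mono mult_nonneg_nonneg) auto
      have "E4 n \<le> 24 * (u * (12 * (2 * u)\<^sup>2 * ?R n) + 2 * B\<^sup>2 + u * (2 * p n * (2 * real (r n)) ^ 3))"
        using fourth_moment_bound[of n] t1 t2 t3 unfolding distrib_left by linarith
      then have "u / real n * E4 n \<le> u / real n * (24 * (u * (12 * (2 * u)\<^sup>2 * ?R n) + 2 * B\<^sup>2 + u * (2 * p n * (2 * real (r n)) ^ 3)))"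
        using u by (intro mult_left_mono) auto
      also have "\<dots> = ?b n"
        by (simp add: u_def power2_eq_square power3_eq_cube power4_eq_xxxx algebra_simps)
      finally show ?case using E4_nonneg[of n] by (simp add: u_def)
    qed
  qed
qed

text \<open>
  The third moment is interpolated between the second and the fourth by the inequality of
  arithmetic and geometric means with a weight adapted to the size of the fourth moment.
\<close>

lemma third_moment_interpolation:
  assumes Q: "(\<lambda>n. real (m n) / real n * E4 n) \<longlonglongrightarrow> 0"
  shows "(\<lambda>n. sqrt (real (m n) / real n) * E3 n) \<longlonglongrightarrow> 0"
proof -
  let ?Q = "\<lambda>n. real (m n) / real n * E4 n"
  \<comment> \<open>The second summand only keeps the weight positive.\<close>
  let ?d = "\<lambda>n. sqrt (?Q n) + 1 / real (Suc n)"
  have d: "?d \<longlonglongrightarrow> 0"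
    using tendsto_add[OF tendsto_real_sqrt[OF Q] LIMSEQ_inverse_real_of_nat] by (simp add: inverse_eq_divide)
  have "(\<lambda>n. (?d n * var n (N n) + sqrt (?Q n)) / 2) \<longlonglongrightarrow> (0 * sig2 + sqrt 0) / 2"
    by (intro tendsto_intros d var_lim Q) simp
  then have lim: "(\<lambda>n. (?d n * var n (N n) + sqrt (?Q n)) / 2) \<longlonglongrightarrow> 0" by simp
  show ?thesis
  proof (rule Lim_null_comparison[OF _ lim], rule always_eventually, rule allI)
    fix n
    define c where "c = sqrt (real (m n) / real n)"
    define e where "e = ?d n"
    have c0: "0 \<le> c" and c2: "c\<^sup>2 = real (m n) / real n" by (auto simp: c_def)
    have Q0: "0 \<le> ?Q n" using E4_nonneg[of n] by simp
    have e0: "0 < e" and eQ: "sqrt (?Q n) \<le> e"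
      using Q0 by (auto simp: e_def intro: add_nonneg_pos)
    have am: "2 * (c * \<bar>x\<bar> ^ 3) \<le> e * x\<^sup>2 + c\<^sup>2 / e * x ^ 4" for x :: real
    proof -
      have "0 \<le> (e * \<bar>x\<bar> - c * x\<^sup>2)\<^sup>2 / e" using e0 by simp
      also have "(e * \<bar>x\<bar> - c * x\<^sup>2)\<^sup>2 = e\<^sup>2 * x\<^sup>2 - 2 * (e * (c * (\<bar>x\<bar> * x\<^sup>2))) + c\<^sup>2 * (x\<^sup>2)\<^sup>2"
        by (simp add: power2_diff power_mult_distrib)
      also have "\<dots> / e = e * x\<^sup>2 - 2 * (c * (\<bar>x\<bar> * x\<^sup>2)) + c\<^sup>2 / e * (x\<^sup>2)\<^sup>2"
        using e0 by (simp add: add_divide_distrib diff_divide_distrib power2_eq_square)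
      also have "\<bar>x\<bar> * x\<^sup>2 = \<bar>x\<bar> ^ 3" by (simp add: power3_eq_cube power2_eq_square)
      also have "(x\<^sup>2)\<^sup>2 = x ^ 4" by simp
      finally show ?thesis by simp
    qed
    let ?Y = "\<lambda>\<omega>. \<Sum>t=1..N n. xi n t \<omega>"
    have "2 * (c * E3 n) = expectation (\<lambda>\<omega>. 2 * (c * \<bar>?Y \<omega>\<bar> ^ 3))"
      unfolding E3_def using integrable_abs_power[where n=n and T="{1..N n}" and j=3] by simp
    also have "\<dots> \<le> expectation (\<lambda>\<omega>. e * (?Y \<omega>)\<^sup>2 + c\<^sup>2 / e * ?Y \<omega> ^ 4)"
      by (intro integral_mono am Bochner_Integration.integrable_add integrable_mult_right
          integrable_abs_power integrable_square integrable_fourth)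
    also have "\<dots> = e * var n (N n) + c\<^sup>2 / e * E4 n"
      unfolding var_xi E4_def using integrable_square[where n=n and T="{1..N n}"] integrable_fourth[where n=n and T="{1..N n}"] by simp
    also have "c\<^sup>2 / e * E4 n = ?Q n / e" by (simp add: c2)
    also have "?Q n / e \<le> sqrt (?Q n)"
    proof -
      have "?Q n = sqrt (?Q n) * sqrt (?Q n)" using Q0 by (simp only: real_sqrt_mult_self abs_of_nonneg)
      also have "\<dots> \<le> sqrt (?Q n) * e" using eQ Q0 by (intro mult_left_mono) auto
      finally show ?thesis by (simp only: pos_divide_le_eq[OF e0])
    qed
    finally have "2 * (c * E3 n) \<le> e * var n (N n) + sqrt (?Q n)" by simp
    then show "norm (sqrt (real (m n) / real n) * E3 n) \<le> (?d n * var n (N n) + sqrt (?Q n)) / 2"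
      using E3_nonneg[of n] c0 unfolding c_def[symmetric] e_def[symmetric] by (simp add: abs_mult)
  qed
qed

theorem char_limit:
  assumes third: "(\<lambda>n. sqrt (real (m n) / real n) * E3 n) \<longlonglongrightarrow> 0"
  shows "(\<lambda>n. expectation (\<lambda>\<omega>. iexp (t * sqrt (real (m n) / real n) * (\<Sum>s=1..n. xi n s \<omega>))))
    \<longlonglongrightarrow> complex_of_real (exp (- (t\<^sup>2 * sig2 / 2)))"
proof -
  let ?A = "\<lambda>n. expectation (\<lambda>\<omega>. iexp (t * sqrt (real (m n) / real n) * (\<Sum>s=1..n. xi n s \<omega>)))"
  let ?W = "\<lambda>n. var n (N n)"
  let ?g = "\<lambda>n. complex_of_real (exp (- (t\<^sup>2 * (real (k n) * real (m n) / real n * ?W n) / 2)))"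
  obtain B where B: "0 \<le> B" "\<forall>\<^sub>F n in sequentially. real (m n) * Gam n n \<le> B"
    using m_Gam_bounded by blast
  let ?b = "\<lambda>n. \<bar>t\<bar> * sqrt ((real (m n) / real n + real (r n) / real (m n)) * B) +
    16 * (real n / real (m n) * rate (r n)) + \<bar>t\<bar> ^ 3 / 6 * (sqrt (real (m n) / real n) * E3 n) +
    t ^ 4 / 4 * (real (m n) / real n * (?W n)\<^sup>2)"
  have "?b \<longlonglongrightarrow> \<bar>t\<bar> * sqrt ((0 + 0) * B) + 16 * 0 + \<bar>t\<bar> ^ 3 / 6 * 0 + t ^ 4 / 4 * (0 * sig2\<^sup>2)"
    by (intro tendsto_add tendsto_mult tendsto_const tendsto_real_sqrt m_n r_m rate_blocks third tendsto_power var_lim)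
  then have blim: "?b \<longlonglongrightarrow> 0" by simp
  have "(\<lambda>n. ?A n - ?g n) \<longlonglongrightarrow> 0"
  proof (rule Lim_null_comparison[OF _ blim])
    show "\<forall>\<^sub>F n in sequentially. norm (?A n - ?g n) \<le> ?b n"
      using good B(2)
    proof eventually_elim
      case (elim n)
      define c where "c = sqrt (real (m n) / real n)"
      have c0: "0 \<le> c" and c2: "c\<^sup>2 = real (m n) / real n" by (auto simp: c_def)
      have pos: "0 < real n" "0 < real (m n)" using elim(1) by auto
      have Nr: "N n + r n = m n" using elim(1) by (simp add: N_def)
      have km: "k n * m n \<le> n" by (simp add: k_def)
      have kc: "real (k n) * c\<^sup>2 \<le> 1"
        using k_le[of n] pos mult_right_mono[OF k_le[of n], of "c\<^sup>2"] by (simp add: c2)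
      have main: "norm (?A n - complex_of_real (exp (- ((t * c)\<^sup>2 * (real (k n) * ?W n) / 2)))) \<le>
        \<bar>t * c\<bar> * sqrt ((real n - real (k n) * real (N n)) * Gam n n) + real (k n) * (16 * rate (r n)) +
        real (k n) * (\<bar>t * c\<bar> ^ 3 / 6 * E3 n + ((t * c)\<^sup>2 * ?W n / 2)\<^sup>2)"
        using stationary_indicator.char_sum_gaussian[OF row[of n] Nr km, of "t * c"]
        unfolding E3_def xi_def var_def Gam_def c_def by (simp only: mult.assoc)
      have eq: "(t * c)\<^sup>2 * (real (k n) * ?W n) = t\<^sup>2 * (real (k n) * real (m n) / real n * ?W n)"
        by (simp add: power_mult_distrib c2)
      have b1: "\<bar>t * c\<bar> * sqrt ((real n - real (k n) * real (N n)) * Gam n n) \<le>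
        \<bar>t\<bar> * sqrt ((real (m n) / real n + real (r n) / real (m n)) * B)"
      proof -
        have "n \<le> k n * m n + m n"
          using elim(1) mod_less_divisor[of "m n" n] div_mult_mod_eq[of n "m n"] unfolding k_def by linarith
        then have "real n \<le> real (k n) * real (m n) + real (m n)" by (simp flip: of_nat_mult of_nat_add)
        moreover have "real (N n) = real (m n) - real (r n)" using Nr by linarith
        ultimately have "real n - real (k n) * real (N n) \<le> real (m n) + real (k n) * real (r n)"
          by (simp add: right_diff_distrib)
        also have "\<dots> \<le> real (m n) + real n / real (m n) * real (r n)"
          using k_le[of n] by (intro add_left_mono mult_right_mono) auto
        finally have "real n - real (k n) * real (N n) \<le> real (m n) + real n / real (m n) * real (r n)" .
        then have "(real n - real (k n) * real (N n)) / real n \<le> (real (m n) + real n / real (m n) * real (r n)) / real n"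
          using pos by (intro divide_right_mono) auto
        also have "\<dots> = real (m n) / real n + real (r n) / real (m n)"
          using pos by (simp add: add_divide_distrib)
        finally have fr: "(real n - real (k n) * real (N n)) / real n \<le> real (m n) / real n + real (r n) / real (m n)" .
        have "\<bar>t * c\<bar> * sqrt ((real n - real (k n) * real (N n)) * Gam n n) =
            \<bar>t\<bar> * sqrt (real (m n) / real n * ((real n - real (k n) * real (N n)) * Gam n n))"
          using c0 unfolding real_sqrt_mult[of "real (m n) / real n"] c_def[symmetric] by (simp add: abs_mult)
        also have "real (m n) / real n * ((real n - real (k n) * real (N n)) * Gam n n) =
          (real n - real (k n) * real (N n)) / real n * (real (m n) * Gam n n)" by simp
        also have "\<bar>t\<bar> * sqrt \<dots> \<le> \<bar>t\<bar> * sqrt ((real (m n) / real n + real (r n) / real (m n)) * B)"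
          using fr elim(2) B(1) Gam_nonneg[of n n] pos
          by (intro mult_left_mono real_sqrt_le_mono mult_mono) auto
        finally show ?thesis .
      qed
      have b2: "real (k n) * (16 * rate (r n)) \<le> 16 * (real n / real (m n) * rate (r n))"
        using mult_right_mono[OF k_le[of n] mixing_rate_nonneg[of X "r n"]] by simp
      have b3: "real (k n) * (\<bar>t * c\<bar> ^ 3 / 6 * E3 n) \<le> \<bar>t\<bar> ^ 3 / 6 * (c * E3 n)"
      proof -
        have "real (k n) * (\<bar>t * c\<bar> ^ 3 / 6 * E3 n) = (real (k n) * c\<^sup>2) * (\<bar>t\<bar> ^ 3 / 6 * (c * E3 n))"
          using c0 by (simp add: abs_mult power_mult_distrib power3_eq_cube power2_eq_square)
        also have "\<dots> \<le> 1 * (\<bar>t\<bar> ^ 3 / 6 * (c * E3 n))"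
          using kc c0 E3_nonneg[of n] by (intro mult_right_mono) auto
        finally show ?thesis by simp
      qed
      have b4: "real (k n) * ((t * c)\<^sup>2 * ?W n / 2)\<^sup>2 \<le> t ^ 4 / 4 * (real (m n) / real n * (?W n)\<^sup>2)"
      proof -
        have "real (k n) * ((t * c)\<^sup>2 * ?W n / 2)\<^sup>2 = (real (k n) * c\<^sup>2) * (t ^ 4 / 4 * (c\<^sup>2 * (?W n)\<^sup>2))"
          by (simp add: power_mult_distrib power_divide power2_eq_square power4_eq_xxxx)
        also have "\<dots> \<le> 1 * (t ^ 4 / 4 * (c\<^sup>2 * (?W n)\<^sup>2))"
          using kc by (intro mult_right_mono) auto
        finally show ?thesis by (simp add: c2)
      qed
      show ?case
        using main b1 b2 b3 b4 unfolding eq distrib_left c_def[symmetric] by linarith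
    qed
  qed
  moreover have "?g \<longlonglongrightarrow> complex_of_real (exp (- (t\<^sup>2 * (1 * sig2) / 2)))"
    by (intro tendsto_of_real tendsto_exp tendsto_minus tendsto_divide tendsto_mult tendsto_const k_m_over_n var_lim) simp
  ultimately have "(\<lambda>n. (?A n - ?g n) + ?g n) \<longlonglongrightarrow> 0 + complex_of_real (exp (- (t\<^sup>2 * (1 * sig2) / 2)))"
    by (rule tendsto_add)
  then show ?thesis by simp
qed

text \<open>
  Levy's continuity theorem; the limit variance may vanish, in which case the limit law is a point mass.
\<close>

theorem central_limit:
  assumes third: "(\<lambda>n. sqrt (real (m n) / real n) * E3 n) \<longlonglongrightarrow> 0"
  shows "weak_conv_m (\<lambda>n. distr M borel (\<lambda>\<omega>. sqrt (real (m n) / real n) * (\<Sum>s=1..n. xi n s \<omega>)))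
    (centred_normal sig2)"
proof (rule levy_continuity)
  have [measurable]: "xi n s \<in> borel_measurable M" for n s
    unfolding xi_def by (rule stationary_indicator.xi_measurable[OF row])
  have meas: "(\<lambda>\<omega>. sqrt (real (m n) / real n) * (\<Sum>s=1..n. xi n s \<omega>)) \<in> borel_measurable M" for n
    by measurable
  show "real_distribution (distr M borel (\<lambda>\<omega>. sqrt (real (m n) / real n) * (\<Sum>s=1..n. xi n s \<omega>)))" for n
    using meas by (rule real_distribution_distr)
  show "real_distribution (centred_normal sig2)"
    by (rule real_distribution_centred_normal[OF sig2_nonneg])
  fix t
  have "char (distr M borel (\<lambda>\<omega>. sqrt (real (m n) / real n) * (\<Sum>s=1..n. xi n s \<omega>))) t =
      expectation (\<lambda>\<omega>. iexp (t * sqrt (real (m n) / real n) * (\<Sum>s=1..n. xi n s \<omega>)))" for n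
    unfolding char_def using meas[of n] by (subst integral_distr) (auto simp: mult.assoc)
  then show "(\<lambda>n. char (distr M borel (\<lambda>\<omega>. sqrt (real (m n) / real n) * (\<Sum>s=1..n. xi n s \<omega>))) t)
      \<longlonglongrightarrow> char (centred_normal sig2) t"
    using char_limit[OF third, of t] by (simp add: char_centred_normal[OF sig2_nonneg])
qed

end

section \<open>The central limit theorem for the tail estimator\<close>

lemma S_stat_eq:
  "S_stat M X a m C n \<omega> = sqrt (real (m n) / real n) *
    (\<Sum>t=1..n. indicator (exceed X (a (m n)) C (int t)) \<omega> - measure M (exceed X (a (m n)) C 0 \<inter> space M))"
proof (cases "n = 0 \<or> m n = 0")
  case True
  then show ?thesis by (auto simp: S_stat_def)
next
  case False
  then have pos: "0 < real n" "0 < real (m n)" by auto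
  define u v where "u = sqrt (real n)" and "v = sqrt (real (m n))"
  have uv: "0 < u" "0 < v" "real n = u * u" "real (m n) = v * v" using pos by (auto simp: u_def v_def)
  have s: "sqrt (real n / real (m n)) = u / v" "sqrt (real (m n) / real n) = v / u"
    by (simp_all add: u_def v_def real_sqrt_divide)
  show ?thesis
    unfolding S_stat_def P_hat_def s sum_subtractf sum_constant card_atLeastAtMost
    using uv(1,2) by (simp add: uv(3,4) right_diff_distrib field_simps)
qed

theorem theorem3p2:
  fixes M :: "'a measure"
    and X :: "int \<Rightarrow> 'a \<Rightarrow> real ^ 'd"
    and \<alpha> :: real
    and a :: "nat \<Rightarrow> real"
    and C :: "(ereal ^ 'd) set"
    and m r :: "nat \<Rightarrow> nat"
  assumes "prob_space M"
    and "strictly_stationary M X"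
    and "regularly_varying M X \<alpha>"
    and "mono_on {1..} a" and "filterlim a at_top sequentially"
    and "(\<lambda>n. measure M {\<omega> \<in> space M. norm (X 0 \<omega>) > a n}) \<sim>[sequentially] (\<lambda>n. 1 / real n)"
    and "C \<in> sets borel"
    and "bounded_away_from_zero C"
    and "continuity_set (top_of_set (- {0})) (tail_measure1 M X a) C"
    and "\<And>h. h \<ge> 1 \<Longrightarrow>
           continuity_set (block_top0 (h + 1)) (tail_measure M X a (h + 1)) (ends_in h C)"
    and "alpha_mixing M X"
    and "filterlim m at_top sequentially" and "filterlim r at_top sequentially"
    and "(\<lambda>n. real (m n) / real n) \<longlonglongrightarrow> 0"
    and "(\<lambda>n. real (r n) / real (m n)) \<longlonglongrightarrow> 0"
    and "summable (mixing_rate M X)"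
    and "(\<lambda>n. real (m n) * (\<Sum>h. mixing_rate M X (r n + h))) \<longlonglongrightarrow> 0"
    and "\<And>\<epsilon>. \<epsilon> > 0 \<Longrightarrow>
           (\<lambda>k. limsup (\<lambda>n. ereal (real (m n) * (\<Sum>h=k..r n.
              measure M {\<omega> \<in> space M. norm (X (int h) \<omega>) > \<epsilon> * a (m n) \<and>
                                        norm (X 0 \<omega>) > \<epsilon> * a (m n)})))) \<longlonglongrightarrow> 0"
    and "(\<lambda>n. real n / real (m n) * mixing_rate M X (r n)) \<longlonglongrightarrow> 0"
    and "(\<lambda>n. real (m n)) \<in> o(\<lambda>n. real n powr (1 / 3)) \<or>
         ((\<lambda>n. real (m n) ^ 4 / real n * (\<Sum>j=r n..m n. mixing_rate M X j)) \<longlonglongrightarrow> 0 \<and>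
          (\<lambda>n. real (m n) * real (r n) ^ 3 / real n) \<longlonglongrightarrow> 0)"
  shows "(\<forall>n \<omega>. S_stat M X a m C n \<omega> = sqrt (real (m n) / real n) *
             (\<Sum>t=1..n. indicator (exceed X (a (m n)) C (int t)) \<omega>
                          - measure M (exceed X (a (m n)) C 0 \<inter> space M))) \<and>
         summable (\<lambda>h. tau M X a C (Suc h)) \<and>
         weak_conv_m (\<lambda>n. distr M borel (S_stat M X a m C n)) (centred_normal (sigma2 M X a C))"
proof (intro conjI allI)
  interpret prob_space M by fact
  note X = \<open>strictly_stationary M X\<close> and rv = \<open>regularly_varying M X \<alpha>\<close>
    and a_top = \<open>filterlim a at_top sequentially\<close> and m_top = \<open>filterlim m at_top sequentially\<close>
    and an = assms(6) and Cb = \<open>C \<in> sets borel\<close> and C0 = \<open>bounded_away_from_zero C\<close>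
  define D where "D n = scaled_preimage (a (m n)) C" for n
  obtain \<epsilon>0 where \<epsilon>0: "0 < \<epsilon>0" "C \<subseteq> {x. ext_norm x > ereal \<epsilon>0}"
    using C0 by (auto simp: bounded_away_from_zero_def)
  have Db: "D n \<in> sets borel" for n
    unfolding D_def by (rule scaled_preimage_borel[OF Cb])
  have lim_marginal: "(\<lambda>n. real (m n) * prob {\<omega> \<in> space M. X 0 \<omega> \<in> D n}) \<longlonglongrightarrow> measure (tail_measure1 M X a) C"
    unfolding D_def by (rule filterlim_compose[OF tail_measure1_limit[OF X rv a_top an Cb C0 assms(9)] m_top])
  have lim_pair: "(\<lambda>n. real (m n) * prob {\<omega> \<in> space M. X 0 \<omega> \<in> D n \<and> X (int h) \<omega> \<in> D n}) \<longlonglongrightarrow> tau M X a C h"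
    if h: "1 \<le> h" for h
    unfolding D_def by (rule filterlim_compose[OF tau_limit[OF X rv a_top an Cb C0 h assms(10)[OF h]] m_top])
  have anticluster: "\<exists>k. \<forall>\<^sub>F n in sequentially.
      real (m n) * (\<Sum>h=k..r n. prob {\<omega> \<in> space M. X 0 \<omega> \<in> D n \<and> X (int h) \<omega> \<in> D n}) \<le> \<epsilon>"
    if \<epsilon>: "0 < \<epsilon>" for \<epsilon>
  proof -
    let ?F = "\<lambda>k n. real (m n) * (\<Sum>h=k..r n.
              measure M {\<omega> \<in> space M. norm (X (int h) \<omega>) > \<epsilon>0 * a (m n) \<and> norm (X 0 \<omega>) > \<epsilon>0 * a (m n)})"
    have "(\<lambda>k. limsup (\<lambda>n. ereal (?F k n))) \<longlonglongrightarrow> 0" by (rule assms(18)[OF \<epsilon>0(1)])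
    then have "\<forall>\<^sub>F k in sequentially. limsup (\<lambda>n. ereal (?F k n)) < ereal \<epsilon>"
      using \<epsilon> by (intro order_tendstoD(2)[where y=0]) auto
    then obtain k where "limsup (\<lambda>n. ereal (?F k n)) < ereal \<epsilon>"
      by (auto simp: eventually_sequentially)
    then have "\<forall>\<^sub>F n in sequentially. ereal (?F k n) < ereal \<epsilon>" by (rule Limsup_lessD)
    moreover have "\<forall>\<^sub>F n in sequentially. 0 < a (m n)"
      using filterlim_compose[OF a_top m_top] by (simp add: filterlim_at_top_dense)
    ultimately have "\<forall>\<^sub>F n in sequentially.
      real (m n) * (\<Sum>h=k..r n. prob {\<omega> \<in> space M. X 0 \<omega> \<in> D n \<and> X (int h) \<omega> \<in> D n}) \<le> \<epsilon>"
    proof eventually_elim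
      case (elim n)
      have "real (m n) * (\<Sum>h=k..r n. prob {\<omega> \<in> space M. X 0 \<omega> \<in> D n \<and> X (int h) \<omega> \<in> D n}) \<le> ?F k n"
      proof (intro mult_left_mono sum_mono finite_measure_mono)
        fix h
        show "{\<omega> \<in> space M. X 0 \<omega> \<in> D n \<and> X (int h) \<omega> \<in> D n} \<subseteq>
          {\<omega> \<in> space M. norm (X (int h) \<omega>) > \<epsilon>0 * a (m n) \<and> norm (X 0 \<omega>) > \<epsilon>0 * a (m n)}"
          using scaled_preimage_norm[OF \<epsilon>0(2) elim(2)] by (auto simp: D_def)
        have [measurable]: "X t \<in> borel_measurable M" for t using X by (rule strictly_stationary_measurable)
        show "{\<omega> \<in> space M. norm (X (int h) \<omega>) > \<epsilon>0 * a (m n) \<and> norm (X 0 \<omega>) > \<epsilon>0 * a (m n)} \<in> sets M"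
          by measurable
      qed auto
      then show ?case using elim(1) by simp
    qed
    then show ?thesis by blast
  qed
  interpret A: indicator_array M X D m r "measure (tail_measure1 M X a) C" "tau M X a C"
    by (intro indicator_array.intro indicator_array_axioms.intro prob_space_axioms X Db m_top assms(13-17)
        assms(19) lim_marginal lim_pair anticluster)
  show "S_stat M X a m C n \<omega> = sqrt (real (m n) / real n) *
             (\<Sum>t=1..n. indicator (exceed X (a (m n)) C (int t)) \<omega>
                          - measure M (exceed X (a (m n)) C 0 \<inter> space M))" for n \<omega>
    by (rule S_stat_eq)
  show "summable (\<lambda>h. tau M X a C (Suc h))" by (rule A.tau_summable)
  have third: "(\<lambda>n. sqrt (real (m n) / real n) * A.E3 n) \<longlonglongrightarrow> 0"
    using assms(20) A.third_moment_small_blocks A.third_moment_interpolation[OF A.fourth_moment_lim] by blast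
  have xi: "A.xi n s \<omega> = indicator (exceed X (a (m n)) C (int s)) \<omega> - measure M (exceed X (a (m n)) C 0 \<inter> space M)" for n s \<omega>
  proof -
    have "exceed X (a (m n)) C 0 \<inter> space M = {\<omega> \<in> space M. X 0 \<omega> \<in> D n}" by (auto simp: exceed_eq D_def)
    then show ?thesis
      unfolding A.xi_def stationary_indicator.xi_def[OF A.row] stationary_indicator.p_def[OF A.row]
      by (simp add: exceed_eq D_def indicator_def)
  qed
  have "S_stat M X a m C n = (\<lambda>\<omega>. sqrt (real (m n) / real n) * (\<Sum>s=1..n. A.xi n s \<omega>))" for n
    by (rule ext) (simp only: S_stat_eq xi)
  moreover have "sigma2 M X a C = A.sig2" by (simp add: sigma2_def A.sig2_def)
  ultimately show "weak_conv_m (\<lambda>n. distr M borel (S_stat M X a m C n)) (centred_normal (sigma2 M X a C))"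
    using A.central_limit[OF third] by simp
qed

end
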